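(* Let $V\in C^1(\mathbb{R}^d)$ be such that $\mu(dx)=e^{-V(x)}dx$ is a probability measure on $\mathbb{R}^d$, and let $\nu$ be a probability measure on $\mathbb{R}^d$. Assume that $\mu$ satisfies the log-Sobolev inequality with some constant $C>0$, i.e. $$\mu(f^2\log f^2)\le C\mu(|\nabla f|^2),\quad f\in C_b^1(\mathbb{R}^d),\ \mu(f^2)=1.$$ Assume that $$\Phi_\nu(x):=\int_{\mathbb{R}^d}(\nabla e^{-V})(x-z)\,\nu(dz),\quad x\in\mathbb{R}^d,$$ is well-defined and continuous, and that there exists a constant $\delta>1$ such that $$\int_{\mathbb{R}^d}\exp\left\{\frac{\delta C}{4}\Big(\int_{\mathbb{R}^d}|\nabla V(x)-\nabla V(x-z)|\,\nu_x(dz)\Big)^2\right\}\mu(dx)<\infty.$$ Then $\mu*\nu$ also satisfies the log-Sobolev inequality, i.e. there is a constant $C'>0$ such that $$(\mu*\nu)(f^2\log f^2)\le C'(\mu*\nu)(|\nabla f|^2),\quad f\in C_b^1(\mathbb{R}^d),\ (\mu*\nu)(f^2)=1.$$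
   Context: For a measure $m$ and a function $g$, $m(g):=\int g\,dm$. The convolution is $(\mu*\nu)(A)=\int 1_A(x+y)\,\mu(dx)\nu(dy)$. $C_b^1(\mathbb{R}^d)$ denotes the bounded $C^1$ functions on $\mathbb{R}^d$ with bounded gradient. Set $p_\nu(x)=\int_{\mathbb{R}^d}e^{-V(x-z)}\,\nu(dz)$, and for $x\in\mathbb{R}^d$ let $\nu_x$ be the probability measure $\nu_x(dz)=\frac{1}{p_\nu(x)}e^{-V(x-z)}\,\nu(dz)$. *)

theory Defs
  imports "HOL-Probability.Probability"
begin

definition grad :: "('a::real_inner \<Rightarrow> real) \<Rightarrow> 'a \<Rightarrow> 'a" where
  "grad f x = (THE D. GDERIV f x :> D)"

definition C1 :: "('a::real_inner \<Rightarrow> real) set" where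
  "C1 = {f. (\<forall>x. f differentiable (at x)) \<and> continuous_on UNIV (grad f)}"

definition C1b :: "('a::real_inner \<Rightarrow> real) set" where
  "C1b = {f \<in> C1. bounded (range f) \<and> bounded (range (grad f))}"

lemma GDERIV_imp_grad_eq:
  assumes "GDERIV f x :> D"
  shows "grad f x = D"
  unfolding grad_def
proof (rule the_equality)
  show "GDERIV f x :> D" by (fact assms)
next
  fix D' assume "GDERIV f x :> D'"
  then have "(\<lambda>h. h \<bullet> D') = (\<lambda>h. h \<bullet> D)"
    using assms unfolding gderiv_def by (rule has_derivative_unique)
  then have "\<forall>h. h \<bullet> D' = h \<bullet> D"
    by (rule fun_cong[THEN allI])
  then show "D' = D"
    by (rule vector_eq_ldot[THEN iffD1])
qed

lemma differentiable_imp_GDERIV_grad: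
  fixes f :: "'a::euclidean_space \<Rightarrow> real"
  assumes "f differentiable (at x)"
  shows "GDERIV f x :> grad f x"
proof -
  obtain f' where f': "(f has_derivative f') (at x)"
    using assms by (auto simp: differentiable_def)
  then interpret linear f' by (rule has_derivative_linear)
  define D where "D = (\<Sum>b\<in>Basis. f' b *\<^sub>R b)"
  have "f' = (\<lambda>h. h \<bullet> D)"
  proof
    fix h
    have "f' h = f' (\<Sum>b\<in>Basis. (h \<bullet> b) *\<^sub>R b)"
      by (simp only: euclidean_representation)
    also have "\<dots> = (\<Sum>b\<in>Basis. (h \<bullet> b) * f' b)"
      by (simp only: sum scale real_scaleR_def)
    also have "\<dots> = h \<bullet> D"
      by (simp only: D_def inner_sum_right inner_scaleR_right mult.commute)
    finally show "f' h = h \<bullet> D" .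
  qed
  then have "GDERIV f x :> D"
    using f' by (simp add: gderiv_def)
  then show ?thesis
    by (simp add: GDERIV_imp_grad_eq)
qed

text \<open>
  The conventions \<open>ln 0 = 0\<close> and \<open>0 * y = 0\<close> give the usual value \<open>0\<close> to \<open>0 log 0\<close>. For
  \<open>f \<in> C1b\<close> and a finite Borel measure \<open>m\<close> all integrands below are bounded and measurable, hence
  integrable, so the Bochner integrals carry no junk values.
\<close>

definition log_sobolev :: "'a::euclidean_space measure \<Rightarrow> real \<Rightarrow> bool" where
  "log_sobolev m C \<longleftrightarrow>
    (\<forall>f\<in>C1b. (\<integral>x. (f x)\<^sup>2 \<partial>m) = 1 \<longrightarrow>
      (\<integral>x. (f x)\<^sup>2 * ln ((f x)\<^sup>2) \<partial>m) \<le> C * (\<integral>x. (norm (grad f x))\<^sup>2 \<partial>m))"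

definition gibbs :: "('a::euclidean_space \<Rightarrow> real) \<Rightarrow> 'a measure" where
  "gibbs V = density lborel (\<lambda>x. ennreal (exp (- V x)))"

text \<open>
  \<open>p_conv V \<nu> x\<close> is the normalising constant of \<open>nu_at V \<nu> x\<close>, which is a probability measure
  exactly when \<open>z \<mapsto> exp (- V (x - z))\<close> is \<open>\<nu>\<close>-integrable; otherwise \<open>p_conv V \<nu> x = 0\<close>.
\<close>

definition p_conv :: "('a::euclidean_space \<Rightarrow> real) \<Rightarrow> 'a measure \<Rightarrow> 'a \<Rightarrow> real" where
  "p_conv V \<nu> x = (\<integral>z. exp (- V (x - z)) \<partial>\<nu>)"

definition nu_at :: "('a::euclidean_space \<Rightarrow> real) \<Rightarrow> 'a measure \<Rightarrow> 'a \<Rightarrow> 'a measure" where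
  "nu_at V \<nu> x = density \<nu> (\<lambda>z. ennreal (1 / p_conv V \<nu> x * exp (- V (x - z))))"

definition Phi :: "('a::euclidean_space \<Rightarrow> real) \<Rightarrow> 'a measure \<Rightarrow> 'a \<Rightarrow> 'a" where
  "Phi V \<nu> x = (\<integral>z. grad (\<lambda>y. exp (- V y)) (x - z) \<partial>\<nu>)"

end

theory Submission
  imports Defs "HOL-Real_Asymp.Real_Asymp"
begin

text \<open>
  Let \<open>\<mu> = gibbs V\<close>. The convolution of \<open>\<mu>\<close> and \<open>\<nu>\<close> has the Lebesgue density \<open>p = p_conv V \<nu>\<close>, so with respect to
  \<open>\<mu>\<close> it has the density \<open>exp W\<close>, where \<open>W = V + ln p\<close>. If \<open>p\<close> has the gradient \<open>Phi V \<nu>\<close>, then the gradient of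
  \<open>W\<close> at \<open>x\<close> is the mean of \<open>grad V x - grad V (x - z)\<close> under \<open>nu_at V \<nu> x\<close>. The moment assumption therefore implies
  that \<open>exp (k * (norm (grad W x))\<^sup>2)\<close> is \<open>\<mu>\<close>-integrable for some \<open>k > C / 4\<close>, and three things remain
  to be proved.

  The first is a perturbation theorem (locale \<open>log_sobolev_weight\<close>). The inequality for \<open>\<mu>\<close> is applied to
  \<open>f * exp (W / 2)\<close>. The energy of the weight that appears is absorbed by the entropy, by the
  variational inequality \<open>entropy_variational\<close> and \<open>k > C / 4\<close>. The result is a defective
  inequality, with an additional multiple of the second moment of \<open>f\<close> on the right-hand side. It requires
  \<open>exp (- W)\<close> to be \<open>\<mu>\<close>-integrable, which again follows from the log-Sobolev inequality for \<open>\<mu>\<close>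
  (\<open>exp_neg_weight_integrable\<close>).

  The second is that a defective inequality can be tightened (\<open>tight_log_sobolev\<close>). The density of the convolution
  is continuous and positive after a change on a null set, so a Poincare inequality holds on every ball
  (\<open>local_poincare\<close>). The defective inequality controls the mass outside a large ball, which gives a global
  Poincare inequality, and a weak form of the Rothaus lemma removes the defect.

  The third is the regularity of \<open>p\<close> (locale \<open>gibbs_convolution\<close>). That \<open>Phi V \<nu>\<close> is defined everywhere
  and continuous does not by itself allow differentiation under the integral, since no domination is assumed. What is
  available is a locally integrable function, the \<open>rate\<close>, such that the gradients of all truncated densities are at most
  \<open>rate * p\<close>. Along a segment on which the rate is integrable, Baire's theorem and a Gronwall estimate show
  that \<open>p\<close> is bounded, and then dominated convergence yields the fundamental theorem of calculus for \<open>p\<close> and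
  \<open>Phi V \<nu>\<close> (\<open>limit_ftc\<close>). Almost every segment is of this kind, so \<open>p\<close> agrees almost everywhere with a
  continuously differentiable function whose gradient is \<open>Phi V \<nu>\<close> (\<open>C1_density\<close>). Agreement almost everywhere is all
  that the perturbation theorem needs.
\<close>


section \<open>Gradients of continuously differentiable functions\<close>

lemma C1_I:
  assumes "\<And>x. GDERIV f x :> F x" "continuous_on UNIV F"
  shows "f \<in> C1" "grad f = F"
proof -
  have g: "grad f = F" using assms(1) GDERIV_imp_grad_eq by blast
  then show "grad f = F" .
  show "f \<in> C1" unfolding C1_def using assms g
    by (auto simp: gderiv_def differentiable_def)
qed

lemma C1_D:
  fixes f :: "'a::euclidean_space \<Rightarrow> real"
  assumes "f \<in> C1"
  shows "GDERIV f x :> grad f x" "continuous_on UNIV (grad f)" "continuous_on UNIV f"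
    "grad f \<in> borel_measurable borel" "f \<in> borel_measurable borel"
proof -
  show 1: "GDERIV f x :> grad f x" using assms
    by (auto simp: C1_def intro: differentiable_imp_GDERIV_grad)
  show 2: "continuous_on UNIV (grad f)" using assms by (auto simp: C1_def)
  show 3: "continuous_on UNIV f" using assms
    by (auto simp: C1_def intro!: continuous_at_imp_continuous_on differentiable_imp_continuous_within)
  show "grad f \<in> borel_measurable borel" "f \<in> borel_measurable borel"
    using 2 3 by (auto intro: borel_measurable_continuous_onI)
qed

lemma C1_mult:
  fixes f g :: "'a::euclidean_space \<Rightarrow> real"
  assumes f: "f \<in> C1" and g: "g \<in> C1"
  shows "(\<lambda>x. f x * g x) \<in> C1" "grad (\<lambda>x. f x * g x) = (\<lambda>x. f x *\<^sub>R grad g x + g x *\<^sub>R grad f x)"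
proof -
  have *: "GDERIV (\<lambda>x. f x * g x) x :> f x *\<^sub>R grad g x + g x *\<^sub>R grad f x" for x
    by (intro GDERIV_mult C1_D assms)
  have **: "continuous_on UNIV (\<lambda>x. f x *\<^sub>R grad g x + g x *\<^sub>R grad f x)"
    by (intro continuous_intros C1_D assms)
  show "(\<lambda>x. f x * g x) \<in> C1" "grad (\<lambda>x. f x * g x) = (\<lambda>x. f x *\<^sub>R grad g x + g x *\<^sub>R grad f x)"
    using C1_I[OF * **] by auto
qed

lemma C1_compose:
  fixes f :: "'a::euclidean_space \<Rightarrow> real"
  assumes f: "f \<in> C1" and d: "\<And>x. DERIV g (f x) :> g' (f x)" and c: "continuous_on (range f) g'"
  shows "(\<lambda>x. g (f x)) \<in> C1" "grad (\<lambda>x. g (f x)) = (\<lambda>x. g' (f x) *\<^sub>R grad f x)"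
proof -
  have *: "GDERIV (\<lambda>x. g (f x)) x :> g' (f x) *\<^sub>R grad f x" for x
    by (intro GDERIV_DERIV_compose C1_D assms)
  have **: "continuous_on UNIV (\<lambda>x. g' (f x) *\<^sub>R grad f x)"
    by (intro continuous_intros C1_D continuous_on_compose2[OF c] assms) auto
  show "(\<lambda>x. g (f x)) \<in> C1" "grad (\<lambda>x. g (f x)) = (\<lambda>x. g' (f x) *\<^sub>R grad f x)"
    using C1_I[OF * **] by auto
qed

lemma C1_add_const:
  fixes f :: "'a::euclidean_space \<Rightarrow> real"
  assumes f: "f \<in> C1"
  shows "(\<lambda>x. f x - a) \<in> C1" "grad (\<lambda>x. f x - a) = grad f"
proof -
  have d: "DERIV (\<lambda>s. s - a) (f x) :> 1" for x by (auto intro!: derivative_eq_intros)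
  show "(\<lambda>x. f x - a) \<in> C1" "grad (\<lambda>x. f x - a) = grad f"
    using C1_compose[OF f d] by auto
qed

lemma C1_cmult:
  fixes f :: "'a::euclidean_space \<Rightarrow> real"
  assumes f: "f \<in> C1"
  shows "(\<lambda>x. a * f x) \<in> C1" "grad (\<lambda>x. a * f x) = (\<lambda>x. a *\<^sub>R grad f x)"
proof -
  have d: "DERIV (\<lambda>s. a * s) (f x) :> a" for x by (auto intro!: derivative_eq_intros)
  show "(\<lambda>x. a * f x) \<in> C1" "grad (\<lambda>x. a * f x) = (\<lambda>x. a *\<^sub>R grad f x)"
    using C1_compose[OF f d] by auto
qed

lemma C1_add:
  fixes f g :: "'a::euclidean_space \<Rightarrow> real"
  assumes f: "f \<in> C1" and g: "g \<in> C1"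
  shows "(\<lambda>x. f x + g x) \<in> C1" "grad (\<lambda>x. f x + g x) = (\<lambda>x. grad f x + grad g x)"
proof -
  have *: "GDERIV (\<lambda>x. f x + g x) x :> grad f x + grad g x" for x
    by (intro GDERIV_add C1_D assms)
  have **: "continuous_on UNIV (\<lambda>x. grad f x + grad g x)"
    by (intro continuous_intros C1_D assms)
  show "(\<lambda>x. f x + g x) \<in> C1" "grad (\<lambda>x. f x + g x) = (\<lambda>x. grad f x + grad g x)"
    using C1_I[OF * **] by auto
qed

lemma C1b_I: "f \<in> C1 \<Longrightarrow> (\<And>x. \<bar>f x\<bar> \<le> K) \<Longrightarrow> (\<And>x. norm (grad f x) \<le> K') \<Longrightarrow> f \<in> C1b"
  by (auto simp: C1b_def intro!: boundedI)

lemma C1b_D: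
  assumes "f \<in> C1b"
  obtains K where "f \<in> C1" "K > 0" "\<And>x. \<bar>f x\<bar> \<le> K" "\<And>x. norm (grad f x) \<le> K"
proof -
  obtain a b where "\<And>x. \<bar>f x\<bar> \<le> a" "\<And>x. norm (grad f x) \<le> b"
    using assms unfolding C1b_def bounded_iff by auto
  then show ?thesis using that[of "max 1 (max a b)"] assms
    by (auto simp: C1b_def le_max_iff_disj)
qed

lemma continuous_bounded_cball:
  fixes F :: "'a::euclidean_space \<Rightarrow> 'b::real_normed_vector"
  assumes F: "continuous_on UNIV F"
  obtains b where "\<And>y. norm y \<le> r \<Longrightarrow> norm (F y) \<le> b"
proof -
  have "compact (F ` cball 0 r)" by (auto intro!: compact_continuous_image continuous_on_subset[OF F])
  then obtain b where b: "\<forall>y\<in>F ` cball 0 r. norm y \<le> b" using compact_imp_bounded bounded_iff by blast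
  show thesis by (rule that[of b]) (use b in auto)
qed

lemma C1b_continuous_support:
  fixes f :: "'a::euclidean_space \<Rightarrow> real"
  assumes f: "f \<in> C1" and s: "\<And>x. norm x \<ge> r \<Longrightarrow> f x = 0 \<and> grad f x = 0"
  shows "f \<in> C1b"
proof -
  obtain a where a: "\<And>x. norm x \<le> r \<Longrightarrow> \<bar>f x\<bar> \<le> a"
    using continuous_bounded_cball[OF C1_D(3)[OF f]] unfolding real_norm_def by blast
  obtain b where b: "\<And>x. norm x \<le> r \<Longrightarrow> norm (grad f x) \<le> b"
    using continuous_bounded_cball[OF C1_D(2)[OF f]] by blast
  show ?thesis
  proof (rule C1b_I[OF f, of "max 0 a" "max 0 b"])
    show "\<bar>f x\<bar> \<le> max 0 a" for x using a[of x] s[of x] by (cases "norm x \<le> r") auto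
    show "norm (grad f x) \<le> max 0 b" for x using b[of x] s[of x] by (cases "norm x \<le> r") auto
  qed
qed

section \<open>Cutoff functions\<close>

lemma DERIV_max_0_square: "DERIV (\<lambda>s::real. (max 0 s)\<^sup>2) s :> 2 * max 0 s"
proof -
  consider "s < 0" | "s > 0" | "s = 0" by linarith
  then show ?thesis
  proof cases
    case 1
    have "DERIV (\<lambda>_. 0) s :> (0::real)" by simp
    moreover have "\<forall>\<^sub>F t in nhds s. (0::real) = (max 0 t)\<^sup>2"
      using eventually_nhds_in_open[of "{..<0}" s] 1 by (auto elim!: eventually_mono)
    ultimately have "DERIV (\<lambda>s. (max 0 s)\<^sup>2) s :> 0"
      using DERIV_cong_ev[OF refl _ refl, of "\<lambda>_. 0" "\<lambda>t. (max 0 t)\<^sup>2" s 0] by blast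
    then show ?thesis using 1 by simp
  next
    case 2
    have "DERIV (\<lambda>t. t^2) s :> 2 * s" by (auto intro!: derivative_eq_intros)
    moreover have "\<forall>\<^sub>F t in nhds s. t^2 = (max 0 t)\<^sup>2"
      using eventually_nhds_in_open[of "{0<..}" s] 2 by (auto elim!: eventually_mono)
    ultimately have "DERIV (\<lambda>s. (max 0 s)\<^sup>2) s :> 2 * s"
      using DERIV_cong_ev[OF refl _ refl, of "\<lambda>t. t^2" "\<lambda>t. (max 0 t)\<^sup>2" s "2 * s"] by blast
    then show ?thesis using 2 by simp
  next
    case 3
    have "(\<lambda>h::real. (max 0 h)\<^sup>2 / h) \<midarrow>0\<rightarrow> 0"
    proof (rule Lim_null_comparison[where g="\<lambda>h. \<bar>h\<bar>"])
      show "\<forall>\<^sub>F h in at 0. norm ((max 0 h)\<^sup>2 / h) \<le> \<bar>h\<bar>"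
        by (intro always_eventually) (auto simp: max_def power2_eq_square abs_mult)
      show "((\<lambda>h::real. \<bar>h\<bar>) \<longlongrightarrow> 0) (at 0)" by (auto intro!: tendsto_eq_intros)
    qed
    then show ?thesis using 3 by (simp add: DERIV_def)
  qed
qed

text \<open>Squaring the positive part makes the bump continuously differentiable across the boundary of its
  support. The offset 1 keeps the radius positive for \<open>n = 0\<close>.\<close>

definition cutoff :: "nat \<Rightarrow> 'a::euclidean_space \<Rightarrow> real" where
  "cutoff n x = (max 0 (1 - (norm x)\<^sup>2 / (real n + 1)\<^sup>2))\<^sup>2"

lemma cutoff_C1:
  shows "cutoff n \<in> (C1 :: ('a::euclidean_space \<Rightarrow> real) set)"
    "grad (cutoff n) = (\<lambda>x::'a. (- 4 / (real n + 1)\<^sup>2 * max 0 (1 - (norm x)\<^sup>2 / (real n + 1)\<^sup>2)) *\<^sub>R x)"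
proof -
  have "GDERIV (\<lambda>x. 1 - (norm x)\<^sup>2 / (real n + 1)\<^sup>2) x :> (- 2 / (real n + 1)\<^sup>2) *\<^sub>R x" for x :: 'a
  proof -
    have 1: "GDERIV (\<lambda>x. x \<bullet> x) x :> 2 *\<^sub>R x"
      unfolding gderiv_def by (auto intro!: derivative_eq_intros simp: inner_commute)
    have 2: "DERIV (\<lambda>s. 1 - s / (real n + 1)\<^sup>2) (x \<bullet> x) :> - 1 / (real n + 1)\<^sup>2"
      by (rule DERIV_cong, (rule DERIV_diff DERIV_const DERIV_cdivide DERIV_ident)+) simp
    show ?thesis
      using GDERIV_DERIV_compose[OF 1 2] by (simp add: power2_norm_eq_inner)
  qed
  from GDERIV_DERIV_compose[OF this DERIV_max_0_square]
  have *: "GDERIV (cutoff n) x :> (- 4 / (real n + 1)\<^sup>2 * max 0 (1 - (norm x)\<^sup>2 / (real n + 1)\<^sup>2)) *\<^sub>R x" for x :: 'a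
    unfolding cutoff_def[abs_def] by (rule GDERIV_subst) simp
  have **: "continuous_on UNIV (\<lambda>x::'a. (- 4 / (real n + 1)\<^sup>2 * max 0 (1 - (norm x)\<^sup>2 / (real n + 1)\<^sup>2)) *\<^sub>R x)"
    by (intro continuous_intros) (auto simp: add_nonneg_eq_0_iff)
  show "cutoff n \<in> (C1 :: ('a \<Rightarrow> real) set)"
    "grad (cutoff n) = (\<lambda>x::'a. (- 4 / (real n + 1)\<^sup>2 * max 0 (1 - (norm x)\<^sup>2 / (real n + 1)\<^sup>2)) *\<^sub>R x)"
    using C1_I[OF * **] by auto
qed

lemma cutoff_bounds: "0 \<le> cutoff n x" "cutoff n x \<le> 1"
proof -
  show "0 \<le> cutoff n x" by (simp add: cutoff_def)
  have "max 0 (1 - (norm x)\<^sup>2 / (real n + 1)\<^sup>2) \<le> 1" by simp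
  then show "cutoff n x \<le> 1" unfolding cutoff_def by (intro power_le_one) auto
qed

lemma cutoff_support:
  assumes "norm x \<ge> real n + 1" shows "cutoff n x = 0" "grad (cutoff n) x = 0"
proof -
  have "(real n + 1)\<^sup>2 \<le> (norm x)\<^sup>2" using assms by (intro power_mono) auto
  then have "1 - (norm x)\<^sup>2 / (real n + 1)\<^sup>2 \<le> 0" by (simp add: field_simps)
  then show "cutoff n x = 0" "grad (cutoff n) x = 0" by (simp_all add: cutoff_def cutoff_C1 max_def)
qed

lemma grad_cutoff_bound: "norm (grad (cutoff n) x) \<le> 4 / (real n + 1)"
proof (cases "norm x \<ge> real n + 1")
  case True then show ?thesis by (simp add: cutoff_support)
next
  case False
  have "\<bar>max 0 (1 - (norm x)\<^sup>2 / (real n + 1)\<^sup>2)\<bar> \<le> 1" by simp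
  then have "norm (grad (cutoff n) x) \<le> 4 / (real n + 1)\<^sup>2 * 1 * norm x"
    unfolding cutoff_C1 norm_scaleR abs_mult by (intro mult_right_mono mult_mono) auto
  also have "\<dots> \<le> 4 / (real n + 1)\<^sup>2 * 1 * (real n + 1)" using False by (intro mult_left_mono) auto
  also have "\<dots> = 4 / (real n + 1)"
    using nonzero_mult_divide_mult_cancel_right[of "real n + 1" 4 "real n + 1"] by (simp add: power2_eq_square)
  finally show ?thesis .
qed

lemma cutoff_tendsto: "(\<lambda>n. cutoff n x) \<longlonglongrightarrow> 1"
proof -
  have "(\<lambda>n. (max 0 (1 - (norm x)\<^sup>2 / (real n + 1)\<^sup>2))\<^sup>2) \<longlonglongrightarrow> (max 0 (1 - 0))\<^sup>2"
    by (intro tendsto_intros) real_asymp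
  then show ?thesis by (simp add: cutoff_def)
qed

lemma grad_cutoff_tendsto: "(\<lambda>n. grad (cutoff n) x) \<longlonglongrightarrow> 0"
proof (rule Lim_null_comparison)
  show "\<forall>\<^sub>F n in sequentially. norm (grad (cutoff n) x) \<le> 4 / (real n + 1)"
    by (simp add: grad_cutoff_bound)
  show "(\<lambda>n. 4 / (real n + 1)) \<longlonglongrightarrow> 0" by real_asymp
qed

section \<open>Entropy\<close>

text \<open>The subtracted term makes \<open>ent M\<close> homogeneous of degree one, so inequalities between the
  entropy of \<open>f\<^sup>2\<close> and quadratic expressions in \<open>f\<close> need no normalisation.\<close>

definition ent :: "'a measure \<Rightarrow> ('a \<Rightarrow> real) \<Rightarrow> real" where
  "ent M F = (\<integral>x. F x * ln (F x) \<partial>M) - (\<integral>x. F x \<partial>M) * ln (\<integral>x. F x \<partial>M)"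

lemma x_ln_x_abs_le: "0 \<le> (x::real) \<Longrightarrow> \<bar>x * ln x\<bar> \<le> 1 + x\<^sup>2"
proof (cases "x \<ge> 1")
  case True
  then have "x * ln x \<le> x * x" "0 \<le> x * ln x"
    using ln_bound[of x] by (auto intro!: mult_left_mono)
  then show ?thesis by (simp add: power2_eq_square)
next
  case False
  assume "0 \<le> x"
  show ?thesis
  proof (cases "x = 0")
    case False
    with \<open>0 \<le> x\<close> have x: "x > 0" by simp
    have "ln (1/x) \<le> 1/x - 1" using ln_le_minus_one[of "1/x"] x by simp
    then have "x * ln (1/x) \<le> x * (1/x - 1)" using x by (intro mult_left_mono) auto
    then have "- (x * ln x) \<le> 1" using x by (simp add: ln_div right_diff_distrib)
    moreover have "x * ln x \<le> 0" using x \<open>\<not> x \<ge> 1\<close> by (simp add: mult_nonneg_nonpos)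
    ultimately show ?thesis using zero_le_power2[of x] by linarith
  qed auto
qed

lemma x_ln_x_tendsto:
  fixes f :: "nat \<Rightarrow> real"
  assumes f: "f \<longlonglongrightarrow> l" and nonneg: "\<And>n. f n \<ge> 0"
  shows "(\<lambda>n. f n * ln (f n)) \<longlonglongrightarrow> l * ln l"
proof (cases "l = 0")
  case False
  then show ?thesis by (intro tendsto_intros f) auto
next
  case True
  have "((\<lambda>x::real. x * ln x) \<longlongrightarrow> 0) (at_right 0)" by real_asymp
  then have "((\<lambda>x::real. x * ln x) \<longlongrightarrow> 0) (at 0 within {0..})"
    by (simp add: at_within_Ici_at_right)
  then have "((\<lambda>x::real. x * ln x) \<longlongrightarrow> 0 * ln 0) (at 0 within {0..})" by simp
  then have "continuous (at 0 within {0..}) (\<lambda>x::real. x * ln x)"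
    by (simp add: continuous_within)
  then have "(\<lambda>n. f n * ln (f n)) \<longlonglongrightarrow> 0 * ln 0"
    by (rule continuous_within_tendsto_compose') (use f nonneg True in auto)
  then show ?thesis using True by simp
qed

lemma integrable_x_ln_x:
  fixes F :: "'a \<Rightarrow> real"
  assumes "finite_measure M" "F \<in> borel_measurable M" "\<And>x. 0 \<le> F x" "\<And>x. F x \<le> K"
  shows "integrable M F" "integrable M (\<lambda>x. F x * ln (F x))"
proof -
  interpret finite_measure M by fact
  note [measurable] = assms(2)
  show "integrable M F" by (rule integrable_const_bound[of _ K]) (use assms in auto)
  have "\<bar>F x * ln (F x)\<bar> \<le> 1 + K\<^sup>2" for x
  proof -
    have "\<bar>F x * ln (F x)\<bar> \<le> 1 + (F x)\<^sup>2" using x_ln_x_abs_le assms by blast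
    also have "\<dots> \<le> 1 + K\<^sup>2" using assms by (auto intro!: power_mono)
    finally show ?thesis .
  qed
  then show "integrable M (\<lambda>x. F x * ln (F x))"
    by (intro integrable_const_bound[of _ "1 + K\<^sup>2"]) auto
qed

text \<open>Young's inequality for the conjugate functions \<open>a ln a - a\<close> and \<open>exp h\<close>, shifted so that equality
  holds at \<open>a = s / z * exp h\<close>.\<close>

lemma young_entropy:
  fixes a h s z :: real
  assumes "a \<ge> 0" "s > 0" "z > 0"
  shows "a * h \<le> a * ln a + a * ln z - a * ln s - a + s / z * exp h"
proof (cases "a = 0")
  case False
  then have a: "a > 0" using assms by simp
  define t where "t = h + ln s - ln z - ln a"
  have "a * (1 + t) \<le> a * exp t" using a by (intro mult_left_mono exp_ge_add_one_self) auto
  also have "a * exp t = s / z * exp h"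
    using a assms by (simp add: t_def exp_add exp_diff)
  finally show ?thesis by (simp add: t_def algebra_simps)
qed (use assms in auto)

text \<open>One half of the variational formula for the entropy. The previous inequality is integrated with \<open>s\<close>
  and \<open>z\<close> the integrals of \<open>F\<close> and \<open>exp h\<close>, for which its last two terms cancel.\<close>

lemma entropy_variational:
  fixes F h :: "'a \<Rightarrow> real"
  assumes M: "prob_space M" and F: "F \<in> borel_measurable M" "\<And>x. 0 \<le> F x" "\<And>x. F x \<le> K"
    and h: "h \<in> borel_measurable M" "integrable M (\<lambda>x. exp (h x))"
    and Fh: "integrable M (\<lambda>x. F x * h x)"
  shows "(\<integral>x. F x * h x \<partial>M) \<le> ent M F + (\<integral>x. F x \<partial>M) * ln (\<integral>x. exp (h x) \<partial>M)"
proof -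
  interpret prob_space M by fact
  note int = integrable_x_ln_x[OF finite_measure_axioms F]
  define s where "s = (\<integral>x. F x \<partial>M)"
  define z where "z = (\<integral>x. exp (h x) \<partial>M)"
  have s0: "s \<ge> 0" unfolding s_def using F by (intro integral_nonneg_AE) auto
  have "z > 0"
  proof -
    have "z \<noteq> 0" unfolding z_def
      by (subst integral_nonneg_eq_0_iff_AE[OF h(2)]) (auto simp: AE_False)
    moreover have "z \<ge> 0" unfolding z_def by (intro integral_nonneg_AE) auto
    ultimately show ?thesis by simp
  qed
  show ?thesis
  proof (cases "s = 0")
    case True
    then have "AE x in M. F x = 0"
      using integral_nonneg_eq_0_iff_AE[OF int(1)] F by (auto simp: s_def)
    then have "(\<integral>x. F x * h x \<partial>M) = (\<integral>x. 0 \<partial>M)" "(\<integral>x. F x * ln (F x) \<partial>M) = (\<integral>x. 0 \<partial>M)"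
      using F h by (intro integral_cong_AE; force)+
    then show ?thesis using True by (simp add: ent_def s_def)
  next
    case False
    then have s: "s > 0" using s0 by simp
    have "(\<integral>x. F x * h x \<partial>M) \<le> (\<integral>x. F x * ln (F x) + F x * ln z - F x * ln s - F x + s / z * exp (h x) \<partial>M)"
      using int h Fh young_entropy[OF F(2) s \<open>z > 0\<close>] by (intro integral_mono) auto
    also have "\<dots> = (\<integral>x. F x * ln (F x) \<partial>M) + s * ln z - s * ln s - s + s / z * z"
      using int h by (simp add: s_def z_def)
    also have "\<dots> = ent M F + s * ln z" using \<open>z > 0\<close> by (simp add: ent_def s_def)
    finally show ?thesis by (simp add: s_def z_def)
  qed
qed

lemma entropy_integrable:
  fixes F h :: "'a \<Rightarrow> real"
  assumes M: "prob_space M" and F: "F \<in> borel_measurable M" "\<And>x. 0 \<le> F x" "\<And>x. F x \<le> K"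
    and h: "h \<in> borel_measurable M" "integrable M (\<lambda>x. exp (h x))" "\<And>x. h x \<ge> 0"
  shows "integrable M (\<lambda>x. F x * h x)"
proof (rule Bochner_Integration.integrable_bound)
  show "integrable M (\<lambda>x. K * exp (h x))" using h by simp
  show "(\<lambda>x. F x * h x) \<in> borel_measurable M" using F h by simp
  have "F x * h x \<le> K * exp (h x)" for x
  proof (rule mult_mono)
    show "h x \<le> exp (h x)" using exp_ge_add_one_self[of "h x"] by linarith
    show "0 \<le> K" using F(2)[of x] F(3)[of x] by linarith
  qed (use F h in auto)
  moreover have "0 \<le> F x * h x" for x using F h by simp
  ultimately show "AE x in M. norm (F x * h x) \<le> norm (K * exp (h x))"
    by (intro always_eventually allI) (metis abs_of_nonneg order_trans real_norm_def)
qed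

text \<open>Testing against a multiple of an indicator: a density with small entropy puts little
  mass on a set of small probability.\<close>

lemma entropy_small_set:
  fixes F :: "'a \<Rightarrow> real"
  assumes M: "prob_space M" and F: "F \<in> borel_measurable M" "\<And>x. 0 \<le> F x" "\<And>x. F x \<le> K"
    and A: "A \<in> sets M" "measure M A \<le> exp (- l)" and "l \<ge> 0"
  shows "l * (\<integral>x. F x * indicator A x \<partial>M) \<le> ent M F + (\<integral>x. F x \<partial>M) * ln 2"
proof -
  interpret prob_space M by fact
  note [measurable] = A(1) F(1)
  let ?h = "\<lambda>x. l * indicator A x"
  have e: "exp (?h x) = 1 + (exp l - 1) * indicator A x" for x by (auto simp: indicator_def)
  have iA: "integrable M (indicat_real A)"
    by (intro integrable_real_indicator) (auto simp: emeasure_eq_measure)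
  then have i: "integrable M (\<lambda>x. exp (?h x))" unfolding e by simp
  have Fi: "integrable M (\<lambda>x. F x * ?h x)"
    by (rule entropy_integrable[OF M F _ i]) (use \<open>l \<ge> 0\<close> in auto)
  have *: "(\<integral>x. exp (?h x) \<partial>M) = 1 + (exp l - 1) * measure M A" unfolding e
    using iA A by (simp add: prob_space)
  also have "\<dots> \<le> 1 + (exp l - 1) * exp (- l)" using A \<open>l \<ge> 0\<close> by (intro add_left_mono mult_left_mono) auto
  also have "\<dots> \<le> 2" using exp_minus_inverse[of l] exp_gt_zero[of "- l"] by (simp add: left_diff_distrib)
  finally have le2: "(\<integral>x. exp (?h x) \<partial>M) \<le> 2" .
  have ge1: "(\<integral>x. exp (?h x) \<partial>M) \<ge> 1"
    unfolding * using \<open>l \<ge> 0\<close> by simp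
  have "(\<integral>x. F x * ?h x \<partial>M) \<le> ent M F + (\<integral>x. F x \<partial>M) * ln (\<integral>x. exp (?h x) \<partial>M)"
    by (rule entropy_variational[OF M F _ i Fi]) auto
  also have "\<dots> \<le> ent M F + (\<integral>x. F x \<partial>M) * ln 2"
    using le2 ge1 F by (intro add_left_mono mult_left_mono integral_nonneg_AE) auto
  also have "(\<integral>x. F x * ?h x \<partial>M) = l * (\<integral>x. F x * indicator A x \<partial>M)"
    by (subst integral_mult_right_zero[symmetric]) (auto simp: ac_simps)
  finally show ?thesis .
qed


section \<open>Log-Sobolev inequalities in entropy form\<close>

lemma log_sobolev_imp_ent_le:
  fixes f :: "'a::euclidean_space \<Rightarrow> real"
  assumes M: "finite_measure M" "sets M = sets borel"
    and LSI: "log_sobolev M C" and C: "C \<ge> 0" and f: "f \<in> C1b"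
  shows "ent M (\<lambda>x. (f x)\<^sup>2) \<le> C * (\<integral>x. (norm (grad f x))\<^sup>2 \<partial>M)"
proof -
  interpret finite_measure M by fact
  obtain K where K: "f \<in> C1" "K > 0" "\<And>x. \<bar>f x\<bar> \<le> K" "\<And>x. norm (grad f x) \<le> K"
    using C1b_D[OF f] by blast
  have [measurable]: "f \<in> borel_measurable M" "grad f \<in> borel_measurable M"
    using C1_D[OF K(1)] M(2) by (auto cong: measurable_cong_sets)
  have "(f x)\<^sup>2 \<le> K\<^sup>2" for x using K(2) K(3)[of x] by (simp add: abs_le_square_iff[symmetric])
  note int = integrable_x_ln_x[OF finite_measure_axioms _ _ this, of "\<lambda>x. x", simplified]
  define s where "s = (\<integral>x. (f x)\<^sup>2 \<partial>M)"
  have s0: "s \<ge> 0" unfolding s_def by (intro integral_nonneg_AE) auto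
  show ?thesis
  proof (cases "s = 0")
    case True
    then have "AE x in M. (f x)\<^sup>2 = 0"
      using integral_nonneg_eq_0_iff_AE[OF int(1)] by (auto simp: s_def)
    then have "(\<integral>x. (f x)\<^sup>2 * ln ((f x)\<^sup>2) \<partial>M) = (\<integral>x. 0 \<partial>M)"
      by (intro integral_cong_AE; force)
    then have "ent M (\<lambda>x. (f x)\<^sup>2) = 0" using True by (simp add: ent_def s_def)
    moreover have "0 \<le> C * (\<integral>x. (norm (grad f x))\<^sup>2 \<partial>M)" using C by simp
    ultimately show ?thesis by linarith
  next
    case False
    then have s: "s > 0" using s0 by simp
    let ?g = "\<lambda>x. 1 / sqrt s * f x"
    have g: "?g \<in> C1" "grad ?g = (\<lambda>x. (1 / sqrt s) *\<^sub>R grad f x)"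
      using C1_cmult[OF K(1), of "1 / sqrt s"] by blast+
    have gb: "?g \<in> C1b"
    proof (rule C1b_I[OF g(1)])
      show "\<bar>?g x\<bar> \<le> K / sqrt s" for x using K(3)[of x] s by (simp add: abs_mult divide_right_mono)
      show "norm (grad ?g x) \<le> K / sqrt s" for x
        unfolding g using K(4)[of x] s by (simp add: divide_right_mono)
    qed
    have g2: "(?g x)\<^sup>2 = (f x)\<^sup>2 / s" for x using s by (simp add: power_mult_distrib power_divide)
    have gl: "(?g x)\<^sup>2 * ln ((?g x)\<^sup>2) = ((f x)\<^sup>2 * ln ((f x)\<^sup>2) - (f x)\<^sup>2 * ln s) / s" for x
    proof (cases "f x = 0")
      case False
      then show ?thesis unfolding g2 using s by (simp add: ln_div algebra_simps diff_divide_distrib)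
    qed simp
    have "(\<integral>x. (?g x)\<^sup>2 \<partial>M) = 1" unfolding g2 using s by (simp add: s_def[symmetric])
    from LSI[unfolded log_sobolev_def, THEN bspec, OF gb, THEN mp, OF this]
    have "(\<integral>x. (?g x)\<^sup>2 * ln ((?g x)\<^sup>2) \<partial>M) \<le> C * (\<integral>x. (norm (grad ?g x))\<^sup>2 \<partial>M)" .
    also have "(\<integral>x. (?g x)\<^sup>2 * ln ((?g x)\<^sup>2) \<partial>M) = ent M (\<lambda>x. (f x)\<^sup>2) / s"
      unfolding gl using int by (simp add: ent_def s_def)
    also have "(\<integral>x. (norm (grad ?g x))\<^sup>2 \<partial>M) = (\<integral>x. (norm (grad f x))\<^sup>2 \<partial>M) / s"
      unfolding g using s by (simp add: power_divide)
    finally show ?thesis using s by (simp add: field_simps)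
  qed
qed

text \<open>Truncation by the cutoff functions reduces an inequality for bounded functions to the
  same inequality for compactly supported ones.\<close>

lemma ent_le_if_cutoff:
  fixes f :: "'a::euclidean_space \<Rightarrow> real"
  assumes M: "finite_measure M" "sets M = sets borel"
    and f: "f \<in> C1" "\<And>x. \<bar>f x\<bar> \<le> K" "integrable M (\<lambda>x. (norm (grad f x))\<^sup>2)"
    and le: "\<And>n. ent M (\<lambda>x. (cutoff n x * f x)\<^sup>2)
      \<le> A * (\<integral>x. (norm (grad (\<lambda>x. cutoff n x * f x) x))\<^sup>2 \<partial>M) + B * (\<integral>x. (cutoff n x * f x)\<^sup>2 \<partial>M)"
  shows "ent M (\<lambda>x. (f x)\<^sup>2) \<le> A * (\<integral>x. (norm (grad f x))\<^sup>2 \<partial>M) + B * (\<integral>x. (f x)\<^sup>2 \<partial>M)"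
proof -
  interpret finite_measure M by fact
  have [measurable]: "f \<in> borel_measurable M" "grad f \<in> borel_measurable M"
    "cutoff n \<in> borel_measurable M" "grad (cutoff n) \<in> borel_measurable M" for n
    using C1_D[OF f(1)] C1_D[OF cutoff_C1(1)] M(2) by (auto cong: measurable_cong_sets)
  let ?F = "\<lambda>n x. (cutoff n x * f x)\<^sup>2"
  have Fle: "?F n x \<le> K\<^sup>2" for n x
  proof -
    have "\<bar>cutoff n x * f x\<bar> \<le> 1 * K"
      unfolding abs_mult using f(2) cutoff_bounds[of n x] by (intro mult_mono) auto
    then show ?thesis by (metis abs_ge_zero abs_le_square_iff abs_of_nonneg mult_1 order_trans)
  qed
  have Fl: "(\<lambda>n. ?F n x) \<longlonglongrightarrow> (f x)\<^sup>2" for x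
    using tendsto_power[OF tendsto_mult[OF cutoff_tendsto[of x] tendsto_const[of "f x"]], of 2] by simp
  have 1: "(\<lambda>n. \<integral>x. ?F n x \<partial>M) \<longlonglongrightarrow> (\<integral>x. (f x)\<^sup>2 \<partial>M)"
  proof (rule integral_dominated_convergence[where w="\<lambda>_. K\<^sup>2"])
    show "AE x in M. norm (?F n x) \<le> K\<^sup>2" for n
      using Fle[of n] by (intro AE_I2) (simp only: real_norm_def abs_of_nonneg zero_le_power2)
  qed (use Fl in auto)
  have 2: "(\<lambda>n. \<integral>x. ?F n x * ln (?F n x) \<partial>M) \<longlonglongrightarrow> (\<integral>x. (f x)\<^sup>2 * ln ((f x)\<^sup>2) \<partial>M)"
  proof (rule integral_dominated_convergence[where w="\<lambda>_. 1 + (K\<^sup>2)\<^sup>2"])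
    show "AE x in M. norm (?F n x * ln (?F n x)) \<le> 1 + (K\<^sup>2)\<^sup>2" for n
    proof (rule AE_I2)
      fix x
      have "\<bar>?F n x * ln (?F n x)\<bar> \<le> 1 + (?F n x)\<^sup>2" by (rule x_ln_x_abs_le) simp
      also have "\<dots> \<le> 1 + (K\<^sup>2)\<^sup>2" by (rule add_left_mono, rule power_mono[OF Fle]) simp
      finally show "norm (?F n x * ln (?F n x)) \<le> 1 + (K\<^sup>2)\<^sup>2" by simp
    qed
    show "AE x in M. (\<lambda>n. ?F n x * ln (?F n x)) \<longlonglongrightarrow> (f x)\<^sup>2 * ln ((f x)\<^sup>2)"
      by (intro AE_I2 x_ln_x_tendsto Fl) simp
  qed auto
  have e: "(\<lambda>n. ent M (?F n)) \<longlonglongrightarrow> ent M (\<lambda>x. (f x)\<^sup>2)"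
    unfolding ent_def
    by (intro tendsto_diff 2 x_ln_x_tendsto 1 integral_nonneg_AE) auto
  let ?G = "\<lambda>n x. cutoff n x *\<^sub>R grad f x + f x *\<^sub>R grad (cutoff n) x"
  have gr: "grad (\<lambda>x. cutoff n x * f x) = ?G n" for n using C1_mult[OF cutoff_C1(1) f(1)] by simp
  have 3: "(\<lambda>n. \<integral>x. (norm (?G n x))\<^sup>2 \<partial>M) \<longlonglongrightarrow> (\<integral>x. (norm (grad f x))\<^sup>2 \<partial>M)"
  proof (rule integral_dominated_convergence[where w="\<lambda>x. 2 * (norm (grad f x))\<^sup>2 + 2 * (4 * K)\<^sup>2"])
    show "AE x in M. norm ((norm (?G n x))\<^sup>2) \<le> 2 * (norm (grad f x))\<^sup>2 + 2 * (4 * K)\<^sup>2" for n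
    proof (rule AE_I2)
      fix x
      have "norm (?G n x) \<le> cutoff n x * norm (grad f x) + \<bar>f x\<bar> * norm (grad (cutoff n) x)"
        using norm_triangle_ineq[of "cutoff n x *\<^sub>R grad f x" "f x *\<^sub>R grad (cutoff n) x"]
          cutoff_bounds[of n x] by simp
      also have "\<dots> \<le> 1 * norm (grad f x) + K * 4"
      proof (intro add_mono mult_mono)
        have "norm (grad (cutoff n) x) \<le> 4 / (real n + 1)" by (rule grad_cutoff_bound)
        also have "\<dots> \<le> 4" by (simp add: field_simps)
        finally show "norm (grad (cutoff n) x) \<le> 4" .
        show "0 \<le> K" using f(2)[of x] by linarith
      qed (use f cutoff_bounds in auto)
      finally have "(norm (?G n x))\<^sup>2 \<le> (norm (grad f x) + 4 * K)\<^sup>2" by (intro power_mono) auto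
      also have "\<dots> \<le> 2 * (norm (grad f x))\<^sup>2 + 2 * (4 * K)\<^sup>2"
        using sum_squares_bound[of "norm (grad f x)" "4 * K"] by (simp add: power2_sum)
      finally show "norm ((norm (?G n x))\<^sup>2) \<le> 2 * (norm (grad f x))\<^sup>2 + 2 * (4 * K)\<^sup>2" by simp
    qed
    have "(\<lambda>n. (norm (?G n x))\<^sup>2) \<longlonglongrightarrow> (norm (1 *\<^sub>R grad f x + f x *\<^sub>R 0))\<^sup>2" for x
      by (intro tendsto_intros cutoff_tendsto grad_cutoff_tendsto)
    then show "AE x in M. (\<lambda>n. (norm (?G n x))\<^sup>2) \<longlonglongrightarrow> (norm (grad f x))\<^sup>2" by simp
  qed (use f(3) in auto)
  show ?thesis
  proof (rule LIMSEQ_le[OF e])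
    show "(\<lambda>n. A * (\<integral>x. (norm (?G n x))\<^sup>2 \<partial>M) + B * (\<integral>x. ?F n x \<partial>M))
      \<longlonglongrightarrow> A * (\<integral>x. (norm (grad f x))\<^sup>2 \<partial>M) + B * (\<integral>x. (f x)\<^sup>2 \<partial>M)"
      by (intro tendsto_intros 1 3)
  qed (use le in \<open>auto simp: gr\<close>)
qed

lemma cutoff_mult_C1b:
  fixes f :: "'a::euclidean_space \<Rightarrow> real"
  assumes f: "f \<in> C1"
  shows "(\<lambda>x. cutoff n x * f x) \<in> C1b" "(\<lambda>x. cutoff n x * f x) \<in> C1"
    "norm x \<ge> real n + 1 \<Longrightarrow> cutoff n x * f x = 0 \<and> grad (\<lambda>x. cutoff n x * f x) x = 0"
proof -
  note * = C1_mult[OF cutoff_C1(1)[of n] f]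
  show "(\<lambda>x. cutoff n x * f x) \<in> C1" by fact
  have 1: "cutoff n x * f x = 0 \<and> grad (\<lambda>x. cutoff n x * f x) x = 0" if "norm x \<ge> real n + 1" for x
    using cutoff_support[OF that] by (simp add: *)
  then show "norm x \<ge> real n + 1 \<Longrightarrow> cutoff n x * f x = 0 \<and> grad (\<lambda>x. cutoff n x * f x) x = 0" .
  show "(\<lambda>x. cutoff n x * f x) \<in> C1b" by (rule C1b_continuous_support[OF *(1) 1])
qed

lemma integrable_continuous_support:
  fixes f :: "'a::euclidean_space \<Rightarrow> real"
  assumes M: "finite_measure M" "sets M = sets borel"
    and f: "continuous_on UNIV f" and s: "\<And>x. norm x \<ge> r \<Longrightarrow> f x = 0"
  shows "integrable M f"
proof -
  interpret finite_measure M by fact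
  obtain a where a: "\<And>x. norm x \<le> r \<Longrightarrow> \<bar>f x\<bar> \<le> a"
    using continuous_bounded_cball[OF f] unfolding real_norm_def by blast
  have "\<bar>f x\<bar> \<le> max 0 a" for x using a[of x] s[of x] by (cases "norm x \<le> r") auto
  moreover have "f \<in> borel_measurable M"
    using borel_measurable_continuous_onI[OF f] M(2) by (auto cong: measurable_cong_sets)
  ultimately show ?thesis by (intro integrable_const_bound[of _ "max 0 a"]) auto
qed

section \<open>Tightening a defective inequality\<close>

text \<open>With \<open>s\<close> the second moment of \<open>v\<close>, the bracket on the right integrates to the entropy of \<open>v\<^sup>2\<close>, while
  the left-hand side integrates to an upper bound for the entropy of \<open>(a + v)\<^sup>2\<close>. For \<open>\<bar>v\<bar> \<le> \<bar>a\<bar>\<close> the left-hand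
  side is quadratic in \<open>v\<close>, because \<open>x ln x - x + 1\<close> vanishes to second order at 1. For \<open>\<bar>v\<bar> > \<bar>a\<bar>\<close>
  the sum \<open>a + v\<close> is comparable with \<open>v\<close>, and \<open>s \<le> a\<^sup>2\<close> allows the logarithm of \<open>a\<^sup>2\<close> to be replaced by that of \<open>s\<close>.\<close>

lemma weak_rothaus_pointwise:
  fixes a v s :: real
  assumes a: "a \<noteq> 0" and s: "0 < s" "s \<le> a\<^sup>2"
  shows "(a + v)\<^sup>2 * ln ((a + v)\<^sup>2) - (a + v)\<^sup>2 * ln (a\<^sup>2) - (a + v)\<^sup>2 + a\<^sup>2
    \<le> 4 * (v\<^sup>2 * ln (v\<^sup>2) - v\<^sup>2 * ln s - v\<^sup>2 + s) + (14 + 8 * ln 2) * v\<^sup>2"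
proof -
  define F where "F = (a + v)\<^sup>2"
  define t where "t = v\<^sup>2"
  have F0: "F \<ge> 0" and t0: "t \<ge> 0" and a0: "a\<^sup>2 > 0" using a by (auto simp: F_def t_def)
  have R: "0 \<le> t * ln t - t * ln s - t + s" using young_entropy[OF t0 s(1), of 1 0] by simp
  have "F * ln F - F * ln (a\<^sup>2) - F + a\<^sup>2 \<le> 4 * (t * ln t - t * ln s - t + s) + (14 + 8 * ln 2) * t"
  proof (cases "\<bar>v\<bar> \<le> \<bar>a\<bar>")
    case True
    have "F * ln F - F * ln (a\<^sup>2) \<le> F * (F / a\<^sup>2 - 1)"
    proof (cases "F = 0")
      case False
      then have "F > 0" using F0 by simp
      then have "ln F - ln (a\<^sup>2) \<le> F / a\<^sup>2 - 1"
        using ln_le_minus_one[of "F / a\<^sup>2"] a0 by (simp add: ln_div)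
      then have "F * (ln F - ln (a\<^sup>2)) \<le> F * (F / a\<^sup>2 - 1)" using F0 by (rule mult_left_mono)
      then show ?thesis by (simp add: right_diff_distrib)
    qed simp
    then have "F * ln F - F * ln (a\<^sup>2) - F + a\<^sup>2 \<le> (F - a\<^sup>2)\<^sup>2 / a\<^sup>2"
    proof -
      have "(F - b)\<^sup>2 / b = F * (F / b) - 2 * F + b" if "b > 0" for b
        using that by (simp add: power2_eq_square field_simps)
      from this[OF a0] have "(F - a\<^sup>2)\<^sup>2 / a\<^sup>2 = F * (F / a\<^sup>2) - 2 * F + a\<^sup>2" .
      then show ?thesis using \<open>F * ln F - F * ln (a\<^sup>2) \<le> F * (F / a\<^sup>2 - 1)\<close>
        by (simp add: right_diff_distrib)
    qed
    also have "(F - a\<^sup>2)\<^sup>2 / a\<^sup>2 = (2 * a + v)\<^sup>2 / a\<^sup>2 * t"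
      by (simp add: F_def t_def power2_eq_square algebra_simps)
    also have "\<dots> \<le> 9 * t"
    proof (rule mult_right_mono[OF _ t0])
      have "\<bar>2 * a + v\<bar> \<le> \<bar>3 * a\<bar>" using True by linarith
      then have "(2 * a + v)\<^sup>2 \<le> (3 * a)\<^sup>2" by (simp only: abs_le_square_iff)
      then show "(2 * a + v)\<^sup>2 / a\<^sup>2 \<le> 9" using a0 by (simp add: power_mult_distrib divide_le_eq)
    qed
    also have "\<dots> \<le> (14 + 8 * ln 2) * t" using t0 by (intro mult_right_mono) (auto simp: ln_ge_zero add_increasing2)
    also have "\<dots> \<le> 4 * (t * ln t - t * ln s - t + s) + (14 + 8 * ln 2) * t" using R by simp
    finally show ?thesis .
  next
    case False
    then have v: "\<bar>v\<bar> > \<bar>a\<bar>" by simp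
    have at: "a\<^sup>2 \<le> t" unfolding t_def using v by (simp flip: abs_le_square_iff)
    have "\<bar>a + v\<bar> \<le> \<bar>2 * v\<bar>" using v by linarith
    then have F4: "F \<le> 4 * t" unfolding F_def t_def by (simp only: abs_le_square_iff power_mult_distrib) simp
    have tp: "t > 0" using at a0 by linarith
    have "ln (a\<^sup>2) \<le> ln (4 * t)" using at a0 tp by (subst ln_le_cancel_iff) linarith+
    then have l0: "ln (4 * t) - ln (a\<^sup>2) \<ge> 0" by simp
    have "F * ln F - F * ln (a\<^sup>2) \<le> 4 * t * (ln (4 * t) - ln (a\<^sup>2))"
    proof (cases "F \<le> a\<^sup>2")
      case True
      then have "F * ln F - F * ln (a\<^sup>2) \<le> 0"
      proof (cases "F = 0")
        case False
        then have "ln F \<le> ln (a\<^sup>2)" using F0 True by (subst ln_le_cancel_iff) auto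
        then show ?thesis using F0 by (simp add: mult_left_mono)
      qed simp
      also have "0 \<le> 4 * t * (ln (4 * t) - ln (a\<^sup>2))" using l0 t0 by (intro mult_nonneg_nonneg) auto
      finally show ?thesis .
    next
      case False
      then have "F > a\<^sup>2" "F > 0" using a0 by linarith+
      then have "ln F \<le> ln (4 * t)" "ln (a\<^sup>2) \<le> ln F"
        using F4 a0 tp by (subst ln_le_cancel_iff; linarith)+
      then have "F * (ln F - ln (a\<^sup>2)) \<le> 4 * t * (ln (4 * t) - ln (a\<^sup>2))"
        using F4 t0 by (intro mult_mono diff_right_mono) auto
      then show ?thesis by (simp add: right_diff_distrib)
    qed
    also have "ln (4 * t) = 2 * ln 2 + ln t" using tp ln_mult[of 4 t] ln_realpow[of 2 2] by simp
    also have "4 * t * (2 * ln 2 + ln t - ln (a\<^sup>2)) \<le> 4 * t * (2 * ln 2 + ln t - ln s)"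
      using s a0 t0 by (intro mult_left_mono diff_left_mono) auto
    finally have "F * ln F - F * ln (a\<^sup>2) \<le> 4 * (t * ln t - t * ln s) + 8 * ln 2 * t"
      by (simp add: algebra_simps)
    moreover have "(14 + 8 * ln 2) * t = 14 * t + 8 * ln 2 * t" by (simp add: algebra_simps)
    moreover have "u - F + b \<le> 4 * (x - t + s) + z"
      if "u \<le> 4 * x + y" "z = 14 * t + y" "b \<le> t" for u x y z b
      using that F0 t0 s by simp
    ultimately show ?thesis using at by blast
  qed
  then show ?thesis by (simp add: F_def t_def)
qed

text \<open>A weak form of the Rothaus lemma: adding a constant that dominates the function in mean square
  costs only the second moment.\<close>

lemma weak_rothaus:
  fixes f :: "'a \<Rightarrow> real"
  assumes M: "prob_space M" and f: "f \<in> borel_measurable M" "\<And>x. \<bar>f x\<bar> \<le> K"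
    and a: "a \<noteq> 0" "(\<integral>x. (f x)\<^sup>2 \<partial>M) \<le> a\<^sup>2"
  shows "ent M (\<lambda>x. (a + f x)\<^sup>2) \<le> 4 * ent M (\<lambda>x. (f x)\<^sup>2) + (14 + 8 * ln 2) * (\<integral>x. (f x)\<^sup>2 \<partial>M)"
proof -
  interpret prob_space M by fact
  note [measurable] = f(1)
  have "(f x)\<^sup>2 \<le> K\<^sup>2" for x using f(2)[of x] by (simp add: abs_le_square_iff[symmetric])
  note int = integrable_x_ln_x[OF finite_measure_axioms _ _ this, of "\<lambda>x. x", simplified]
  have "\<bar>a + f x\<bar> \<le> \<bar>\<bar>a\<bar> + K\<bar>" for x using f(2)[of x] by linarith
  then have "(a + f x)\<^sup>2 \<le> (\<bar>a\<bar> + K)\<^sup>2" for x by (simp only: abs_le_square_iff)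
  note inta = integrable_x_ln_x[OF finite_measure_axioms _ _ this, of "\<lambda>x. x", simplified]
  define s where "s = (\<integral>x. (f x)\<^sup>2 \<partial>M)"
  define S where "S = (\<integral>x. (a + f x)\<^sup>2 \<partial>M)"
  have s0: "s \<ge> 0" "S \<ge> 0" unfolding s_def S_def by (intro integral_nonneg_AE; simp)+
  show ?thesis
  proof (cases "s = 0")
    case True
    then have z: "AE x in M. (f x)\<^sup>2 = 0"
      using integral_nonneg_eq_0_iff_AE[OF int(1)] by (auto simp: s_def)
    have "(\<integral>x. (f x)\<^sup>2 * ln ((f x)\<^sup>2) \<partial>M) = (\<integral>x. 0 \<partial>M)"
      "(\<integral>x. (a + f x)\<^sup>2 * ln ((a + f x)\<^sup>2) \<partial>M) = (\<integral>x. a\<^sup>2 * ln (a\<^sup>2) \<partial>M)"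
      "(\<integral>x. (a + f x)\<^sup>2 \<partial>M) = (\<integral>x. a\<^sup>2 \<partial>M)"
      using z by (intro integral_cong_AE; force)+
    then show ?thesis using True by (simp add: ent_def s_def prob_space)
  next
    case False
    then have s: "s > 0" "s \<le> a\<^sup>2" using s0 a(2) by (simp_all add: s_def[symmetric])
    have "0 \<le> S * ln S - S * ln (a\<^sup>2) - S + a\<^sup>2"
      using young_entropy[OF s0(2), of "a\<^sup>2" 1 0] a(1) by simp
    then have "ent M (\<lambda>x. (a + f x)\<^sup>2) \<le> (\<integral>x. (a + f x)\<^sup>2 * ln ((a + f x)\<^sup>2) \<partial>M) - S * ln (a\<^sup>2) - S + a\<^sup>2"
      by (simp add: ent_def S_def)
    also have "\<dots> = (\<integral>x. (a + f x)\<^sup>2 * ln ((a + f x)\<^sup>2) - (a + f x)\<^sup>2 * ln (a\<^sup>2) - (a + f x)\<^sup>2 + a\<^sup>2 \<partial>M)"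
      using inta by (simp add: S_def prob_space)
    also have "\<dots> \<le> (\<integral>x. 4 * ((f x)\<^sup>2 * ln ((f x)\<^sup>2) - (f x)\<^sup>2 * ln s - (f x)\<^sup>2 + s) + (14 + 8 * ln 2) * (f x)\<^sup>2 \<partial>M)"
      using int inta weak_rothaus_pointwise[OF a(1) s] by (intro integral_mono) auto
    also have "\<dots> = 4 * ((\<integral>x. (f x)\<^sup>2 * ln ((f x)\<^sup>2) \<partial>M) - s * ln s - s + s) + (14 + 8 * ln 2) * s"
      using int by (simp add: s_def prob_space)
    finally show ?thesis by (simp add: ent_def s_def)
  qed
qed

text \<open>By \<open>entropy_small_set\<close>, the defective inequality bounds the second moment outside a large ball by the
  energy and a small fraction of the whole second moment. Together with the Poincare inequality inside the
  ball this yields a global Poincare inequality for \<open>f - a\<close>. Either the second moment of \<open>f - a\<close> is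
  at least \<open>1 / 4\<close>, and then the defect is itself bounded by the energy, or the constant \<open>a\<close> dominates
  \<open>f - a\<close> in mean square, and then it is removed by \<open>weak_rothaus\<close>.\<close>

lemma tight_log_sobolev:
  fixes M :: "'a::euclidean_space measure"
  assumes M: "prob_space M" "sets M = sets borel" and AB: "A \<ge> 0" "B \<ge> 0"
    and defective: "\<And>f. f \<in> C1b \<Longrightarrow> ent M (\<lambda>x. (f x)\<^sup>2)
      \<le> A * (\<integral>x. (norm (grad f x))\<^sup>2 \<partial>M) + B * (\<integral>x. (f x)\<^sup>2 \<partial>M)"
    and local_poincare: "\<And>n::nat. \<exists>c\<ge>0. \<forall>f\<in>C1b. \<exists>a.
      (\<integral>x. (f x - a)\<^sup>2 * indicator (ball 0 (real n)) x \<partial>M) \<le> c * (\<integral>x. (norm (grad f x))\<^sup>2 \<partial>M)"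
  shows "\<exists>C'>0. log_sobolev M C'"
proof -
  interpret prob_space M by fact
  have space: "space M = UNIV" using M(2) sets_eq_imp_space_eq by fastforce
  have ln2: "ln 2 > (0::real)" by simp
  \<comment> \<open>this choice makes the second moment return with the factor \<open>1 / 4\<close> in the tail estimate\<close>
  define l where "l = 4 * (B + ln 2)"
  have l: "l > 0" unfolding l_def using AB by (simp add: add_nonneg_pos)
  have "(\<lambda>n. measure M (- ball 0 (real n))) \<longlonglongrightarrow> measure M (\<Inter>n. - ball 0 (real n))"
    by (rule finite_Lim_measure_decseq) (auto simp: decseq_def M(2))
  moreover have "(\<Inter>n. - ball (0::'a) (real n)) = {}"
  proof -
    have "\<exists>n. norm x < real n" for x :: 'a by (rule reals_Archimedean2)
    then show ?thesis by force
  qed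
  ultimately have "(\<lambda>n. measure M (- ball 0 (real n))) \<longlonglongrightarrow> 0" by simp
  from order_tendstoD(2)[OF this, of "exp (- l)"]
  obtain n :: nat where n: "measure M (- ball 0 (real n)) \<le> exp (- l)"
    by (auto simp: eventually_sequentially intro: less_imp_le)
  obtain c where c: "c \<ge> 0" "\<And>f. f \<in> C1b \<Longrightarrow> \<exists>a.
      (\<integral>x. (f x - a)\<^sup>2 * indicator (ball 0 (real n)) x \<partial>M) \<le> c * (\<integral>x. (norm (grad f x))\<^sup>2 \<partial>M)"
    using local_poincare[of n] by blast
  define P where "P = 4 / 3 * (c + A / l)"
  have P: "P \<ge> 0" using c l AB by (simp add: P_def)
  have poincare: "\<exists>a. (\<integral>x. (f x - a)\<^sup>2 \<partial>M) \<le> P * (\<integral>x. (norm (grad f x))\<^sup>2 \<partial>M)" if f: "f \<in> C1b" for f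
  proof -
    define D where "D = (\<integral>x. (norm (grad f x))\<^sup>2 \<partial>M)"
    obtain a where a: "(\<integral>x. (f x - a)\<^sup>2 * indicator (ball 0 (real n)) x \<partial>M) \<le> c * D"
      using c(2)[OF f] by (auto simp: D_def)
    obtain K where K: "f \<in> C1" "K > 0" "\<And>x. \<bar>f x\<bar> \<le> K" "\<And>x. norm (grad f x) \<le> K"
      using C1b_D[OF f] by blast
    have fa: "(\<lambda>x. f x - a) \<in> C1b" "grad (\<lambda>x. f x - a) = grad f"
    proof -
      show g: "grad (\<lambda>x. f x - a) = grad f" using C1_add_const[OF K(1)] by simp
      show "(\<lambda>x. f x - a) \<in> C1b"
      proof (rule C1b_I[of _ "K + \<bar>a\<bar>" K])
        show "\<bar>f x - a\<bar> \<le> K + \<bar>a\<bar>" for x using K(3)[of x] by linarith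
      qed (use K g C1_add_const[OF K(1)] in auto)
    qed
    have [measurable]: "f \<in> borel_measurable M"
      using C1_D[OF K(1)] M(2) by (auto cong: measurable_cong_sets)
    have "\<bar>f x - a\<bar> \<le> \<bar>K + \<bar>a\<bar>\<bar>" for x using K(3)[of x] by linarith
    then have bd: "(f x - a)\<^sup>2 \<le> (K + \<bar>a\<bar>)\<^sup>2" for x by (simp only: abs_le_square_iff)
    have [simp]: "integrable M (\<lambda>x. (f x - a)\<^sup>2)"
      by (rule integrable_const_bound[of _ "(K + \<bar>a\<bar>)\<^sup>2"]) (use bd in auto)
    have sb [measurable]: "ball 0 (real n) \<in> sets M" "- ball 0 (real n) \<in> sets M" using M(2) by auto
    define I where "I = (\<integral>x. (f x - a)\<^sup>2 \<partial>M)"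
    define J where "J = (\<integral>x. (f x - a)\<^sup>2 * indicator (- ball 0 (real n)) x \<partial>M)"
    have "l * J \<le> ent M (\<lambda>x. (f x - a)\<^sup>2) + I * ln 2"
      unfolding I_def J_def by (rule entropy_small_set[OF M(1) _ _ bd sb(2) n]) (use l in auto)
    also have "\<dots> \<le> A * D + B * I + I * ln 2"
      using defective[OF fa(1)] by (simp add: fa D_def I_def)
    also have "\<dots> = A * D + l / 4 * I" by (simp add: l_def algebra_simps)
    finally have "l * J \<le> l * (A / l * D + I / 4)" using l by (simp add: algebra_simps)
    then have J: "J \<le> A / l * D + I / 4" using l by (simp only: mult_le_cancel_left_pos)
    have "I = (\<integral>x. (f x - a)\<^sup>2 * indicator (ball 0 (real n)) x + (f x - a)\<^sup>2 * indicator (- ball 0 (real n)) x \<partial>M)"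
      unfolding I_def by (intro Bochner_Integration.integral_cong) (auto simp: indicator_def)
    also have "\<dots> = (\<integral>x. (f x - a)\<^sup>2 * indicator (ball 0 (real n)) x \<partial>M) + J"
      unfolding J_def
      by (intro Bochner_Integration.integral_add integrable_real_mult_indicator sb) simp_all
    finally have "I \<le> c * D + A / l * D + I / 4" using J a by linarith
    moreover have "P * D = 4 / 3 * (c * D + A / l * D)" by (simp add: P_def algebra_simps)
    moreover have "x \<le> 4 / 3 * y" if "x \<le> y + x / 4" for x y :: real using that by simp
    ultimately have "I \<le> P * D" by metis
    then show ?thesis by (auto simp: I_def D_def)
  qed
  define C' where "C' = 1 + A + 4 * B * P + 4 * A + (4 * B + 14 + 8 * ln 2) * P"
  have C'0: "0 \<le> 4 * B * P" "0 \<le> (4 * B + 14 + 8 * ln 2) * P" using AB P ln2 by auto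
  have "log_sobolev M C'"
    unfolding log_sobolev_def
  proof (intro ballI impI)
    fix f :: "'a \<Rightarrow> real" assume f: "f \<in> C1b" and f1: "(\<integral>x. (f x)\<^sup>2 \<partial>M) = 1"
    define D where "D = (\<integral>x. (norm (grad f x))\<^sup>2 \<partial>M)"
    have D: "D \<ge> 0" unfolding D_def by simp
    have e: "ent M (\<lambda>x. (f x)\<^sup>2) = (\<integral>x. (f x)\<^sup>2 * ln ((f x)\<^sup>2) \<partial>M)" by (simp add: ent_def f1)
    obtain a where a: "(\<integral>x. (f x - a)\<^sup>2 \<partial>M) \<le> P * D" using poincare[OF f] by (auto simp: D_def)
    define I where "I = (\<integral>x. (f x - a)\<^sup>2 \<partial>M)"
    have I: "I \<le> P * D" using a by (simp add: I_def)
    have "ent M (\<lambda>x. (f x)\<^sup>2) \<le> C' * D"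
    proof (cases "I \<ge> 1 / 4")
      case True
      then have "B * 1 \<le> B * (4 * (P * D))" using I AB by (intro mult_left_mono) auto
      then have "ent M (\<lambda>x. (f x)\<^sup>2) \<le> A * D + 4 * B * P * D"
        using defective[OF f] by (simp add: f1 D_def)
      also have "\<dots> = (A + 4 * B * P) * D" by (simp add: algebra_simps)
      also have "\<dots> \<le> C' * D" using D AB C'0 by (intro mult_right_mono) (auto simp: C'_def)
      finally show ?thesis .
    next
      case False
      obtain K where K: "f \<in> C1" "K > 0" "\<And>x. \<bar>f x\<bar> \<le> K" "\<And>x. norm (grad f x) \<le> K"
        using C1b_D[OF f] by blast
      have [measurable]: "f \<in> borel_measurable M"
        using C1_D[OF K(1)] M(2) by (auto cong: measurable_cong_sets)
      have b: "\<bar>f x - a\<bar> \<le> K + \<bar>a\<bar>" for x using K(3)[of x] by linarith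
      have fa: "(\<lambda>x. f x - a) \<in> C1b" "grad (\<lambda>x. f x - a) = grad f"
        using C1b_I[of "\<lambda>x. f x - a" "K + \<bar>a\<bar>" K] C1_add_const[OF K(1), of a] K b by auto
      have "\<bar>f x - a\<bar> \<le> \<bar>K + \<bar>a\<bar>\<bar>" for x using K(3)[of x] by linarith
      then have bd: "(f x - a)\<^sup>2 \<le> (K + \<bar>a\<bar>)\<^sup>2" for x by (simp only: abs_le_square_iff)
      have i: "integrable M (\<lambda>x. (f x - a)\<^sup>2)"
        by (rule integrable_const_bound[of _ "(K + \<bar>a\<bar>)\<^sup>2"]) (use bd in auto)
      have i2: "integrable M (\<lambda>x. (f x)\<^sup>2)"
        by (rule integrable_const_bound[of _ "K\<^sup>2"])
          (use K in \<open>auto simp: abs_le_square_iff[symmetric]\<close>)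
      have "(\<integral>x. (f x)\<^sup>2 \<partial>M) \<le> (\<integral>x. 2 * (f x - a)\<^sup>2 + 2 * a\<^sup>2 \<partial>M)"
      proof (intro integral_mono)
        show "(f x)\<^sup>2 \<le> 2 * (f x - a)\<^sup>2 + 2 * a\<^sup>2" for x
          using zero_le_power2[of "f x - 2 * a"] by (simp add: power2_eq_square algebra_simps)
      qed (use i i2 in auto)
      also have "\<dots> = 2 * I + 2 * a\<^sup>2" using i by (simp add: I_def prob_space)
      finally have a2: "a\<^sup>2 \<ge> 1 / 4" using False f1 by simp
      then have "a \<noteq> 0" by auto
      have "ent M (\<lambda>x. (a + (f x - a))\<^sup>2) \<le> 4 * ent M (\<lambda>x. (f x - a)\<^sup>2) + (14 + 8 * ln 2) * I"
        unfolding I_def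
        by (rule weak_rothaus[OF M(1) _ b \<open>a \<noteq> 0\<close>]) (use a2 False in \<open>auto simp: I_def\<close>)
      also have "ent M (\<lambda>x. (f x - a)\<^sup>2) \<le> A * D + B * I"
        using defective[OF fa(1)] by (simp add: fa D_def I_def)
      finally have "ent M (\<lambda>x. (f x)\<^sup>2) \<le> 4 * A * D + (4 * B + 14 + 8 * ln 2) * I"
        by (simp add: algebra_simps)
      also have "\<dots> \<le> 4 * A * D + (4 * B + 14 + 8 * ln 2) * (P * D)"
        using I AB ln2 by (intro add_left_mono mult_left_mono) auto
      also have "\<dots> = (4 * A + (4 * B + 14 + 8 * ln 2) * P) * D" by (simp add: algebra_simps)
      also have "\<dots> \<le> C' * D" using D AB C'0 by (intro mult_right_mono) (auto simp: C'_def)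
      finally show ?thesis .
    qed
    then show "(\<integral>x. (f x)\<^sup>2 * ln ((f x)\<^sup>2) \<partial>M) \<le> C' * (\<integral>x. (norm (grad f x))\<^sup>2 \<partial>M)"
      by (simp add: e D_def)
  qed
  moreover have "C' > 0" using AB C'0 by (simp add: C'_def)
  ultimately show ?thesis by blast
qed


section \<open>Perturbation by a weight with exponentially square-integrable gradient\<close>

lemma norm_add_square_le:
  fixes a b :: "'a::real_inner"
  assumes "s > 0"
  shows "(norm (a + b))\<^sup>2 \<le> (1 + s) * (norm a)\<^sup>2 + (1 + 1 / s) * (norm b)\<^sup>2"
proof -
  have "0 \<le> (norm (s *\<^sub>R a - b))\<^sup>2" by simp
  also have "\<dots> = s\<^sup>2 * (norm a)\<^sup>2 + (norm b)\<^sup>2 - 2 * s * (a \<bullet> b)"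
    unfolding power2_norm_eq_inner
    by (simp add: inner_diff_left inner_diff_right inner_commute power2_eq_square algebra_simps)
  finally have "s * (2 * (a \<bullet> b)) \<le> s * (s * (norm a)\<^sup>2 + (norm b)\<^sup>2 / s)"
    using assms by (simp add: power2_eq_square algebra_simps)
  then have "2 * (a \<bullet> b) \<le> s * (norm a)\<^sup>2 + (norm b)\<^sup>2 / s"
    using assms by (simp only: mult_le_cancel_left_pos)
  moreover have "(norm (a + b))\<^sup>2 = (norm a)\<^sup>2 + (norm b)\<^sup>2 + 2 * (a \<bullet> b)"
    by (simp add: power2_norm_eq_inner inner_add_left inner_add_right inner_commute)
  ultimately show ?thesis by (simp add: algebra_simps)
qed

locale log_sobolev_weight =
  fixes M :: "'a::euclidean_space measure" and C k :: real and W :: "'a \<Rightarrow> real"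
  assumes M: "prob_space M" "sets M = sets borel"
    and LSI: "log_sobolev M C" and C: "C > 0"
    and W: "W \<in> C1" and k: "4 * k > C"
    and moment: "integrable M (\<lambda>x. exp (k * (norm (grad W x))\<^sup>2))"
    and weight: "prob_space (density M (\<lambda>x. ennreal (exp (W x))))"
begin

sublocale prob_space M by (rule M)

definition L where "L = ln (\<integral>x. exp (k * (norm (grad W x))\<^sup>2) \<partial>M)"

lemma W_measurable [measurable]: "W \<in> borel_measurable M" "grad W \<in> borel_measurable M"
  using C1_D[OF W] M(2) by (auto cong: measurable_cong_sets)

lemma k_pos: "k > 0" using k C by simp

lemma L_nonneg: "L \<ge> 0"
proof -
  have "(1::real) = (\<integral>x. 1 \<partial>M)" by (simp add: prob_space)
  also have "\<dots> \<le> (\<integral>x. exp (k * (norm (grad W x))\<^sup>2) \<partial>M)"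
    using moment k_pos by (intro integral_mono) auto
  finally show ?thesis unfolding L_def by simp
qed

text \<open>Applicable to functions of \<open>W\<close>, whose gradients need not be bounded.\<close>

lemma LSI_bounded:
  assumes f: "f \<in> C1" "\<And>x. \<bar>f x\<bar> \<le> K" "integrable M (\<lambda>x. (norm (grad f x))\<^sup>2)"
  shows "ent M (\<lambda>x. (f x)\<^sup>2) \<le> C * (\<integral>x. (norm (grad f x))\<^sup>2 \<partial>M)"
proof -
  have "ent M (\<lambda>x. (f x)\<^sup>2) \<le> C * (\<integral>x. (norm (grad f x))\<^sup>2 \<partial>M) + 0 * (\<integral>x. (f x)\<^sup>2 \<partial>M)"
  proof (rule ent_le_if_cutoff[OF finite_measure_axioms M(2) f])
    show "ent M (\<lambda>x. (cutoff n x * f x)\<^sup>2)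
      \<le> C * (\<integral>x. (norm (grad (\<lambda>x. cutoff n x * f x) x))\<^sup>2 \<partial>M) + 0 * (\<integral>x. (cutoff n x * f x)\<^sup>2 \<partial>M)" for n
      using log_sobolev_imp_ent_le[OF finite_measure_axioms M(2) LSI _ cutoff_mult_C1b(1)[OF f(1)]] C by simp
  qed
  then show ?thesis by simp
qed

text \<open>The exponential moment enters through this estimate: it is the exponential integral that
  \<open>entropy_variational\<close> attaches to the test function \<open>k * (norm (grad W x))\<^sup>2\<close>.\<close>

lemma weight_energy_le:
  assumes F: "F \<in> borel_measurable M" "\<And>x. 0 \<le> F x" "\<And>x. F x \<le> K"
  shows "integrable M (\<lambda>x. F x * (norm (grad W x))\<^sup>2)"
    "k * (\<integral>x. F x * (norm (grad W x))\<^sup>2 \<partial>M) \<le> ent M F + (\<integral>x. F x \<partial>M) * L"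
proof -
  have i: "integrable M (\<lambda>x. F x * (k * (norm (grad W x))\<^sup>2))"
    by (rule entropy_integrable[OF M(1) F _ moment]) (use k_pos in auto)
  from entropy_variational[OF M(1) F _ moment i]
  have 1: "(\<integral>x. F x * (k * (norm (grad W x))\<^sup>2) \<partial>M) \<le> ent M F + (\<integral>x. F x \<partial>M) * L"
    by (simp add: L_def)
  have e: "F x * (k * (norm (grad W x))\<^sup>2) = k * (F x * (norm (grad W x))\<^sup>2)" for x by simp
  show "integrable M (\<lambda>x. F x * (norm (grad W x))\<^sup>2)" using i k_pos unfolding e by simp
  show "k * (\<integral>x. F x * (norm (grad W x))\<^sup>2 \<partial>M) \<le> ent M F + (\<integral>x. F x \<partial>M) * L"
    using 1 unfolding e by simp
qed

text \<open>The log-Sobolev inequality is applied to bounded functions whose squares \<open>q m\<close> increase to \<open>1 + y\<close>, where \<open>y\<close> is a small multiple of \<open>exp (- W)\<close>. The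
  logarithmic gradients of these functions are at most half the gradient of \<open>W\<close>, so \<open>4 * k > C\<close> bounds the entropy of \<open>q m\<close> by a
  multiple of its integral. Since \<open>y\<close> exceeds 1 only on a set of small probability, \<open>entropy_small_set\<close>
  then bounds the integral of \<open>q m\<close> uniformly in \<open>m\<close>.\<close>

lemma exp_neg_weight_integrable: "integrable M (\<lambda>x. exp (- W x))"
proof -
  define c where "c = C * L / (4 * k - C)"
  have c0: "c \<ge> 0" unfolding c_def using C L_nonneg k by simp
  define l where "l = 2 * (c + ln 2)"
  have ln2: "ln 2 > (0::real)" by simp
  have l0: "l > 0" unfolding l_def using add_nonneg_pos[OF c0 ln2] by simp
  have "(\<lambda>n. measure M {x. W x < - real n}) \<longlonglongrightarrow> measure M (\<Inter>n. {x. W x < - real n})"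
  proof (rule finite_Lim_measure_decseq)
    have "{x \<in> space M. W x < - real n} \<in> sets M" for n by measurable
    then show "range (\<lambda>n. {x. W x < - real n}) \<subseteq> sets M"
      using sets_eq_imp_space_eq[OF M(2)] by auto
    show "decseq (\<lambda>n. {x. W x < - real n})" by (auto simp: decseq_def)
  qed
  moreover have "(\<Inter>n. {x. W x < - real n}) = {}"
  proof -
    have False if x: "x \<in> (\<Inter>n. {x. W x < - real n})" for x
    proof -
      obtain n where "- W x \<le> real n" using real_arch_simple by blast
      moreover have "W x < - real n" using x by blast
      ultimately show False by linarith
    qed
    then show ?thesis by blast
  qed
  ultimately have "(\<lambda>n. measure M {x. W x < - real n}) \<longlonglongrightarrow> 0" by simp
  from order_tendstoD(2)[OF this, of "exp (- l)"]
  obtain n :: nat where n: "measure M {x. W x < - real n} \<le> exp (- l)"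
    by (auto simp: eventually_sequentially intro: less_imp_le)
  define A where "A = {x. W x < - real n}"
  have A: "A \<in> sets M" "measure M A \<le> exp (- l)"
  proof -
    have "{x \<in> space M. W x < - real n} \<in> sets M" by measurable
    then show "A \<in> sets M" using sets_eq_imp_space_eq[OF M(2)] by (simp add: A_def)
  qed (use n in \<open>simp add: A_def\<close>)
  define y where "y x = exp (- real n - W x)" for x
  have y0: "y x > 0" for x by (simp add: y_def)
  define q where "q m x = (1 + y x) / (1 + y x / (real m + 1))" for m x
  have pos: "1 + y x / (real m + 1) > 0" for m x using y0[of x] by (simp add: add_pos_nonneg)
  have q0: "q m x \<ge> 0" for m x unfolding q_def using y0[of x] by simp
  have qm: "q m x \<le> real m + 1" for m x
  proof -
    have "1 + y x \<le> (real m + 1) * (1 + y x / (real m + 1))" using y0[of x] by (simp add: distrib_left)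
    then show ?thesis unfolding q_def using pos[of x m] by (simp add: pos_divide_le_eq)
  qed
  have qy: "q m x \<le> 1 + y x" for m x
    unfolding q_def using y0[of x] pos[of x m] by (simp add: pos_divide_le_eq mult_le_cancel_left1)
  have [measurable]: "y \<in> borel_measurable M" "q m \<in> borel_measurable M" for m
    unfolding y_def[abs_def] q_def[abs_def] by measurable
  have Z4: "(\<integral>x. q m x \<partial>M) \<le> 4" for m
  proof -
    let ?N = "real m + 1"
    let ?g = "\<lambda>w. exp ((ln (1 + exp (- real n - w)) - ln (1 + exp (- real n - w) / ?N)) / 2)"
    define b where "b w = exp (- real n - w) / ?N / (1 + exp (- real n - w) / ?N) - exp (- real n - w) / (1 + exp (- real n - w))" for w
    have p1: "1 + exp (- real n - w) > 0" "1 + exp (- real n - w) / ?N > 0" for w by (auto simp: add_pos_nonneg)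
    have der: "DERIV ?g w :> ?g w * (b w / 2)" for w
    proof -
      have *: "DERIV (\<lambda>w. ln (1 + exp (- real n - w))) w :> - exp (- real n - w) / (1 + exp (- real n - w))"
        using p1(1)[of w] by (auto intro!: derivative_eq_intros)
      have **: "DERIV (\<lambda>w. ln (1 + exp (- real n - w) / ?N)) w :> (- exp (- real n - w) / ?N) / (1 + exp (- real n - w) / ?N)"
      proof -
        have "DERIV (\<lambda>w. 1 + exp (- real n - w) / ?N) w :> - exp (- real n - w) / ?N"
          by (auto intro!: derivative_eq_intros)
        from DERIV_chain2[OF DERIV_ln_divide[OF p1(2)] this] show ?thesis by (simp add: mult.commute)
      qed
      show ?thesis
        by (rule DERIV_cong[OF DERIV_chain2[OF DERIV_exp DERIV_cdivide[OF DERIV_diff[OF * **]]]])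
          (simp add: b_def)
    qed
    have cont: "continuous_on UNIV (\<lambda>w. ?g w * (b w / 2))"
      unfolding b_def using p1[THEN less_imp_neq, symmetric] by (intro continuous_intros) auto
    define f where "f x = ?g (W x)" for x
    have f: "f \<in> C1" "grad f = (\<lambda>x. (f x * (b (W x) / 2)) *\<^sub>R grad W x)"
    proof -
      have "continuous_on (range W) (\<lambda>w. ?g w * (b w / 2))" by (rule continuous_on_subset[OF cont]) simp
      note * = C1_compose[where f=W and g="?g" and g'="\<lambda>w. ?g w * (b w / 2)", OF W der this]
      show "f \<in> C1" unfolding f_def[abs_def] by (rule *(1))
      show "grad f = (\<lambda>x. (f x * (b (W x) / 2)) *\<^sub>R grad W x)"
        unfolding f_def[abs_def] by (rule *(2))
    qed
    have f2: "(f x)\<^sup>2 = q m x" for x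
    proof -
      have "(f x)\<^sup>2 = exp (ln (1 + y x) - ln (1 + y x / ?N))"
        by (simp add: f_def power2_eq_square y_def flip: exp_add)
      also have "\<dots> = q m x" using y0[of x] pos[of x m] by (simp add: exp_diff q_def)
      finally show ?thesis .
    qed
    have fb: "\<bar>f x\<bar> \<le> sqrt ?N" for x
      using qm[of m x] unfolding f2[symmetric] by (metis real_sqrt_abs real_sqrt_le_mono)
    have b1: "\<bar>b w\<bar> \<le> 1" for w
    proof -
      have *: "0 \<le> t / (1 + t)" "t / (1 + t) \<le> 1" if "t > 0" for t :: real using that by simp_all
      have p: "exp (- real n - w) / ?N > 0" "exp (- real n - w) > 0" by simp_all
      show ?thesis
        unfolding b_def using *[OF p(1)] *[OF p(2)] by linarith
    qed
    note E = weight_energy_le[OF _ q0 qm, of m]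
    define X where "X = (\<integral>x. q m x * (norm (grad W x))\<^sup>2 \<partial>M)"
    define Z where "Z = (\<integral>x. q m x \<partial>M)"
    have Z0: "Z \<ge> 0" unfolding Z_def using q0 by (intro integral_nonneg_AE) auto
    have gle: "(norm (grad f x))\<^sup>2 \<le> q m x * (norm (grad W x))\<^sup>2 / 4" for x
    proof -
      have "(norm (grad f x))\<^sup>2 = q m x * (b (W x))\<^sup>2 * (norm (grad W x))\<^sup>2 / 4"
        by (simp add: f power_mult_distrib power_divide f2)
      also have "\<dots> \<le> q m x * 1 * (norm (grad W x))\<^sup>2 / 4"
        using b1[of "W x"] q0 by (intro divide_right_mono mult_right_mono mult_left_mono) (auto simp: abs_square_le_1)
      finally show ?thesis by simp
    qed
    have [measurable]: "grad f \<in> borel_measurable M"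
      using C1_D[OF f(1)] M(2) by (auto cong: measurable_cong_sets)
    have gi: "integrable M (\<lambda>x. (norm (grad f x))\<^sup>2)"
      by (rule Bochner_Integration.integrable_bound[of _ "\<lambda>x. q m x * (norm (grad W x))\<^sup>2 / 4"])
        (use E(1) gle q0 in \<open>auto intro!: AE_I2\<close>)
    have "ent M (q m) \<le> C * (\<integral>x. (norm (grad f x))\<^sup>2 \<partial>M)"
      using LSI_bounded[OF f(1) fb gi] unfolding f2 .
    also have "(\<integral>x. (norm (grad f x))\<^sup>2 \<partial>M) \<le> X / 4"
      using integral_mono[OF gi _ gle] E(1) by (simp add: X_def)
    finally have e: "ent M (q m) \<le> C * (X / 4)" using C by simp
    have "k * X \<le> ent M (q m) + Z * L" using E(2) by (simp add: X_def Z_def)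
    with e have "(4 * k - C) * X \<le> 4 * (Z * L)" by (simp add: algebra_simps)
    then have "(X / 4) * (4 * k - C) \<le> Z * L" by (simp add: mult.commute)
    then have "X / 4 \<le> Z * L / (4 * k - C)" using k by (subst pos_le_divide_eq) auto
    then have "C * (X / 4) \<le> C * (Z * L / (4 * k - C))"
      using C by (intro mult_left_mono) auto
    also have "\<dots> = c * Z" by (simp add: c_def)
    finally have "ent M (q m) \<le> c * Z" using e by simp
    then have "l * (\<integral>x. q m x * indicator A x \<partial>M) \<le> c * Z + Z * ln 2"
      using entropy_small_set[of M "q m", OF M(1) _ q0 qm A less_imp_le[OF l0]] by (simp add: Z_def)
    also have "\<dots> = l * (Z / 2)" by (simp add: l_def algebra_simps)
    finally have "(\<integral>x. q m x * indicator A x \<partial>M) \<le> Z / 2" using l0 by (simp only: mult_le_cancel_left_pos)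
    moreover have "Z \<le> (\<integral>x. 2 + q m x * indicator A x \<partial>M)"
      unfolding Z_def
    proof (rule integral_mono)
      show iq: "integrable M (q m)" by (rule integrable_const_bound[of _ ?N]) (use q0 qm in auto)
      show "integrable M (\<lambda>x. 2 + q m x * indicator A x)"
        using integrable_real_mult_indicator[OF A(1) iq] by simp
      show "q m x \<le> 2 + q m x * indicator A x" for x
      proof (cases "x \<in> A")
        case False
        then have "y x \<le> 1" by (simp add: A_def y_def)
        then show ?thesis using qy[of m x] False by simp
      qed simp
    qed
    moreover have "(\<integral>x. 2 + q m x * indicator A x \<partial>M) = 2 + (\<integral>x. q m x * indicator A x \<partial>M)"
    proof -
      have iq: "integrable M (q m)" by (rule integrable_const_bound[of _ ?N]) (use q0 qm in auto)
      show ?thesis using integrable_real_mult_indicator[OF A(1) iq] by (simp add: prob_space)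
    qed
    ultimately show ?thesis by (simp add: Z_def)
  qed
  have lim: "(\<lambda>m. q m x) \<longlonglongrightarrow> 1 + y x" for x
  proof -
    have "(\<lambda>m. (1 + y x) / (1 + y x * inverse (real (Suc m)))) \<longlonglongrightarrow> (1 + y x) / (1 + y x * 0)"
      by (intro tendsto_intros LIMSEQ_inverse_real_of_nat) simp
    then show ?thesis by (simp add: q_def divide_inverse add.commute)
  qed
  have "(\<integral>\<^sup>+x. ennreal (1 + y x) \<partial>M) = (\<integral>\<^sup>+x. liminf (\<lambda>m. ennreal (q m x)) \<partial>M)"
    by (intro nn_integral_cong lim_imp_Liminf[symmetric] tendsto_ennrealI lim) simp
  also have "\<dots> \<le> liminf (\<lambda>m. \<integral>\<^sup>+x. ennreal (q m x) \<partial>M)"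
    by (rule nn_integral_liminf) simp
  also have "\<dots> \<le> liminf (\<lambda>m. ennreal 4)"
  proof (intro Liminf_mono always_eventually allI)
    fix m
    have "integrable M (q m)" by (rule integrable_const_bound[of _ "real m + 1"]) (use q0 qm in auto)
    then have "(\<integral>\<^sup>+x. ennreal (q m x) \<partial>M) = ennreal (\<integral>x. q m x \<partial>M)"
      using q0 by (intro nn_integral_eq_integral) auto
    then show "(\<integral>\<^sup>+x. ennreal (q m x) \<partial>M) \<le> ennreal 4" using Z4[of m] by (metis ennreal_leI)
  qed
  also have "\<dots> < \<infinity>" by (simp add: Liminf_const)
  finally have "integrable M (\<lambda>x. 1 + y x)"
    using y0 by (intro integrableI_nonneg) (auto simp: less_imp_le add_nonneg_nonneg)
  then have "integrable M (\<lambda>x. exp (real n) * ((1 + y x) - 1))"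
    by (intro integrable_mult_right Bochner_Integration.integrable_diff integrable_const)
  moreover have "exp (real n) * ((1 + y x) - 1) = exp (- W x)" for x
    by (simp add: y_def flip: exp_add)
  ultimately show ?thesis by (simp only:)
qed

abbreviation N where "N \<equiv> density M (\<lambda>x. ennreal (exp (W x)))"

lemma N_integral:
  assumes "f \<in> borel_measurable M"
  shows "(\<integral>x. f x \<partial>N) = (\<integral>x. exp (W x) * f x \<partial>M)"
  using assms by (subst integral_density) auto

text \<open>The function \<open>g = f * exp (W / 2)\<close> is inserted into the inequality for \<open>M\<close>. The energy of \<open>g\<close>
  contains the energy of the weight, which \<open>weight_energy_le\<close> turns back into entropy of \<open>g\<^sup>2\<close>; because
  of \<open>4 * k > C\<close> this happens with a factor \<open>t < 1\<close> and can be absorbed. The entropies of \<open>g\<^sup>2\<close> under \<open>M\<close>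
  and of \<open>f\<^sup>2\<close> under \<open>N\<close> differ by the integral of \<open>g\<^sup>2 * W\<close>, which the entropy controls as well since
  \<open>exp (- W)\<close> is integrable.\<close>

lemma defective_log_sobolev_support:
  "\<exists>A B. A \<ge> 0 \<and> B \<ge> 0 \<and> (\<forall>f\<in>C1. \<forall>r. (\<forall>x. norm x \<ge> r \<longrightarrow> f x = 0 \<and> grad f x = 0) \<longrightarrow>
     ent N (\<lambda>x. (f x)\<^sup>2) \<le> A * (\<integral>x. (norm (grad f x))\<^sup>2 \<partial>N) + B * (\<integral>x. (f x)\<^sup>2 \<partial>N))"
proof -
  \<comment> \<open>the weight \<open>s\<close> splits the square of \<open>grad g\<close> so that the energy of the weight gets the factor \<open>t * k\<close>\<close>
  define r where "r = 4 * k / C"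
  have r: "r > 1" unfolding r_def using k C by simp
  define s where "s = 2 / (r - 1)"
  have s: "s > 0" "1 + 1 / s = (1 + r) / 2" unfolding s_def using r by (auto simp: field_simps)
  define t where "t = (1 + r) / (2 * r)"
  have t: "t \<ge> 0" "t < 1" unfolding t_def using r by (auto simp: field_simps)
  have Ct: "C * ((1 + r) / 2) / 4 = t * k" unfolding t_def r_def using C k by (simp add: field_simps)
  define L' where "L' = ln (\<integral>x. exp (- W x) \<partial>M)"
  define A where "A = 2 * (C * (1 + s) / (1 - t))"
  define B where "B = 2 * (t * L / (1 - t)) + \<bar>L'\<bar>"
  have AB: "A \<ge> 0" "B \<ge> 0" unfolding A_def B_def using C s t L_nonneg by auto
  have main: "ent N (\<lambda>x. (f x)\<^sup>2) \<le> A * (\<integral>x. (norm (grad f x))\<^sup>2 \<partial>N) + B * (\<integral>x. (f x)\<^sup>2 \<partial>N)"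
    if f: "f \<in> C1" and supp: "\<And>x. norm x \<ge> R \<Longrightarrow> f x = 0 \<and> grad f x = 0" for f R
  proof -
    have [measurable]: "f \<in> borel_measurable M" "grad f \<in> borel_measurable M"
      using C1_D[OF f] M(2) by (auto cong: measurable_cong_sets)
    have cont [continuous_intros]: "continuous_on UNIV f" "continuous_on UNIV W" "continuous_on UNIV (grad f)"
      "continuous_on UNIV (grad W)"
      using C1_D[OF f] C1_D[OF W] by auto
    have "DERIV (\<lambda>w. exp (w / 2)) w :> exp (w / 2) / 2" for w :: real
      by (auto intro!: derivative_eq_intros)
    then have eW: "(\<lambda>x. exp (W x / 2)) \<in> C1" "grad (\<lambda>x. exp (W x / 2)) = (\<lambda>x. (exp (W x / 2) / 2) *\<^sub>R grad W x)"
      using C1_compose[OF W, of "\<lambda>w. exp (w / 2)" "\<lambda>w. exp (w / 2) / 2"]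
        continuous_on_subset[of UNIV "\<lambda>w::real. exp (w / 2) / 2" "range W"]
      by (simp_all add: continuous_intros)
    define g where "g x = exp (W x / 2) * f x" for x
    have g: "g \<in> C1" "grad g = (\<lambda>x. exp (W x / 2) *\<^sub>R grad f x + f x *\<^sub>R (exp (W x / 2) / 2) *\<^sub>R grad W x)"
      unfolding g_def[abs_def] using C1_mult[OF eW(1) f] by (auto simp: eW)
    have gsupp: "g x = 0 \<and> grad g x = 0" if "norm x \<ge> R" for x
      using supp[OF that] by (simp add: g g_def)
    have gb: "g \<in> C1b" by (rule C1b_continuous_support[OF g(1) gsupp])
    obtain K where K: "K > 0" "\<And>x. \<bar>g x\<bar> \<le> K" using C1b_D[OF gb] by metis
    have g2K: "(g x)\<^sup>2 \<le> K\<^sup>2" for x using K(1) K(2)[of x] by (simp add: abs_le_square_iff[symmetric])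
    have [measurable]: "g \<in> borel_measurable M"
      using C1_D[OF g(1)] M(2) by (auto cong: measurable_cong_sets)
    have g2: "(g x)\<^sup>2 = exp (W x) * (f x)\<^sup>2" for x
      by (simp add: g_def power_mult_distrib power2_eq_square flip: exp_add)
    define D where "D = (\<integral>x. (norm (grad f x))\<^sup>2 \<partial>N)"
    define S where "S = (\<integral>x. (f x)\<^sup>2 \<partial>N)"
    define X where "X = (\<integral>x. (g x)\<^sup>2 * (norm (grad W x))\<^sup>2 \<partial>M)"
    define E where "E = ent M (\<lambda>x. (g x)\<^sup>2)"
    have S: "S = (\<integral>x. (g x)\<^sup>2 \<partial>M)" by (simp add: S_def N_integral g2)
    have D: "D = (\<integral>x. exp (W x) * (norm (grad f x))\<^sup>2 \<partial>M)" by (simp add: D_def N_integral)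
    have S0: "S \<ge> 0" and D0: "D \<ge> 0" unfolding S_def D_def by simp_all
    note int = integrable_continuous_support[OF finite_measure_axioms M(2), where r=R]
    have iD: "integrable M (\<lambda>x. exp (W x) * (norm (grad f x))\<^sup>2)"
      by (rule int) (auto intro!: continuous_intros simp: supp)
    have iX: "integrable M (\<lambda>x. (g x)\<^sup>2 * (norm (grad W x))\<^sup>2)"
      by (rule int) (auto intro!: continuous_intros C1_D(3)[OF g(1)] simp: gsupp)
    have iG: "integrable M (\<lambda>x. (norm (grad g x))\<^sup>2)"
      by (rule int) (auto intro!: continuous_intros C1_D(2)[OF g(1)] simp: gsupp)
    have iW: "integrable M (\<lambda>x. (g x)\<^sup>2 * W x)"
      by (rule int) (auto intro!: continuous_intros C1_D(3)[OF g(1)] simp: gsupp)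
    note il = integrable_x_ln_x[OF finite_measure_axioms _ _ g2K, of "\<lambda>x. x", simplified]
    have "(\<integral>x. (norm (grad g x))\<^sup>2 \<partial>M)
        \<le> (\<integral>x. (1 + s) * (exp (W x) * (norm (grad f x))\<^sup>2) + (1 + 1 / s) / 4 * ((g x)\<^sup>2 * (norm (grad W x))\<^sup>2) \<partial>M)"
    proof (rule integral_mono[OF iG])
      show "integrable M (\<lambda>x. (1 + s) * (exp (W x) * (norm (grad f x))\<^sup>2) + (1 + 1 / s) / 4 * ((g x)\<^sup>2 * (norm (grad W x))\<^sup>2))"
        using iD iX by (intro Bochner_Integration.integrable_add integrable_mult_right)
      show "(norm (grad g x))\<^sup>2 \<le> (1 + s) * (exp (W x) * (norm (grad f x))\<^sup>2) + (1 + 1 / s) / 4 * ((g x)\<^sup>2 * (norm (grad W x))\<^sup>2)" for x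
      proof -
        have ee: "(exp (W x / 2))\<^sup>2 = exp (W x)" by (simp add: power2_eq_square flip: exp_add)
        have "(norm (grad g x))\<^sup>2 \<le> (1 + s) * (norm (exp (W x / 2) *\<^sub>R grad f x))\<^sup>2
           + (1 + 1 / s) * (norm (f x *\<^sub>R (exp (W x / 2) / 2) *\<^sub>R grad W x))\<^sup>2"
          unfolding g by (rule norm_add_square_le[OF s(1)])
        also have "(norm (exp (W x / 2) *\<^sub>R grad f x))\<^sup>2 = exp (W x) * (norm (grad f x))\<^sup>2"
          by (simp add: power_mult_distrib ee)
        also have "(norm (f x *\<^sub>R (exp (W x / 2) / 2) *\<^sub>R grad W x))\<^sup>2 = (g x)\<^sup>2 * (norm (grad W x))\<^sup>2 / 4"
          by (simp add: power_mult_distrib power_divide ee g2)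
        finally show ?thesis by simp
      qed
    qed
    also have "\<dots> = (1 + s) * D + (1 + r) / 2 / 4 * X"
      using iD iX by (simp add: D X_def s(2))
    finally have gD: "(\<integral>x. (norm (grad g x))\<^sup>2 \<partial>M) \<le> (1 + s) * D + (1 + r) / 2 / 4 * X" .
    have "E \<le> C * (\<integral>x. (norm (grad g x))\<^sup>2 \<partial>M)"
      unfolding E_def by (rule log_sobolev_imp_ent_le[OF finite_measure_axioms M(2) LSI _ gb]) (use C in simp)
    also have "\<dots> \<le> C * ((1 + s) * D + (1 + r) / 2 / 4 * X)" using gD C by (intro mult_left_mono) auto
    also have "\<dots> = C * (1 + s) * D + C * ((1 + r) / 2) / 4 * X" by (simp add: algebra_simps)
    also have "\<dots> = C * (1 + s) * D + t * (k * X)" unfolding Ct by simp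
    also have "\<dots> \<le> C * (1 + s) * D + t * (E + S * L)"
      using weight_energy_le(2)[OF _ _ g2K] t by (intro add_left_mono mult_left_mono) (auto simp: X_def E_def S)
    finally have "(1 - t) * E \<le> C * (1 + s) * D + t * L * S" by (simp add: algebra_simps)
    then have "E \<le> (C * (1 + s) * D + t * L * S) / (1 - t)" using t by (simp add: pos_le_divide_eq mult.commute)
    then have E: "2 * E \<le> A * D + 2 * (t * L / (1 - t)) * S" by (simp add: A_def add_divide_distrib)
    have "(\<integral>x. (g x)\<^sup>2 * (- W x) \<partial>M) \<le> E + S * L'"
      unfolding E_def S L'_def
      by (rule entropy_variational[OF M(1) _ _ g2K _ exp_neg_weight_integrable]) (use iW in auto)
    then have Wle: "- (\<integral>x. (g x)\<^sup>2 * W x \<partial>M) \<le> E + S * L'" by simp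
    have "exp (W x) * ((f x)\<^sup>2 * ln ((f x)\<^sup>2)) = (g x)\<^sup>2 * ln ((g x)\<^sup>2) - (g x)\<^sup>2 * W x" for x
    proof (cases "f x = 0")
      case False
      then have "ln ((g x)\<^sup>2) = W x + ln ((f x)\<^sup>2)" unfolding g2 by (simp add: ln_mult)
      then show ?thesis by (simp add: g2 algebra_simps)
    qed (simp add: g_def)
    then have "(\<integral>x. (f x)\<^sup>2 * ln ((f x)\<^sup>2) \<partial>N) = (\<integral>x. (g x)\<^sup>2 * ln ((g x)\<^sup>2) \<partial>M) - (\<integral>x. (g x)\<^sup>2 * W x \<partial>M)"
      using il iW by (simp add: N_integral)
    then have "ent N (\<lambda>x. (f x)\<^sup>2) = E - (\<integral>x. (g x)\<^sup>2 * W x \<partial>M)"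
      by (simp add: ent_def E_def S[symmetric] S_def[symmetric])
    also have "\<dots> \<le> 2 * E + S * L'" using Wle by simp
    also have "\<dots> \<le> A * D + 2 * (t * L / (1 - t)) * S + S * \<bar>L'\<bar>"
      using E S0 by (intro add_mono mult_left_mono) auto
    also have "\<dots> = A * D + B * S" by (simp add: B_def algebra_simps)
    finally show ?thesis by (simp add: D_def S_def)
  qed
  show ?thesis
    by (intro exI[of _ A] exI[of _ B] conjI AB ballI allI impI main) auto
qed

lemma defective_log_sobolev:
  "\<exists>A B. A \<ge> 0 \<and> B \<ge> 0 \<and> (\<forall>f\<in>C1b.
     ent N (\<lambda>x. (f x)\<^sup>2) \<le> A * (\<integral>x. (norm (grad f x))\<^sup>2 \<partial>N) + B * (\<integral>x. (f x)\<^sup>2 \<partial>N))"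
proof -
  obtain A B where AB: "A \<ge> 0" "B \<ge> 0" and supp:
    "\<forall>f\<in>C1. \<forall>r. (\<forall>x. norm x \<ge> r \<longrightarrow> f x = 0 \<and> grad f x = 0) \<longrightarrow>
     ent N (\<lambda>x. (f x)\<^sup>2) \<le> A * (\<integral>x. (norm (grad f x))\<^sup>2 \<partial>N) + B * (\<integral>x. (f x)\<^sup>2 \<partial>N)"
    using defective_log_sobolev_support by (elim exE conjE)
  interpret N: prob_space N by (rule weight)
  have "ent N (\<lambda>x. (f x)\<^sup>2) \<le> A * (\<integral>x. (norm (grad f x))\<^sup>2 \<partial>N) + B * (\<integral>x. (f x)\<^sup>2 \<partial>N)" if f: "f \<in> C1b" for f
  proof -
    obtain K where K: "f \<in> C1" "K > 0" "\<And>x. \<bar>f x\<bar> \<le> K" "\<And>x. norm (grad f x) \<le> K"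
      using C1b_D[OF f] by blast
    have m: "grad f \<in> borel_measurable N"
      using C1_D[OF K(1)] M(2) by (auto cong: measurable_cong_sets)
    have i: "integrable N (\<lambda>x. (norm (grad f x))\<^sup>2)"
    proof (rule N.integrable_const_bound[of _ "K\<^sup>2"])
      show "AE x in N. norm ((norm (grad f x))\<^sup>2) \<le> K\<^sup>2"
        using K(4) by (intro AE_I2) (simp add: power_mono)
    qed (use m in measurable)
    show ?thesis
    proof (rule ent_le_if_cutoff[OF N.finite_measure_axioms _ K(1) K(3) i])
      show "sets N = sets borel" using M(2) by simp
      fix n
      have "\<forall>x. norm x \<ge> real n + 1 \<longrightarrow> cutoff n x * f x = 0 \<and> grad (\<lambda>x. cutoff n x * f x) x = 0"
        by (intro allI impI cutoff_mult_C1b(3)[OF K(1)])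
      from supp[rule_format, OF cutoff_mult_C1b(2)[OF K(1)] this[rule_format]]
      show "ent N (\<lambda>x. (cutoff n x * f x)\<^sup>2) \<le> A * (\<integral>x. (norm (grad (\<lambda>x. cutoff n x * f x) x))\<^sup>2 \<partial>N)
        + B * (\<integral>x. (cutoff n x * f x)\<^sup>2 \<partial>N)" .
    qed
  qed
  then show ?thesis using AB by blast
qed

end


section \<open>Averages over segments\<close>

text \<open>The homothety with centre \<open>a\<close> and ratio \<open>c\<close> maps \<open>B\<close> into itself, and its Jacobian is at least
  \<open>2\<close> to the power minus the dimension.\<close>

lemma nn_integral_contraction_le:
  fixes k :: "'a::euclidean_space \<Rightarrow> ennreal"
  assumes [measurable]: "k \<in> borel_measurable borel" "B \<in> sets borel"
    and B: "convex B" "a \<in> B" and c: "1 / 2 \<le> c" "c \<le> 1"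
  shows "(\<integral>\<^sup>+y\<in>B. k (a + c *\<^sub>R (y - a)) \<partial>lborel) \<le> 2 ^ DIM('a) * (\<integral>\<^sup>+y\<in>B. k y \<partial>lborel)"
proof -
  define J where "J = (\<integral>\<^sup>+y\<in>B. k (a + c *\<^sub>R (y - a)) \<partial>lborel)"
  define T where "T y = (1 - c) *\<^sub>R a + c *\<^sub>R y" for y
  have T: "a + c *\<^sub>R (y - a) = T y" for y by (simp add: T_def algebra_simps)
  have TB: "T y \<in> B" if "y \<in> B" for y
    unfolding T_def using B c that by (intro convexD) auto
  have "J \<le> (\<integral>\<^sup>+y. k (T y) * indicator B (T y) \<partial>lborel)"
    unfolding J_def T by (intro nn_integral_mono) (auto simp: indicator_def TB)
  then have "ennreal (\<bar>c\<bar> ^ DIM('a)) * J \<le> ennreal (\<bar>c\<bar> ^ DIM('a)) * (\<integral>\<^sup>+y. k (T y) * indicator B (T y) \<partial>lborel)"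
    by (intro mult_left_mono) auto
  also have "\<dots> = (\<integral>\<^sup>+y\<in>B. k y \<partial>lborel)"
    by (subst (2) lborel_affine[of c "(1 - c) *\<^sub>R a"], use c in simp)
      (simp add: nn_integral_density nn_integral_distr nn_integral_cmult T_def)
  finally have "2 ^ DIM('a) * (ennreal (\<bar>c\<bar> ^ DIM('a)) * J) \<le> 2 ^ DIM('a) * (\<integral>\<^sup>+y\<in>B. k y \<partial>lborel)"
    by (intro mult_left_mono) auto
  moreover have "1 * J \<le> (2 ^ DIM('a) * ennreal (\<bar>c\<bar> ^ DIM('a))) * J"
  proof (rule mult_right_mono)
    have "1 \<le> (2 * c) ^ DIM('a)" using c by (intro one_le_power) auto
    then have "ennreal 1 \<le> ennreal ((2 * c) ^ DIM('a))" by (rule ennreal_leI)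
    also have "\<dots> = 2 ^ DIM('a) * ennreal (\<bar>c\<bar> ^ DIM('a))"
      using c by (simp add: power_mult_distrib ennreal_mult ennreal_power[symmetric])
    finally show "1 \<le> 2 ^ DIM('a) * ennreal (\<bar>c\<bar> ^ DIM('a))" by simp
  qed simp
  ultimately show ?thesis by (simp add: J_def mult.assoc)
qed

text \<open>The point \<open>x + t *\<^sub>R (y - x)\<close> is a contraction of \<open>y\<close> towards \<open>x\<close> with ratio \<open>t\<close> and of \<open>x\<close> towards \<open>y\<close>
  with ratio \<open>1 - t\<close>. One of the ratios is at least \<open>1 / 2\<close>.\<close>

lemma nn_integral_segment_le:
  fixes k :: "'a::euclidean_space \<Rightarrow> ennreal"
  assumes [measurable]: "k \<in> borel_measurable borel" "B \<in> sets borel" and B: "convex B"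
  shows "(\<integral>\<^sup>+x\<in>B. (\<integral>\<^sup>+y\<in>B. (\<integral>\<^sup>+t\<in>{0..1::real}. k (x + t *\<^sub>R (y - x)) \<partial>lborel) \<partial>lborel) \<partial>lborel)
    \<le> 2 ^ DIM('a) * emeasure lborel B * (\<integral>\<^sup>+y\<in>B. k y \<partial>lborel)"
proof -
  define I where "I = (\<integral>\<^sup>+y\<in>B. k y \<partial>lborel)"
  define F where "F x y t = k (x + t *\<^sub>R (y - x)) * indicator {0..1} t * indicator B y * indicator B x" for x y and t :: real
  have [measurable (raw)]: "(\<lambda>w. F (f w) (g w) (h w)) \<in> borel_measurable N"
    if [measurable]: "f \<in> borel_measurable N" "g \<in> borel_measurable N" "h \<in> borel_measurable N" for f g h and N :: "'b measure"
    unfolding F_def by measurable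
  have "(\<integral>\<^sup>+x\<in>B. (\<integral>\<^sup>+y\<in>B. (\<integral>\<^sup>+t\<in>{0..1::real}. k (x + t *\<^sub>R (y - x)) \<partial>lborel) \<partial>lborel) \<partial>lborel)
      = (\<integral>\<^sup>+x. (\<integral>\<^sup>+y. (\<integral>\<^sup>+t. F x y t \<partial>lborel) \<partial>lborel) \<partial>lborel)"
    unfolding F_def by (subst nn_integral_multc, measurable)+
  also have "\<dots> = (\<integral>\<^sup>+x. (\<integral>\<^sup>+t. (\<integral>\<^sup>+y. F x y t \<partial>lborel) \<partial>lborel) \<partial>lborel)"
    by (intro nn_integral_cong lborel_pair.Fubini') measurable
  also have "\<dots> = (\<integral>\<^sup>+t. (\<integral>\<^sup>+x. (\<integral>\<^sup>+y. F x y t \<partial>lborel) \<partial>lborel) \<partial>lborel)"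
    by (intro lborel_pair.Fubini') measurable
  also have "\<dots> \<le> (\<integral>\<^sup>+t. 2 ^ DIM('a) * emeasure lborel B * I * indicator {0..1::real} t \<partial>lborel)"
  proof (intro nn_integral_mono)
    fix t :: real
    have key: "(\<integral>\<^sup>+x. (\<integral>\<^sup>+y. k (x + s *\<^sub>R (y - x)) * indicator B y * indicator B x \<partial>lborel) \<partial>lborel)
        \<le> 2 ^ DIM('a) * emeasure lborel B * I" if s: "1/2 \<le> s" "s \<le> 1" for s :: real
    proof -
      have "(\<integral>\<^sup>+x. (\<integral>\<^sup>+y. k (x + s *\<^sub>R (y - x)) * indicator B y * indicator B x \<partial>lborel) \<partial>lborel)
        \<le> (\<integral>\<^sup>+x. 2 ^ DIM('a) * I * indicator B x \<partial>lborel)"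
      proof (intro nn_integral_mono)
        fix x
        show "(\<integral>\<^sup>+y. k (x + s *\<^sub>R (y - x)) * indicator B y * indicator B x \<partial>lborel) \<le> 2 ^ DIM('a) * I * indicator B x"
          using nn_integral_contraction_le[OF assms(1,2) B _ s, of x]
          by (auto simp: indicator_def I_def)
      qed
      also have "\<dots> = 2 ^ DIM('a) * emeasure lborel B * I"
        by (subst nn_integral_cmult_indicator) (auto simp: ac_simps)
      finally show ?thesis .
    qed
    consider "t \<notin> {0..1}" | "t \<in> {1/2..1}" | "t \<in> {0..1/2}" by fastforce
    then show "(\<integral>\<^sup>+x. (\<integral>\<^sup>+y. F x y t \<partial>lborel) \<partial>lborel) \<le> 2 ^ DIM('a) * emeasure lborel B * I * indicator {0..1::real} t"
    proof cases
      case 1 then show ?thesis by (simp add: F_def)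
    next
      case 2 then show ?thesis using key[of t] by (simp add: F_def)
    next
      case 3
      have "(\<integral>\<^sup>+x. (\<integral>\<^sup>+y. F x y t \<partial>lborel) \<partial>lborel) = (\<integral>\<^sup>+y. (\<integral>\<^sup>+x. F x y t \<partial>lborel) \<partial>lborel)"
        by (intro lborel_pair.Fubini') measurable
      also have "\<dots> = (\<integral>\<^sup>+y. (\<integral>\<^sup>+x. k (y + (1 - t) *\<^sub>R (x - y)) * indicator B x * indicator B y \<partial>lborel) \<partial>lborel)"
        using 3 by (intro nn_integral_cong) (simp add: F_def algebra_simps)
      also have "\<dots> \<le> 2 ^ DIM('a) * emeasure lborel B * I" using 3 by (intro key) auto
      finally show ?thesis using 3 by simp
    qed
  qed
  also have "\<dots> = 2 ^ DIM('a) * emeasure lborel B * I"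
    by (subst nn_integral_cmult_indicator) auto
  finally show ?thesis by (simp add: I_def)
qed

section \<open>A local Poincare inequality\<close>

lemma GDERIV_along_line:
  fixes f :: "'a::euclidean_space \<Rightarrow> real"
  assumes "GDERIV f (x + t *\<^sub>R w) :> D"
  shows "((\<lambda>t. f (x + t *\<^sub>R w)) has_vector_derivative (w \<bullet> D)) (at t within S)"
proof -
  have "((\<lambda>t. x + t *\<^sub>R w) has_derivative (\<lambda>h. h *\<^sub>R w)) (at t)"
    by (auto intro!: derivative_eq_intros)
  from diff_chain_at[OF this assms[unfolded gderiv_def]]
  have "((\<lambda>t. f (x + t *\<^sub>R w)) has_derivative (\<lambda>h. h *\<^sub>R (w \<bullet> D))) (at t)"
    by (simp add: o_def)
  then show ?thesis unfolding has_vector_derivative_def by (rule has_derivative_at_withinI)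
qed

lemma C1_increment:
  fixes f :: "'a::euclidean_space \<Rightarrow> real"
  assumes f: "f \<in> C1" and st: "s \<le> t"
  shows "((\<lambda>r. w \<bullet> grad f (x + r *\<^sub>R w)) has_integral (f (x + t *\<^sub>R w) - f (x + s *\<^sub>R w))) {s..t}"
  by (rule fundamental_theorem_of_calculus[OF st])
    (intro GDERIV_along_line C1_D(1)[OF f])

lemma square_integral_le:
  fixes g :: "real \<Rightarrow> real"
  assumes g: "continuous_on {0..1} g"
  shows "(integral {0..1} g)\<^sup>2 \<le> integral {0..1} (\<lambda>t. (g t)\<^sup>2)"
proof -
  define c where "c = integral {0..1} g"
  have i: "g integrable_on {0..1}" "(\<lambda>t. (g t)\<^sup>2) integrable_on {0..1}"
    by (auto intro!: integrable_continuous_interval continuous_intros g)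
  have "0 \<le> integral {0..1} (\<lambda>t. (g t - c)\<^sup>2)" by (rule integral_nonneg) (auto intro!: integrable_continuous_interval continuous_intros g)
  also have "(\<lambda>t. (g t - c)\<^sup>2) = (\<lambda>t. (g t)\<^sup>2 - 2 * c * g t + c\<^sup>2)"
    by (simp add: power2_diff algebra_simps)
  also have "integral {0..1} \<dots> = integral {0..1} (\<lambda>t. (g t)\<^sup>2) - c\<^sup>2"
  proof -
    have k: "((\<lambda>t. c\<^sup>2) has_integral c\<^sup>2) {0..1::real}" using has_integral_const_real[of "c\<^sup>2" 0 1] by simp
    have "((\<lambda>t. (g t)\<^sup>2 - 2 * c * g t + c\<^sup>2) has_integral
        (integral {0..1} (\<lambda>t. (g t)\<^sup>2) - 2 * c * integral {0..1} g + c\<^sup>2)) {0..1}"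
      by (intro has_integral_add has_integral_diff has_integral_mult_right integrable_integral i k)
    then show "integral {0..1} (\<lambda>t. (g t)\<^sup>2 - 2 * c * g t + c\<^sup>2) = integral {0..1} (\<lambda>t. (g t)\<^sup>2) - c\<^sup>2"
      by (simp add: integral_unique power2_eq_square c_def[symmetric])
  qed
  finally show ?thesis by (simp add: c_def)
qed

lemma nn_integral_continuous_interval:
  fixes g :: "real \<Rightarrow> real"
  assumes "continuous_on {a..b} g" "\<And>t. t \<in> {a..b} \<Longrightarrow> 0 \<le> g t"
  shows "(\<integral>\<^sup>+t\<in>{a..b}. ennreal (g t) \<partial>lborel) = ennreal (integral {a..b} g)"
proof -
  have i: "set_integrable lborel {a..b} g" by (rule borel_integrable_atLeastAtMost'[OF assms(1)])
  have "(\<integral>\<^sup>+t\<in>{a..b}. ennreal (g t) \<partial>lborel) = (\<integral>\<^sup>+t. ennreal (indicator {a..b} t *\<^sub>R g t) \<partial>lborel)"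
    by (intro nn_integral_cong) (auto simp: indicator_def)
  also have "\<dots> = ennreal (LINT t:{a..b}|lborel. g t)"
    unfolding set_lebesgue_integral_def using i assms(2)
    by (intro nn_integral_eq_integral) (auto simp: set_integrable_def indicator_def)
  also have "(LINT t:{a..b}|lborel. g t) = integral {a..b} g" by (rule set_borel_integral_eq_integral(2)[OF i])
  finally show ?thesis .
qed

lemma C1_square_increment_le:
  fixes f :: "'a::euclidean_space \<Rightarrow> real"
  assumes f: "f \<in> C1" and d: "norm (y - x) \<le> d"
  shows "ennreal ((f y - f x)\<^sup>2) \<le> ennreal (d\<^sup>2) * (\<integral>\<^sup>+t\<in>{0..1::real}. ennreal ((norm (grad f (x + t *\<^sub>R (y - x))))\<^sup>2) \<partial>lborel)"
proof -
  let ?g = "\<lambda>t. (y - x) \<bullet> grad f (x + t *\<^sub>R (y - x))"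
  have c: "continuous_on {0..1::real} (\<lambda>t. grad f (x + t *\<^sub>R (y - x)))"
    by (rule continuous_on_compose2[OF C1_D(2)[OF f]]) (auto intro!: continuous_intros)
  have "f y - f x = integral {0..1} ?g"
    using C1_increment[OF f, of 0 1 "y - x" x] by (simp add: integral_unique)
  moreover have "continuous_on {0..1} ?g" by (intro continuous_intros c)
  ultimately have "(f y - f x)\<^sup>2 \<le> integral {0..1} (\<lambda>t. (?g t)\<^sup>2)"
    using square_integral_le[of ?g] by simp
  also have "\<dots> \<le> integral {0..1} (\<lambda>t. d\<^sup>2 * (norm (grad f (x + t *\<^sub>R (y - x))))\<^sup>2)"
  proof (rule integral_le)
    show "(?g t)\<^sup>2 \<le> d\<^sup>2 * (norm (grad f (x + t *\<^sub>R (y - x))))\<^sup>2" for t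
    proof -
      have "\<bar>?g t\<bar> \<le> norm (y - x) * norm (grad f (x + t *\<^sub>R (y - x)))" by (rule Cauchy_Schwarz_ineq2)
      also have "\<dots> \<le> d * norm (grad f (x + t *\<^sub>R (y - x)))" using d by (intro mult_right_mono) auto
      finally have "\<bar>?g t\<bar>\<^sup>2 \<le> (d * norm (grad f (x + t *\<^sub>R (y - x))))\<^sup>2" by (intro power_mono) auto
      then show ?thesis by (simp add: power_mult_distrib)
    qed
  qed (auto intro!: integrable_continuous_interval continuous_intros c)
  finally have "ennreal ((f y - f x)\<^sup>2) \<le> ennreal (integral {0..1} (\<lambda>t. d\<^sup>2 * (norm (grad f (x + t *\<^sub>R (y - x))))\<^sup>2))"
    by (rule ennreal_leI)
  also have "\<dots> = (\<integral>\<^sup>+t\<in>{0..1}. ennreal (d\<^sup>2 * (norm (grad f (x + t *\<^sub>R (y - x))))\<^sup>2) \<partial>lborel)"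
    by (rule nn_integral_continuous_interval[symmetric]) (auto intro!: continuous_intros c)
  also have "\<dots> = ennreal (d\<^sup>2) * (\<integral>\<^sup>+t\<in>{0..1::real}. ennreal ((norm (grad f (x + t *\<^sub>R (y - x))))\<^sup>2) \<partial>lborel)"
  proof -
    have [measurable]: "grad f \<in> borel_measurable borel" by (rule C1_D[OF f])
    show ?thesis by (subst nn_integral_cmult[symmetric]) (auto simp: ennreal_mult mult.assoc)
  qed
  finally show ?thesis .
qed

text \<open>The constant \<open>a\<close> is the value of \<open>f\<close> at a point of the ball where the mean square distance to the
  other values of \<open>f\<close> does not exceed its average.\<close>

lemma ball_poincare:
  fixes f :: "'a::euclidean_space \<Rightarrow> real"
  assumes f: "f \<in> C1" and R: "R > 0"
  shows "\<exists>a. (\<integral>\<^sup>+y\<in>ball 0 R. ennreal ((f y - a)\<^sup>2) \<partial>lborel)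
    \<le> ennreal ((2 * R)\<^sup>2 * 2 ^ DIM('a)) * (\<integral>\<^sup>+y\<in>ball 0 R. ennreal ((norm (grad f y))\<^sup>2) \<partial>lborel)"
proof (rule ccontr)
  assume neg: "\<not> ?thesis"
  let ?B = "ball (0::'a) R"
  have [measurable]: "f \<in> borel_measurable borel" "grad f \<in> borel_measurable borel" by (rule C1_D[OF f])+
  have [measurable]: "?B \<in> sets borel" by simp
  define D where "D = (\<integral>\<^sup>+y\<in>?B. ennreal ((norm (grad f y))\<^sup>2) \<partial>lborel)"
  define K where "K = ennreal ((2 * R)\<^sup>2 * 2 ^ DIM('a))"
  define J where "J x = (\<integral>\<^sup>+y\<in>?B. ennreal ((f y - f x)\<^sup>2) \<partial>lborel)" for x
  have J: "K * D < J x" for x using neg by (auto simp: J_def K_def D_def not_le)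
  have Jm [measurable]: "J \<in> borel_measurable lborel" unfolding J_def by measurable
  have vol: "emeasure lborel ?B < \<infinity>" "emeasure lborel ?B \<noteq> 0"
  proof -
    have "unit_ball_vol (real DIM('a)) > 0" by (rule unit_ball_vol_pos) simp
    then have "unit_ball_vol (real DIM('a)) \<noteq> 0" by (rule less_imp_neq[THEN not_sym])
    then show "emeasure lborel ?B \<noteq> 0" using R by (simp add: emeasure_ball)
    show "emeasure lborel ?B < \<infinity>" by (rule emeasure_bounded_finite) simp
  qed
  have "D < \<infinity>"
  proof -
    obtain b where b: "\<And>x. norm x \<le> R \<Longrightarrow> norm (grad f x) \<le> b"
      using continuous_bounded_cball[OF C1_D(2)[OF f]] by blast
    have "D \<le> (\<integral>\<^sup>+y. ennreal (b\<^sup>2) * indicator ?B y \<partial>lborel)"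
      unfolding D_def using b by (intro nn_integral_mono) (auto simp: indicator_def power_mono)
    also have "\<dots> < \<infinity>" using vol by (simp add: nn_integral_cmult_indicator ennreal_mult_less_top)
    finally show ?thesis .
  qed
  have "(\<integral>\<^sup>+x. K * D * indicator ?B x \<partial>lborel) < (\<integral>\<^sup>+x\<in>?B. J x \<partial>lborel)"
  proof (rule nn_integral_less)
    show "(\<integral>\<^sup>+x. K * D * indicator ?B x \<partial>lborel) \<noteq> \<infinity>"
      using vol \<open>D < \<infinity>\<close> by (simp add: nn_integral_cmult_indicator ennreal_mult_eq_top_iff K_def less_top[symmetric])
    show "AE x in lborel. K * D * indicator ?B x \<le> J x * indicator ?B x"
      using J by (intro AE_I2) (auto simp: indicator_def less_imp_le)
    show "\<not> (AE x in lborel. J x * indicator ?B x \<le> K * D * indicator ?B x)"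
    proof
      assume "AE x in lborel. J x * indicator ?B x \<le> K * D * indicator ?B x"
      then have "AE x in lborel. x \<notin> ?B"
      proof (rule AE_mp, intro AE_I2 impI notI)
        fix x assume "J x * indicator ?B x \<le> K * D * indicator ?B x" "x \<in> ?B"
        then have "J x \<le> K * D" by simp
        then show False using J[of x] by (simp add: not_le[symmetric])
      qed
      then have "emeasure lborel {x \<in> space lborel. \<not> x \<notin> ?B} = 0" by (subst (asm) AE_iff_measurable[OF _ refl]) auto
      moreover have "{x \<in> space lborel. \<not> x \<notin> ?B} = ?B" by auto
      ultimately show False using vol(2) by metis
    qed
  qed auto
  also have "(\<integral>\<^sup>+x\<in>?B. J x \<partial>lborel) \<le> (\<integral>\<^sup>+x\<in>?B. (\<integral>\<^sup>+y\<in>?B. (ennreal ((2 * R)\<^sup>2) *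
       (\<integral>\<^sup>+t\<in>{0..1::real}. ennreal ((norm (grad f (x + t *\<^sub>R (y - x))))\<^sup>2) \<partial>lborel)) \<partial>lborel) \<partial>lborel)"
    unfolding J_def
  proof (intro nn_integral_mono)
    fix x :: 'a
    show "(\<integral>\<^sup>+y\<in>?B. ennreal ((f y - f x)\<^sup>2) \<partial>lborel) * indicator ?B x
      \<le> (\<integral>\<^sup>+y\<in>?B. (ennreal ((2 * R)\<^sup>2) *
       (\<integral>\<^sup>+t\<in>{0..1::real}. ennreal ((norm (grad f (x + t *\<^sub>R (y - x))))\<^sup>2) \<partial>lborel)) \<partial>lborel) * indicator ?B x"
    proof (cases "x \<in> ?B")
      case True
      have "ennreal ((f y - f x)\<^sup>2) * indicator ?B y \<le> (ennreal ((2 * R)\<^sup>2) *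
       (\<integral>\<^sup>+t\<in>{0..1::real}. ennreal ((norm (grad f (x + t *\<^sub>R (y - x))))\<^sup>2) \<partial>lborel)) * indicator ?B y" for y
      proof (cases "y \<in> ?B")
        case True
        then have "norm (y - x) \<le> 2 * R" using \<open>x \<in> ?B\<close> norm_triangle_ineq4[of y x] by (simp add: dist_norm)
        from C1_square_increment_le[OF f this] show ?thesis by (rule mult_right_mono) simp
      qed simp
      then have "(\<integral>\<^sup>+y\<in>?B. ennreal ((f y - f x)\<^sup>2) \<partial>lborel) \<le> (\<integral>\<^sup>+y\<in>?B. (ennreal ((2 * R)\<^sup>2) *
       (\<integral>\<^sup>+t\<in>{0..1::real}. ennreal ((norm (grad f (x + t *\<^sub>R (y - x))))\<^sup>2) \<partial>lborel)) \<partial>lborel)"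
        by (rule nn_integral_mono)
      then show ?thesis by (rule mult_right_mono) simp
    qed simp
  qed
  also have "\<dots> = ennreal ((2 * R)\<^sup>2) * (\<integral>\<^sup>+x\<in>?B. (\<integral>\<^sup>+y\<in>?B.
       (\<integral>\<^sup>+t\<in>{0..1::real}. ennreal ((norm (grad f (x + t *\<^sub>R (y - x))))\<^sup>2) \<partial>lborel) \<partial>lborel) \<partial>lborel)"
    by (simp add: nn_integral_cmult mult.assoc)
  also have "\<dots> \<le> ennreal ((2 * R)\<^sup>2) * (2 ^ DIM('a) * emeasure lborel ?B * D)"
    unfolding D_def by (intro mult_left_mono nn_integral_segment_le) auto
  also have "\<dots> = K * D * emeasure lborel ?B"
    by (simp add: K_def ennreal_mult ennreal_power[symmetric] ac_simps)
  also have "\<dots> = (\<integral>\<^sup>+x. K * D * indicator ?B x \<partial>lborel)" by (simp add: nn_integral_cmult_indicator)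
  finally show False by simp
qed

lemma local_poincare:
  fixes p :: "'a::euclidean_space \<Rightarrow> real"
  assumes p: "continuous_on UNIV p" "\<And>x. p x > 0" and fin: "finite_measure (density lborel p)"
  shows "\<exists>c\<ge>0. \<forall>f\<in>C1b. \<exists>a. (\<integral>x. (f x - a)\<^sup>2 * indicator (ball 0 (real n)) x \<partial>density lborel p)
     \<le> c * (\<integral>x. (norm (grad f x))\<^sup>2 \<partial>density lborel p)"
proof (cases "n = 0")
  case True
  then show ?thesis by (intro exI[of _ 0]) auto
next
  case False
  let ?N = "density lborel p" and ?B = "ball (0::'a) (real n)"
  interpret finite_measure ?N by fact
  have [measurable]: "?B \<in> sets borel" by simp
  have [measurable]: "p \<in> borel_measurable borel" by (rule borel_measurable_continuous_onI[OF p(1)])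
  have cc: "compact (cball (0::'a) (real n))" "cball (0::'a) (real n) \<noteq> {}" by auto
  obtain u where u: "\<And>x. norm x \<le> real n \<Longrightarrow> p x \<le> p u"
    using continuous_attains_sup[OF cc continuous_on_subset[OF p(1)]] unfolding mem_cball_0 Ball_def Bex_def by blast
  obtain l where l: "\<And>x. norm x \<le> real n \<Longrightarrow> p l \<le> p x"
    using continuous_attains_inf[OF cc continuous_on_subset[OF p(1)]] unfolding mem_cball_0 Ball_def Bex_def by blast
  define K where "K = (2 * real n)\<^sup>2 * 2 ^ DIM('a)"
  have K: "K \<ge> 0" by (simp add: K_def)
  define c where "c = p u * K / p l"
  have c: "c \<ge> 0" using p(2)[of u] p(2)[of l] K by (simp add: c_def)
  have "\<exists>a. (\<integral>x. (f x - a)\<^sup>2 * indicator ?B x \<partial>?N) \<le> c * (\<integral>x. (norm (grad f x))\<^sup>2 \<partial>?N)" if f: "f \<in> C1b" for f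
  proof -
    obtain k where k: "f \<in> C1" "k > 0" "\<And>x. \<bar>f x\<bar> \<le> k" "\<And>x. norm (grad f x) \<le> k"
      using C1b_D[OF f] by blast
    have [measurable]: "f \<in> borel_measurable borel" "grad f \<in> borel_measurable borel" by (rule C1_D[OF k(1)])+
    obtain a where a: "(\<integral>\<^sup>+y\<in>?B. ennreal ((f y - a)\<^sup>2) \<partial>lborel)
        \<le> ennreal K * (\<integral>\<^sup>+y\<in>?B. ennreal ((norm (grad f y))\<^sup>2) \<partial>lborel)"
      using ball_poincare[OF k(1), of "real n"] False by (auto simp: K_def)
    have ig: "integrable ?N (\<lambda>x. (norm (grad f x))\<^sup>2)"
      by (rule integrable_const_bound[of _ "k\<^sup>2"]) (use k in \<open>auto intro!: power_mono\<close>)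
    have "(\<integral>\<^sup>+x. ennreal ((f x - a)\<^sup>2 * indicator ?B x) \<partial>?N)
        = (\<integral>\<^sup>+x. ennreal (p x) * ennreal ((f x - a)\<^sup>2 * indicator ?B x) \<partial>lborel)"
      by (subst nn_integral_density) auto
    also have "\<dots> \<le> (\<integral>\<^sup>+x. ennreal (p u) * (ennreal ((f x - a)\<^sup>2) * indicator ?B x) \<partial>lborel)"
      using u by (intro nn_integral_mono) (auto simp: indicator_def intro!: mult_right_mono ennreal_leI)
    also have "\<dots> = ennreal (p u) * (\<integral>\<^sup>+y\<in>?B. ennreal ((f y - a)\<^sup>2) \<partial>lborel)"
      by (subst nn_integral_cmult) auto
    also have "\<dots> \<le> ennreal (p u) * (ennreal K * (\<integral>\<^sup>+y\<in>?B. ennreal ((norm (grad f y))\<^sup>2) \<partial>lborel))"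
      by (intro mult_left_mono a) auto
    also have "\<dots> = ennreal (p u) * ennreal K * (\<integral>\<^sup>+y\<in>?B. ennreal ((norm (grad f y))\<^sup>2) \<partial>lborel)"
      by (simp add: mult.assoc)
    also have "\<dots> \<le> ennreal (p u) * ennreal K * (\<integral>\<^sup>+y. ennreal (1 / p l) * (ennreal (p y) * ennreal ((norm (grad f y))\<^sup>2)) \<partial>lborel)"
    proof (intro mult_left_mono nn_integral_mono)
      fix y :: 'a
      show "ennreal ((norm (grad f y))\<^sup>2) * indicator ?B y \<le> ennreal (1 / p l) * (ennreal (p y) * ennreal ((norm (grad f y))\<^sup>2))"
      proof (cases "y \<in> ?B")
        case True
        then have "1 \<le> 1 / p l * p y" using l[of y] p(2)[of l] by (simp add: pos_le_divide_eq)
        then have "1 * (norm (grad f y))\<^sup>2 \<le> 1 / p l * p y * (norm (grad f y))\<^sup>2" by (rule mult_right_mono) simp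
        then show ?thesis using True p(2)[of l] p(2)[of y]
          by (simp add: ennreal_mult[symmetric] less_imp_le mult.assoc ennreal_leI)
      qed simp
    qed auto
    also have "\<dots> = ennreal (p u) * ennreal K * (ennreal (1 / p l) * (\<integral>\<^sup>+y. ennreal ((norm (grad f y))\<^sup>2) \<partial>?N))"
      by (subst nn_integral_cmult, measurable, subst nn_integral_density) auto
    also have "\<dots> = ennreal (c * (\<integral>x. (norm (grad f x))\<^sup>2 \<partial>?N))"
      using nn_integral_eq_integral[OF ig] p(2)[of u] p(2)[of l] K
      by (simp add: ennreal_mult[symmetric] c_def less_imp_le)
    finally have le: "(\<integral>\<^sup>+x. ennreal ((f x - a)\<^sup>2 * indicator ?B x) \<partial>?N) \<le> ennreal (c * (\<integral>x. (norm (grad f x))\<^sup>2 \<partial>?N))" .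
    have "(\<integral>x. (f x - a)\<^sup>2 * indicator ?B x \<partial>?N) \<le> c * (\<integral>x. (norm (grad f x))\<^sup>2 \<partial>?N)"
      using c by (intro integral_real_bounded le) auto
    then show ?thesis by blast
  qed
  then show ?thesis using c by blast
qed


section \<open>Passing to the limit in the fundamental theorem of calculus\<close>

lemma locally_bounded_compact:
  fixes P :: "real \<Rightarrow> real"
  assumes T: "compact T" and loc: "\<And>t. t \<in> T \<Longrightarrow> \<exists>e>0. \<exists>b. \<forall>s\<in>T. \<bar>s - t\<bar> < e \<longrightarrow> P s \<le> b"
  shows "\<exists>b. \<forall>t\<in>T. P t \<le> b"
proof -
  obtain e b where e: "\<And>t. t \<in> T \<Longrightarrow> e t > 0" "\<And>t s. t \<in> T \<Longrightarrow> s \<in> T \<Longrightarrow> \<bar>s - t\<bar> < e t \<Longrightarrow> P s \<le> b t"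
    using loc by metis
  have cover: "T \<subseteq> (\<Union>t\<in>T. ball t (e t))" using e(1) by force
  obtain F where F: "F \<subseteq> T" "finite F" "T \<subseteq> (\<Union>t\<in>F. ball t (e t))"
    using compactE_image[OF T open_ball cover] by blast
  have "P t \<le> (\<Sum>u\<in>F. \<bar>b u\<bar>)" if tT: "t \<in> T" for t
  proof -
    obtain u where u: "u \<in> F" "t \<in> ball u (e u)" using F tT by blast
    then have "P t \<le> b u" using e(2)[of u t] F tT by (auto simp: dist_real_def abs_minus_commute)
    also have "\<dots> \<le> \<bar>b u\<bar>" by simp
    also have "\<dots> \<le> (\<Sum>u\<in>F. \<bar>b u\<bar>)" using u F by (intro member_le_sum) auto
    finally show ?thesis .
  qed
  then show ?thesis by blast
qed

text \<open>Along a segment, \<open>P\<close> will be the density of the convolution and \<open>S n\<close>, \<open>g n\<close> the densities and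
  derivatives obtained by truncating the second factor. The bound on \<open>g n\<close> contains the limit \<open>P\<close> itself,
  so it is a domination only where \<open>P\<close> is known to be bounded; that \<open>P\<close> is bounded has to be proved.\<close>

locale increasing_primitives =
  fixes S :: "nat \<Rightarrow> real \<Rightarrow> real" and g :: "nat \<Rightarrow> real \<Rightarrow> real" and P h :: "real \<Rightarrow> real"
  assumes incr: "\<And>n t. t \<in> {0..1} \<Longrightarrow> S n t \<le> P t"
    and lim: "\<And>t. t \<in> {0..1} \<Longrightarrow> (\<lambda>n. S n t) \<longlonglongrightarrow> P t"
    and cont: "\<And>n. continuous_on {0..1} (g n)"
    and ftc: "\<And>n s t. 0 \<le> s \<Longrightarrow> s \<le> t \<Longrightarrow> t \<le> 1 \<Longrightarrow> S n t - S n s = integral {s..t} (g n)"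
    and bound: "\<And>n t. t \<in> {0..1} \<Longrightarrow> \<bar>g n t\<bar> \<le> h t * P t"
    and h: "h integrable_on {0..1}" "\<And>t. t \<in> {0..1} \<Longrightarrow> 0 \<le> h t"
    and P0: "\<And>t. t \<in> {0..1} \<Longrightarrow> 0 \<le> P t"
begin

lemma h_sub: "0 \<le> s \<Longrightarrow> t \<le> 1 \<Longrightarrow> h integrable_on {s..t}"
  by (rule integrable_on_subinterval[OF h(1)]) auto

lemma h_integral_mono:
  assumes "0 \<le> s" "s \<le> s'" "t' \<le> t" "t \<le> 1"
  shows "integral {s'..t'} h \<le> integral {s..t} h"
proof (rule integral_subset_le)
  show "h integrable_on {s'..t'}" "h integrable_on {s..t}" using assms by (auto intro!: h_sub)
qed (use assms in \<open>auto intro: h(2)\<close>)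

lemma S_continuous: "continuous_on {0..1} (S n)"
proof -
  have "continuous_on {0..1} (\<lambda>t. S n 0 + integral {0..t} (g n))"
    by (intro continuous_intros indefinite_integral_continuous_1 integrable_continuous_interval cont)
  then show ?thesis
  proof (rule continuous_on_eq)
    show "S n 0 + integral {0..t} (g n) = S n t" if "t \<in> {0..1}" for t
      using ftc[of 0 t n] that by simp
  qed
qed

lemma increment_bounded:
  assumes st: "0 \<le> s" "s \<le> t" "t \<le> 1" and b: "\<And>r. r \<in> {s..t} \<Longrightarrow> P r \<le> b"
  shows "\<bar>P t - P s\<bar> \<le> b * integral {s..t} h"
proof (rule LIMSEQ_le_const2)
  show "(\<lambda>n. \<bar>S n t - S n s\<bar>) \<longlonglongrightarrow> \<bar>P t - P s\<bar>"
    using st by (intro tendsto_intros lim) auto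
  have "\<bar>S n t - S n s\<bar> \<le> b * integral {s..t} h" for n
  proof -
    have "norm (integral {s..t} (g n)) \<le> integral {s..t} (\<lambda>r. b * h r)"
    proof (rule integral_norm_bound_integral)
      show "g n integrable_on {s..t}"
        using st by (intro integrable_continuous_interval continuous_on_subset[OF cont]) auto
      show "(\<lambda>r. b * h r) integrable_on {s..t}" using st by (intro integrable_on_mult_right h_sub)
      show "norm (g n r) \<le> b * h r" if "r \<in> {s..t}" for r
      proof -
        have r: "r \<in> {0..1}" using that st by auto
        have "\<bar>g n r\<bar> \<le> h r * P r" by (rule bound[OF r])
        also have "\<dots> \<le> h r * b" using b[OF that] h(2)[OF r] by (intro mult_left_mono)
        finally show ?thesis by (simp add: mult.commute)
      qed
    qed
    then show ?thesis using ftc[OF st] by simp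
  qed
  then show "\<exists>N. \<forall>n\<ge>N. \<bar>S n t - S n s\<bar> \<le> b * integral {s..t} h" by blast
qed

text \<open>A Gronwall estimate: the oscillation of \<open>P\<close> is at most half of its supremum \<open>m\<close>.\<close>

lemma doubling:
  assumes st: "0 \<le> s" "s \<le> t" "t \<le> 1" and half: "integral {s..t} h \<le> 1 / 2"
    and b: "\<And>r. r \<in> {s..t} \<Longrightarrow> P r \<le> b" and xc: "x \<in> {s..t}" "c \<in> {s..t}"
  shows "P x \<le> 2 * P c"
proof -
  define m where "m = (SUP r\<in>{s..t}. P r)"
  have bdd: "bdd_above (P ` {s..t})" using b by (intro bdd_aboveI2[of _ _ b])
  have m: "P r \<le> m" if "r \<in> {s..t}" for r unfolding m_def by (rule cSUP_upper[OF that bdd])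
  have m0: "0 \<le> m" using P0[of c] m[OF xc(2)] xc st by force
  have "P r \<le> P c + m / 2" if r: "r \<in> {s..t}" for r
  proof -
    have "\<bar>P (max r c) - P (min r c)\<bar> \<le> m * integral {min r c..max r c} h"
      by (rule increment_bounded) (use r xc st m in \<open>auto simp: min_def max_def split: if_splits\<close>)
    also have "\<dots> \<le> m * integral {s..t} h"
      using r xc st by (intro mult_left_mono h_integral_mono m0) auto
    also have "\<dots> \<le> m * (1 / 2)" using half m0 by (intro mult_left_mono) auto
    finally have "\<bar>P (max r c) - P (min r c)\<bar> \<le> m / 2" by simp
    moreover have "max r c = r \<and> min r c = c \<or> max r c = c \<and> min r c = r" by linarith
    ultimately have "\<bar>P r - P c\<bar> \<le> m / 2" by (metis abs_minus_commute)
    then show ?thesis by linarith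
  qed
  then have "m \<le> P c + m / 2" unfolding m_def[symmetric] using st by (subst m_def, intro cSUP_least) auto
  then show ?thesis using m[OF xc(1)] by simp
qed

definition bounded_points :: "real set" where
  "bounded_points = {t\<in>{0..1}. \<exists>e>0. \<exists>b. \<forall>s\<in>{0..1}. \<bar>s - t\<bar> < e \<longrightarrow> P s \<le> b}"

lemma closed_unbounded_points: "closed ({0..1} - bounded_points)"
proof -
  have "openin (top_of_set {0..1}) bounded_points"
    unfolding openin_euclidean_subtopology_iff
  proof (intro conjI ballI)
    show "bounded_points \<subseteq> {0..1}" by (auto simp: bounded_points_def)
    fix t assume "t \<in> bounded_points"
    then obtain e b where e: "e > 0" "t \<in> {0..1}" "\<And>s. s \<in> {0..1} \<Longrightarrow> \<bar>s - t\<bar> < e \<Longrightarrow> P s \<le> b"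
      unfolding bounded_points_def by blast
    have "x \<in> bounded_points" if x: "x \<in> {0..1}" "dist x t < e / 2" for x
      unfolding bounded_points_def
    proof (intro CollectI conjI exI ballI impI)
      show "0 < e / 2" using e by simp
      show "P s \<le> b" if "s \<in> {0..1}" "\<bar>s - x\<bar> < e / 2" for s
      proof (rule e(3)[OF that(1)])
        show "\<bar>s - t\<bar> < e" using x(2) that(2) unfolding dist_real_def by linarith
      qed
    qed (use x in simp)
    then show "\<exists>e>0. \<forall>x'\<in>{0..1}. dist x' t < e \<longrightarrow> x' \<in> bounded_points" using e(1) by (intro exI[of _ "e/2"]) auto
  qed
  then have "closedin (top_of_set {0..1}) ({0..1} - bounded_points)"
    by (metis closedin_diff closedin_topspace topspace_euclidean_subtopology)
  then show ?thesis by (rule closedin_closed_trans) simp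
qed

lemma bounded_on_interval:
  assumes "{s..t} \<subseteq> bounded_points"
  shows "\<exists>b. \<forall>r\<in>{s..t}. P r \<le> b"
proof (rule locally_bounded_compact)
  fix r assume r: "r \<in> {s..t}"
  then obtain e b where "e > 0" "\<And>q. q \<in> {0..1} \<Longrightarrow> \<bar>q - r\<bar> < e \<Longrightarrow> P q \<le> b"
    using assms unfolding bounded_points_def by blast
  moreover have "{s..t} \<subseteq> {0..1}" using assms by (auto simp: bounded_points_def)
  ultimately show "\<exists>e>0. \<exists>b. \<forall>q\<in>{s..t}. \<bar>q - r\<bar> < e \<longrightarrow> P q \<le> b" by blast
qed simp

text \<open>The set \<open>K\<close> of the remaining points is closed, and it is the union of the closed sets where the
  finite function \<open>P\<close> is at most \<open>M\<close>. If \<open>K\<close> were nonempty, Baire's theorem would give a point \<open>t0\<close> of \<open>K\<close> and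
  a neighbourhood of \<open>t0\<close> in which \<open>P\<close> is at most \<open>M\<close> on \<open>K\<close>. The doubling estimate, started at the point of \<open>K\<close>
  nearest to \<open>y\<close>, carries this bound over to the other points \<open>y\<close> near \<open>t0\<close>, so \<open>t0\<close> is not in \<open>K\<close>.\<close>

lemma bounded_points_eq: "bounded_points = {0..1}"
proof (rule ccontr)
  define K where "K = {0..1} - bounded_points"
  assume "bounded_points \<noteq> {0..1}"
  then have K: "K \<noteq> {}" "closed K" "K \<subseteq> {0..1}" using closed_unbounded_points by (auto simp: K_def bounded_points_def)
  define Q where "Q M = {t\<in>K. P t \<le> real M}" for M :: nat
  have Qcl: "closedin (top_of_set K) (Q M)" for M
  proof -
    have "Q M = (\<Inter>n. {t\<in>K. S n t \<le> real M})"
    proof (intro equalityI subsetI)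
      fix t assume "t \<in> (\<Inter>n. {t\<in>K. S n t \<le> real M})"
      then have "t \<in> K" "\<And>n. S n t \<le> real M" by auto
      then show "t \<in> Q M" using LIMSEQ_le_const2[OF lim[of t]] K by (auto simp: Q_def)
    next
      fix t assume t: "t \<in> Q M"
      then have "S n t \<le> real M" for n using incr[of t n] K by (auto simp: Q_def)
      then show "t \<in> (\<Inter>n. {t\<in>K. S n t \<le> real M})" using t by (simp add: Q_def)
    qed
    moreover have "closedin (top_of_set K) {t\<in>K. S n t \<le> real M}" for n
    proof -
      have "closedin (top_of_set K) (K \<inter> S n -` {..real M})"
        by (rule continuous_closedin_preimage) (auto intro: continuous_on_subset[OF S_continuous K(3)])
      moreover have "K \<inter> S n -` {..real M} = {t\<in>K. S n t \<le> real M}" by auto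
      ultimately show ?thesis by simp
    qed
    ultimately show ?thesis by (metis (no_types, lifting) UNIV_not_empty closedin_INT)
  qed
  have "\<exists>M. \<not> K \<subseteq> closure (K - Q M)"
  proof (rule ccontr)
    assume "\<not> (\<exists>M. \<not> K \<subseteq> closure (K - Q M))"
    then have "K \<subseteq> closure (\<Inter>(range (\<lambda>M. K - Q M)))"
    proof (intro Baire[OF K(2)])
      fix T assume "T \<in> range (\<lambda>M. K - Q M)"
      then show "openin (top_of_set K) T \<and> K \<subseteq> closure T"
        using \<open>\<not> (\<exists>M. \<not> K \<subseteq> closure (K - Q M))\<close> Qcl
        by (auto intro: openin_diff)
    qed simp
    moreover have "\<Inter>(range (\<lambda>M. K - Q M)) = {}"
    proof -
      have "\<exists>M. t \<in> Q M" if "t \<in> K" for t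
        using real_arch_simple[of "P t"] that by (auto simp: Q_def)
      then show ?thesis by blast
    qed
    ultimately have "K \<subseteq> closure {}" by (simp only:)
    then show False using K(1) by simp
  qed
  then obtain M t0 where t0: "t0 \<in> K" "t0 \<notin> closure (K - Q M)" by blast
  then obtain e where e: "e > 0" "\<And>t. t \<in> K \<Longrightarrow> \<bar>t - t0\<bar> < e \<Longrightarrow> P t \<le> real M"
    unfolding closure_approachable by (auto simp: Q_def dist_real_def)
  have t01: "t0 \<in> {0..1}" using t0 K by blast
  have "continuous_on {0..1} (\<lambda>t. integral {0..t} h)" by (rule indefinite_integral_continuous_1[OF h(1)])
  then obtain d where d: "d > 0" "\<And>t. t \<in> {0..1} \<Longrightarrow> \<bar>t - t0\<bar> < d \<Longrightarrow> \<bar>integral {0..t} h - integral {0..t0} h\<bar> < 1 / 2"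
    using t01 unfolding continuous_on_iff dist_real_def by (metis half_gt_zero zero_less_one)
  have half: "integral {min t t0..max t t0} h \<le> 1 / 2" if t: "t \<in> {0..1}" "\<bar>t - t0\<bar> < d" for t
  proof -
    have "integral {0..min t t0} h + integral {min t t0..max t t0} h = integral {0..max t t0} h"
      by (rule Henstock_Kurzweil_Integration.integral_combine) (use t t01 h_sub[of 0 "max t t0"] in auto)
    moreover have "max t t0 = t \<and> min t t0 = t0 \<or> max t t0 = t0 \<and> min t t0 = t" by linarith
    moreover note d(2)[OF t]
    ultimately show ?thesis by (elim disjE conjE; simp only:; linarith)
  qed
  have "P y \<le> 2 * real M" if y: "y \<in> {0..1}" "\<bar>y - t0\<bar> < min d e" for y
  proof -
    have "compact (K \<inter> {min y t0..max y t0})" using K by (intro closed_Int_compact) auto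
    moreover have "t0 \<in> K \<inter> {min y t0..max y t0}" using t0 by simp
    ultimately obtain a where a: "a \<in> K \<inter> {min y t0..max y t0}"
      "\<And>t. t \<in> K \<inter> {min y t0..max y t0} \<Longrightarrow> \<bar>a - y\<bar> \<le> \<bar>t - y\<bar>"
    proof -
      assume c: "compact (K \<inter> {min y t0..max y t0})" and t: "t0 \<in> K \<inter> {min y t0..max y t0}"
      have "continuous_on (K \<inter> {min y t0..max y t0}) (\<lambda>t. \<bar>t - y\<bar>)" by (intro continuous_intros)
      from continuous_attains_inf[OF c _ this] t
      obtain a where "a \<in> K \<inter> {min y t0..max y t0}"
        "\<forall>t\<in>K \<inter> {min y t0..max y t0}. \<bar>a - y\<bar> \<le> \<bar>t - y\<bar>" by blast
      then show thesis using that by blast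
    qed
    have Pa: "P a \<le> real M"
    proof (rule e(2))
      show "a \<in> K" using a by blast
      have "min y t0 \<le> a" "a \<le> max y t0" using a(1) by simp_all
      then show "\<bar>a - t0\<bar> < e" using y(2) by linarith
    qed
    have sub: "0 \<le> min a y" "max a y \<le> 1" "min y t0 \<le> min a y" "max a y \<le> max y t0" using a y K by auto
    have ha: "integral {min a y..max a y} h \<le> 1 / 2"
    proof -
      have "integral {min a y..max a y} h \<le> integral {min y t0..max y t0} h"
        using y(1) t01 by (intro h_integral_mono sub) auto
      then show ?thesis using half[of y] y by simp
    qed
    have bd: "P x \<le> max (2 * P y) (real M)" if x: "x \<in> {min a y..max a y}" for x
    proof (cases "x = a")
      case False
      have "{min x y..max x y} \<subseteq> bounded_points"
      proof
        fix t assume t: "t \<in> {min x y..max x y}"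
        then have "\<bar>t - y\<bar> < \<bar>a - y\<bar>" using x False unfolding atLeastAtMost_iff by linarith
        moreover have "t \<in> {min y t0..max y t0}" using t x sub unfolding atLeastAtMost_iff by linarith
        ultimately have "t \<notin> K" using a(2)[of t] by force
        moreover have "t \<in> {0..1}" using t x sub unfolding atLeastAtMost_iff by linarith
        ultimately show "t \<in> bounded_points" by (simp add: K_def)
      qed
      from bounded_on_interval[OF this] obtain b where b: "\<And>r. r \<in> {min x y..max x y} \<Longrightarrow> P r \<le> b" by blast
      have "integral {min x y..max x y} h \<le> integral {min a y..max a y} h"
        using x by (intro h_integral_mono sub) auto
      then have hx: "integral {min x y..max x y} h \<le> 1 / 2" using ha by simp
      have "P x \<le> 2 * P y"
        by (rule doubling[OF _ _ _ hx b]) (use x sub in auto)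
      then show ?thesis by simp
    qed (use Pa in simp)
    have "P y \<le> 2 * P a" by (rule doubling[OF _ _ _ ha bd]) (use sub in auto)
    then show ?thesis using Pa by simp
  qed
  then have "t0 \<in> bounded_points" unfolding bounded_points_def using t01 d(1) e(1)
    by (intro CollectI conjI exI[of _ "min d e"] exI[of _ "2 * real M"]) auto
  then show False using t0 by (simp add: K_def)
qed

lemma limit_ftc:
  assumes glim: "\<And>t. t \<in> {0..1} \<Longrightarrow> (\<lambda>n. g n t) \<longlonglongrightarrow> k t"
  shows "P 1 - P 0 = integral {0..1} k"
proof -
  obtain b where b: "\<And>t. t \<in> {0..1} \<Longrightarrow> P t \<le> b" using bounded_on_interval[of 0 1] bounded_points_eq by blast
  have "(\<lambda>n. integral {0..1} (g n)) \<longlonglongrightarrow> integral {0..1} k"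
  proof (rule dominated_convergence(2)[where h="\<lambda>t. h t * b"])
    show "g n integrable_on {0..1}" for n by (intro integrable_continuous_interval cont)
    show "(\<lambda>t. h t * b) integrable_on {0..1}" by (intro integrable_on_mult_left h)
    show "norm (g n t) \<le> h t * b" if "t \<in> {0..1}" for n t
      using bound[OF that, of n] mult_left_mono[OF b[OF that] h(2)[OF that]] by simp
  qed (rule glim)
  moreover have "(\<lambda>n. integral {0..1} (g n)) = (\<lambda>n. S n 1 - S n 0)" using ftc[of 0 1] by simp
  moreover have "(\<lambda>n. S n 1 - S n 0) \<longlonglongrightarrow> P 1 - P 0" by (intro tendsto_intros lim) auto
  ultimately show ?thesis using LIMSEQ_unique by metis
qed

end


section \<open>The density of the convolution\<close>

lemma AE_eq_continuous_imp_eq: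
  fixes f g :: "'a::euclidean_space \<Rightarrow> real"
  assumes f: "continuous_on UNIV f" and g: "continuous_on UNIV g" and ae: "AE x in lborel. f x = g x"
  shows "f = g"
proof -
  have o: "open {x. f x \<noteq> g x}" using f g by (rule open_Collect_neq)
  have "{x. f x \<noteq> g x} \<in> null_sets lborel"     using ae o AE_iff_null[of lborel "\<lambda>x. f x = g x"] by auto
  then have "negligible {x. f x \<noteq> g x}" by (simp add: negligible_iff_null_sets null_sets_completionI)
  then show ?thesis using open_not_negligible[OF o] by auto
qed

lemma AE_lborel_ex:
  assumes "AE x in (lborel :: 'a::euclidean_space measure). Q x"
  shows "\<exists>x. Q x"
proof (rule ccontr)
  assume "\<not> (\<exists>x. Q x)"
  then have "AE x in (lborel :: 'a measure). False" using assms by simp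
  then have "ae_filter (lborel :: 'a measure) = bot" by (simp add: trivial_limit_def)
  then show False by (simp add: ae_filter_eq_bot_iff emeasure_lborel_UNIV)
qed

lemma nn_integral_interval_integrable:
  fixes h :: "real \<Rightarrow> real"
  assumes [measurable]: "h \<in> borel_measurable borel" and h: "\<And>t. 0 \<le> h t"
    and fin: "(\<integral>\<^sup>+t\<in>{a..b}. ennreal (h t) \<partial>lborel) < \<infinity>"
  shows "h integrable_on {a..b}"
proof -
  have "(\<integral>\<^sup>+t. ennreal (indicator {a..b} t *\<^sub>R h t) \<partial>lborel) = (\<integral>\<^sup>+t\<in>{a..b}. ennreal (h t) \<partial>lborel)"
    by (intro nn_integral_cong) (auto simp: indicator_def)
  then have "set_integrable lborel {a..b} h"
    unfolding set_integrable_def using fin h by (intro integrableI_nonneg) auto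
  then show ?thesis by (rule set_borel_integral_eq_integral(1))
qed

text \<open>Convolution with the restriction of a probability measure to a ball preserves continuity,
  because only a compact set of arguments matters locally.\<close>

lemma continuous_truncated_convolution:
  fixes F :: "'a::euclidean_space \<Rightarrow> 'b::{banach, second_countable_topology}"
  assumes \<nu>: "finite_measure \<nu>" "sets \<nu> = sets borel" and F: "continuous_on UNIV F"
  shows "continuous_on UNIV (\<lambda>x. \<integral>z. indicator (cball 0 r) z *\<^sub>R F (x - z) \<partial>\<nu>)"
proof -
  interpret finite_measure \<nu> by fact
  note [measurable_cong] = \<nu>(2)
  have [measurable]: "F \<in> borel_measurable borel" by (rule borel_measurable_continuous_onI[OF F])
  have [measurable]: "cball (0::'a) r \<in> sets borel" by simp
  have "isCont (\<lambda>x. \<integral>z. indicator (cball 0 r) z *\<^sub>R F (x - z) \<partial>\<nu>) x" for x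
    unfolding continuous_at_sequentially o_def
  proof (intro allI impI)
    fix X :: "nat \<Rightarrow> 'a" assume X: "X \<longlonglongrightarrow> x"
    then have "bounded (range X)" by (rule convergent_imp_bounded)
    then obtain a where a: "\<And>n. norm (X n) \<le> a" unfolding bounded_iff by auto
    obtain b where b: "\<And>y. norm y \<le> a + r \<Longrightarrow> norm (F y) \<le> b"
      using continuous_bounded_cball[OF F] by blast
    show "(\<lambda>n. \<integral>z. indicator (cball 0 r) z *\<^sub>R F (X n - z) \<partial>\<nu>) \<longlonglongrightarrow> (\<integral>z. indicator (cball 0 r) z *\<^sub>R F (x - z) \<partial>\<nu>)"
    proof (rule integral_dominated_convergence[where w="\<lambda>_. \<bar>b\<bar>"])
      have "(\<lambda>n. F (X n - z)) \<longlonglongrightarrow> F (x - z)" for z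
        using F X by (intro isCont_tendsto_compose[where g=F] tendsto_intros) (auto simp: continuous_on_eq_continuous_at)
      then show "AE z in \<nu>. (\<lambda>n. indicator (cball 0 r) z *\<^sub>R F (X n - z)) \<longlonglongrightarrow> indicator (cball 0 r) z *\<^sub>R F (x - z)"
        by (intro AE_I2 tendsto_intros)
      show "AE z in \<nu>. norm (indicator (cball 0 r) z *\<^sub>R F (X n - z)) \<le> \<bar>b\<bar>" for n
      proof (rule AE_I2)
        fix z
        have "norm (F (X n - z)) \<le> b" if "norm z \<le> r"
          using norm_triangle_ineq4[of "X n" z] a[of n] that by (intro b) linarith
        then show "norm (indicator (cball 0 r) z *\<^sub>R F (X n - z)) \<le> \<bar>b\<bar>"
          by (auto simp: indicator_def)
      qed
    qed (auto simp del: scaleR_conv_of_real)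
  qed
  then show ?thesis by (simp add: continuous_at_imp_continuous_on)
qed

locale gibbs_convolution =
  fixes V :: "'a::euclidean_space \<Rightarrow> real" and \<nu> :: "'a measure"
  assumes V: "V \<in> C1"
    and nu: "prob_space \<nu>" "sets \<nu> = sets borel"
    and p_finite: "\<And>x. integrable \<nu> (\<lambda>z. exp (- V (x - z)))"
    and Phi_defined: "\<And>x. integrable \<nu> (\<lambda>z. grad (\<lambda>y. exp (- V y)) (x - z))"
    and Phi_cont: "continuous_on UNIV (Phi V \<nu>)"
begin

sublocale nu: prob_space \<nu> by (rule nu)

declare nu(2) [measurable_cong]

abbreviation u where "u \<equiv> \<lambda>x. exp (- V x)"
abbreviation p where "p \<equiv> p_conv V \<nu>"

text \<open>The drift is the quantity whose square is exponentially integrable in the main theorem. The rate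
  compares the gradients of the truncated densities below with \<open>p\<close>.\<close>

definition drift :: "'a \<Rightarrow> real" where
  "drift x = (\<integral>z. norm (grad V x - grad V (x - z)) \<partial>nu_at V \<nu> x)"

definition rate :: "'a \<Rightarrow> real" where
  "rate x = drift x + norm (grad V x)"

lemma V_measurable [measurable]: "V \<in> borel_measurable borel" "grad V \<in> borel_measurable borel"
  by (rule C1_D[OF V])+

lemma u_C1: "u \<in> C1" "grad u = (\<lambda>x. - u x *\<^sub>R grad V x)"
proof -
  have d: "DERIV (\<lambda>s. exp (- s)) (V x) :> - exp (- V x)" for x by (auto intro!: derivative_eq_intros)
  have c: "continuous_on (range V) (\<lambda>s. - exp (- s))" by (intro continuous_intros)
  show "u \<in> C1" "grad u = (\<lambda>x. - u x *\<^sub>R grad V x)"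
    using C1_compose[where f=V and g="\<lambda>s. exp (- s)" and g'="\<lambda>s. - exp (- s)", OF V d c] by blast+
qed

lemma grad_u_measurable [measurable]: "grad u \<in> borel_measurable borel"
  by (rule C1_D[OF u_C1(1)])

lemma p_pos: "p x > 0"
proof -
  have "p x \<noteq> 0" unfolding p_conv_def
    by (subst integral_nonneg_eq_0_iff_AE[OF p_finite]) (auto simp: nu.AE_False)
  moreover have "p x \<ge> 0" unfolding p_conv_def by (intro integral_nonneg_AE) auto
  ultimately show ?thesis by simp
qed

lemma p_measurable [measurable]: "p \<in> borel_measurable borel"
  unfolding p_conv_def[abs_def] by measurable

lemma drift_integrable: "integrable \<nu> (\<lambda>z. u (x - z) * norm (grad V x - grad V (x - z)))"
proof (rule Bochner_Integration.integrable_bound)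
  show "integrable \<nu> (\<lambda>z. u (x - z) * norm (grad V x) + norm (grad u (x - z)))"
    by (intro Bochner_Integration.integrable_add integrable_mult_left integrable_norm p_finite Phi_defined)
  have "u (x - z) * norm (grad V x - grad V (x - z)) \<le> u (x - z) * norm (grad V x) + norm (grad u (x - z))" for z
  proof -
    have "u (x - z) * norm (grad V x - grad V (x - z)) \<le> u (x - z) * (norm (grad V x) + norm (grad V (x - z)))"
      by (intro mult_left_mono norm_triangle_ineq4) auto
    then show ?thesis by (simp add: u_C1 distrib_left)
  qed
  then show "AE z in \<nu>. norm (u (x - z) * norm (grad V x - grad V (x - z)))
      \<le> norm (u (x - z) * norm (grad V x) + norm (grad u (x - z)))"
    by (intro AE_I2) (simp add: abs_of_nonneg add_nonneg_nonneg)
qed measurable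

lemma drift_eq: "drift x * p x = (\<integral>z. u (x - z) * norm (grad V x - grad V (x - z)) \<partial>\<nu>)"
proof -
  have "drift x = (\<integral>z. (1 / p x * u (x - z)) *\<^sub>R norm (grad V x - grad V (x - z)) \<partial>\<nu>)"
    unfolding drift_def nu_at_def using p_pos[of x] by (intro integral_density) (auto simp: less_imp_le)
  also have "\<dots> = (\<integral>z. 1 / p x * (u (x - z) * norm (grad V x - grad V (x - z))) \<partial>\<nu>)"
    by (simp only: real_scaleR_def mult.assoc)
  also have "\<dots> = 1 / p x * (\<integral>z. u (x - z) * norm (grad V x - grad V (x - z)) \<partial>\<nu>)"
    by (rule integral_mult_right_zero)
  finally show ?thesis using p_pos[of x] by simp
qed

lemma drift_nonneg: "drift x \<ge> 0" unfolding drift_def by simp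

lemma rate_nonneg: "rate x \<ge> 0" unfolding rate_def using drift_nonneg by simp

lemma drift_measurable [measurable]: "drift \<in> borel_measurable borel"
proof -
  have "drift = (\<lambda>x. (\<integral>z. u (x - z) * norm (grad V x - grad V (x - z)) \<partial>\<nu>) / p x)"
    using drift_eq p_pos by (auto simp: fun_eq_iff eq_divide_eq less_imp_neq[THEN not_sym])
  then show ?thesis by (simp only:) measurable
qed

lemma rate_measurable [measurable]: "rate \<in> borel_measurable borel"
  unfolding rate_def[abs_def] by measurable

text \<open>Where \<open>p\<close> has the gradient \<open>Phi V \<nu>\<close>, the vector on the left divided by \<open>p x\<close> is the gradient of
  \<open>V + ln p\<close>, the logarithm of the density of the convolution with respect to \<open>gibbs V\<close>.\<close>

lemma norm_Phi_le: "norm (Phi V \<nu> x + p x *\<^sub>R grad V x) \<le> drift x * p x"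
proof -
  have "Phi V \<nu> x + p x *\<^sub>R grad V x = (\<integral>z. grad u (x - z) + u (x - z) *\<^sub>R grad V x \<partial>\<nu>)"
    unfolding Phi_def p_conv_def
    by (subst Bochner_Integration.integral_add[OF Phi_defined])
      (auto intro!: integrable_scaleR_left p_finite simp: integral_scaleR_left[OF p_finite])
  also have "norm \<dots> \<le> (\<integral>z. norm (grad u (x - z) + u (x - z) *\<^sub>R grad V x) \<partial>\<nu>)"
    by (rule integral_norm_bound)
  also have "(\<lambda>z. norm (grad u (x - z) + u (x - z) *\<^sub>R grad V x)) = (\<lambda>z. u (x - z) * norm (grad V x - grad V (x - z)))"
  proof
    fix z
    have "grad u (x - z) + u (x - z) *\<^sub>R grad V x = u (x - z) *\<^sub>R (grad V x - grad V (x - z))"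
      by (simp add: u_C1 algebra_simps)
    then show "norm (grad u (x - z) + u (x - z) *\<^sub>R grad V x) = u (x - z) * norm (grad V x - grad V (x - z))"
      by simp
  qed
  finally show ?thesis by (simp add: drift_eq)
qed

text \<open>The gradient of \<open>u\<close> is not dominated uniformly in \<open>x\<close>, so \<open>p\<close> cannot be differentiated under the
  integral directly. Restricting the integral to a ball makes this possible.\<close>

definition p_trunc :: "nat \<Rightarrow> 'a \<Rightarrow> real" where
  "p_trunc n x = (\<integral>z. indicator (cball 0 (real n)) z *\<^sub>R u (x - z) \<partial>\<nu>)"

definition Phi_trunc :: "nat \<Rightarrow> 'a \<Rightarrow> 'a" where
  "Phi_trunc n x = (\<integral>z. indicator (cball 0 (real n)) z *\<^sub>R grad u (x - z) \<partial>\<nu>)"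

lemma cball_sets [measurable]: "cball (0::'a) r \<in> sets borel" by simp

lemma trunc_continuous: "continuous_on UNIV (p_trunc n)" "continuous_on UNIV (Phi_trunc n)"
  unfolding p_trunc_def[abs_def] Phi_trunc_def[abs_def]
  by (intro continuous_truncated_convolution nu.finite_measure_axioms nu(2) C1_D[OF u_C1(1)])+

lemma trunc_limit:
  fixes F :: "'a \<Rightarrow> 'b::{banach, second_countable_topology}"
  assumes F: "integrable \<nu> F"
  shows "(\<lambda>n. \<integral>z. indicator (cball 0 (real n)) z *\<^sub>R F z \<partial>\<nu>) \<longlonglongrightarrow> (\<integral>z. F z \<partial>\<nu>)"
proof (rule integral_dominated_convergence[where w="\<lambda>z. norm (F z)"])
  show "AE z in \<nu>. (\<lambda>n. indicator (cball 0 (real n)) z *\<^sub>R F z) \<longlonglongrightarrow> F z"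
  proof (intro AE_I2 tendsto_eventually)
    fix z :: 'a
    obtain N :: nat where "norm z \<le> real N" using real_arch_simple by blast
    then show "\<forall>\<^sub>F n in sequentially. indicator (cball 0 (real n)) z *\<^sub>R F z = F z"
      by (intro eventually_sequentiallyI[of N]) auto
  qed
  have [measurable]: "F \<in> borel_measurable \<nu>" using F by auto
  show "(\<lambda>z. indicator (cball 0 (real n)) z *\<^sub>R F z) \<in> borel_measurable \<nu>" for n by measurable
qed (use F in \<open>auto simp: indicator_def\<close>)

lemma p_trunc_limit: "(\<lambda>n. p_trunc n x) \<longlonglongrightarrow> p x"
  unfolding p_trunc_def p_conv_def by (rule trunc_limit[OF p_finite])

lemma Phi_trunc_limit: "(\<lambda>n. Phi_trunc n x) \<longlonglongrightarrow> Phi V \<nu> x"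
  unfolding Phi_trunc_def Phi_def by (rule trunc_limit[OF Phi_defined])

lemma trunc_integrable:
  fixes F :: "'a \<Rightarrow> 'b::{banach, second_countable_topology}"
  assumes F: "integrable \<nu> F"
  shows "integrable \<nu> (\<lambda>z. indicator (cball 0 r) z *\<^sub>R F z)"
  by (rule integrable_mult_indicator[OF _ F]) (simp add: nu(2))

lemma p_trunc_le: "p_trunc n x \<le> p x"
  unfolding p_trunc_def p_conv_def
  by (intro integral_mono trunc_integrable p_finite) (auto simp: indicator_def)

text \<open>The bound is by the full density \<open>p\<close> and not by \<open>p_trunc\<close>, because the drift involves all of \<open>\<nu>\<close>.
  This is why \<open>increasing_primitives\<close> is needed to pass to the limit.\<close>

lemma norm_Phi_trunc_le: "norm (Phi_trunc n x) \<le> rate x * p x"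
proof -
  have "norm (Phi_trunc n x) \<le> (\<integral>z. norm (indicator (cball 0 (real n)) z *\<^sub>R grad u (x - z)) \<partial>\<nu>)"
    unfolding Phi_trunc_def by (rule integral_norm_bound)
  also have "\<dots> \<le> (\<integral>z. u (x - z) * norm (grad V x - grad V (x - z)) + u (x - z) * norm (grad V x) \<partial>\<nu>)"
  proof (rule integral_mono)
    show "integrable \<nu> (\<lambda>z. norm (indicator (cball 0 (real n)) z *\<^sub>R grad u (x - z)))"
      by (intro integrable_norm trunc_integrable Phi_defined)
    show "integrable \<nu> (\<lambda>z. u (x - z) * norm (grad V x - grad V (x - z)) + u (x - z) * norm (grad V x))"
      by (intro Bochner_Integration.integrable_add integrable_mult_left p_finite drift_integrable)
    fix z
    have "norm (indicator (cball 0 (real n)) z *\<^sub>R grad u (x - z)) \<le> norm (grad u (x - z))"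
      by (auto simp: indicator_def)
    also have "\<dots> = u (x - z) * norm (grad V (x - z))" by (simp add: u_C1)
    also have "\<dots> \<le> u (x - z) * (norm (grad V x - grad V (x - z)) + norm (grad V x))"
      using norm_triangle_sub[of "grad V (x - z)" "grad V x"]
      by (intro mult_left_mono) (auto simp: norm_minus_commute add.commute)
    finally show "norm (indicator (cball 0 (real n)) z *\<^sub>R grad u (x - z))
      \<le> u (x - z) * norm (grad V x - grad V (x - z)) + u (x - z) * norm (grad V x)"
      by (simp add: distrib_left)
  qed
  also have "\<dots> = drift x * p x + p x * norm (grad V x)"
    by (subst Bochner_Integration.integral_add)
      (auto intro!: integrable_mult_left p_finite drift_integrable simp: drift_eq, simp add: p_conv_def)
  also have "\<dots> = rate x * p x" by (simp add: rate_def algebra_simps)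
  finally show ?thesis .
qed

lemma p_trunc_increment:
  assumes st: "s \<le> t"
  shows "p_trunc n (x + t *\<^sub>R w) - p_trunc n (x + s *\<^sub>R w) = integral {s..t} (\<lambda>r. w \<bullet> Phi_trunc n (x + r *\<^sub>R w))"
proof -
  interpret pair_sigma_finite \<nu> "lborel :: real measure" ..
  let ?B = "cball (0::'a) (real n)"
  define f where "f z r = indicator ?B z * (indicator {s..t} r * (w \<bullet> grad u (x + r *\<^sub>R w - z)))" for z r
  have [measurable]: "case_prod f \<in> borel_measurable (\<nu> \<Otimes>\<^sub>M lborel)"
    unfolding f_def by measurable
  have cg: "continuous_on UNIV (grad u)" by (rule C1_D[OF u_C1(1)])
  have "compact ((\<lambda>(r, z). w \<bullet> grad u (x + r *\<^sub>R w - z)) ` ({s..t} \<times> ?B))"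
    by (intro compact_continuous_image compact_Times)
      (auto simp: split_beta intro!: continuous_intros continuous_on_compose2[OF cg])
  then obtain b where b: "\<And>r z. r \<in> {s..t} \<Longrightarrow> z \<in> ?B \<Longrightarrow> \<bar>w \<bullet> grad u (x + r *\<^sub>R w - z)\<bar> \<le> b"
    unfolding compact_eq_bounded_closed bounded_iff by fastforce
  have int: "integrable (\<nu> \<Otimes>\<^sub>M lborel) (case_prod f)"
  proof (rule integrableI_bounded_set[where A="?B \<times> {s..t}" and B=b])
    show "?B \<times> {s..t} \<in> sets (\<nu> \<Otimes>\<^sub>M lborel)" by (intro pair_measureI) (auto simp: nu(2))
    have "emeasure (\<nu> \<Otimes>\<^sub>M lborel) (?B \<times> {s..t}) = emeasure \<nu> ?B * emeasure lborel {s..t}"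
      by (intro lborel.emeasure_pair_measure_Times) (auto simp: nu(2))
    also have "\<dots> < \<infinity>" using st by (simp add: nu.emeasure_eq_measure ennreal_mult_less_top)
    finally show "emeasure (\<nu> \<Otimes>\<^sub>M lborel) (?B \<times> {s..t}) < \<infinity>" .
    show "AE x in \<nu> \<Otimes>\<^sub>M lborel. x \<in> ?B \<times> {s..t} \<longrightarrow> norm (case_prod f x) \<le> b"
      using b by (intro AE_I2) (auto simp: f_def)
    show "AE x in \<nu> \<Otimes>\<^sub>M lborel. x \<notin> ?B \<times> {s..t} \<longrightarrow> case_prod f x = 0"
      by (intro AE_I2) (auto simp: f_def indicator_def)
  qed measurable
  have cont: "continuous_on {s..t} (\<lambda>r. w \<bullet> Phi_trunc n (x + r *\<^sub>R w))"
    by (intro continuous_intros continuous_on_compose2[OF trunc_continuous(2)]) auto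
  have inner: "(\<integral>r. f z r \<partial>lborel) = indicator ?B z *\<^sub>R u (x + t *\<^sub>R w - z) - indicator ?B z *\<^sub>R u (x + s *\<^sub>R w - z)" for z
  proof -
    have c: "continuous_on {s..t} (\<lambda>r. w \<bullet> grad u (x + r *\<^sub>R w - z))"
      by (intro continuous_intros continuous_on_compose2[OF cg]) auto
    have "(\<integral>r. f z r \<partial>lborel) = indicator ?B z * (LINT r:{s..t}|lborel. w \<bullet> grad u (x + r *\<^sub>R w - z))"
      unfolding f_def set_lebesgue_integral_def by simp
    also have "(LINT r:{s..t}|lborel. w \<bullet> grad u (x + r *\<^sub>R w - z)) = integral {s..t} (\<lambda>r. w \<bullet> grad u (x + r *\<^sub>R w - z))"
      by (rule set_borel_integral_eq_integral(2)[OF borel_integrable_atLeastAtMost'[OF c]])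
    also have "\<dots> = u (x + t *\<^sub>R w - z) - u (x + s *\<^sub>R w - z)"
      using C1_increment[OF u_C1(1) st, of w "x - z"] by (simp add: integral_unique algebra_simps)
    finally show ?thesis by (simp add: right_diff_distrib)
  qed
  have outer: "(\<integral>z. f z r \<partial>\<nu>) = indicator {s..t} r *\<^sub>R (w \<bullet> Phi_trunc n (x + r *\<^sub>R w))" for r
  proof -
    have "(\<integral>z. f z r \<partial>\<nu>) = (\<integral>z. indicator {s..t} r * (w \<bullet> (indicator ?B z *\<^sub>R grad u (x + r *\<^sub>R w - z))) \<partial>\<nu>)"
      unfolding f_def by (intro Bochner_Integration.integral_cong) auto
    also have "\<dots> = indicator {s..t} r * (w \<bullet> Phi_trunc n (x + r *\<^sub>R w))"
      unfolding Phi_trunc_def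
      by (subst integral_mult_right_zero, subst integral_inner_right[OF trunc_integrable[OF Phi_defined]]) simp
    finally show ?thesis by simp
  qed
  have "p_trunc n (x + t *\<^sub>R w) - p_trunc n (x + s *\<^sub>R w) = (\<integral>z. (\<integral>r. f z r \<partial>lborel) \<partial>\<nu>)"
    unfolding inner p_trunc_def
    by (rule Bochner_Integration.integral_diff[symmetric]) (intro trunc_integrable p_finite)+
  also have "\<dots> = (\<integral>r. (\<integral>z. f z r \<partial>\<nu>) \<partial>lborel)" by (rule Fubini_integral[OF int, symmetric])
  also have "\<dots> = (LINT r:{s..t}|lborel. w \<bullet> Phi_trunc n (x + r *\<^sub>R w))"
    unfolding outer set_lebesgue_integral_def ..
  also have "\<dots> = integral {s..t} (\<lambda>r. w \<bullet> Phi_trunc n (x + r *\<^sub>R w))"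
    by (rule set_borel_integral_eq_integral(2)[OF borel_integrable_atLeastAtMost'[OF cont]])
  finally show ?thesis .
qed

text \<open>The increment from \<open>x\<close> to \<open>y\<close> of a function with gradient \<open>Phi V \<nu>\<close>.\<close>

definition slope :: "'a \<Rightarrow> 'a \<Rightarrow> real" where
  "slope x y = integral {0..1} (\<lambda>t. (y - x) \<bullet> Phi V \<nu> (x + t *\<^sub>R (y - x)))"

lemma p_increment:
  assumes fin: "(\<integral>\<^sup>+t\<in>{0..1}. ennreal (rate (x + t *\<^sub>R (y - x))) \<partial>lborel) < \<infinity>"
  shows "p y - p x = slope x y"
proof -
  define w where "w = y - x"
  interpret I: increasing_primitives "\<lambda>n t. p_trunc n (x + t *\<^sub>R w)" "\<lambda>n t. w \<bullet> Phi_trunc n (x + t *\<^sub>R w)"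
    "\<lambda>t. p (x + t *\<^sub>R w)" "\<lambda>t. norm w * rate (x + t *\<^sub>R w)"
  proof
    show "continuous_on {0..1} (\<lambda>t. w \<bullet> Phi_trunc n (x + t *\<^sub>R w))" for n
      by (intro continuous_intros continuous_on_compose2[OF trunc_continuous(2)]) auto
    show "\<bar>w \<bullet> Phi_trunc n (x + t *\<^sub>R w)\<bar> \<le> norm w * rate (x + t *\<^sub>R w) * p (x + t *\<^sub>R w)" for n t
    proof -
      have "\<bar>w \<bullet> Phi_trunc n (x + t *\<^sub>R w)\<bar> \<le> norm w * norm (Phi_trunc n (x + t *\<^sub>R w))" by (rule Cauchy_Schwarz_ineq2)
      also have "\<dots> \<le> norm w * (rate (x + t *\<^sub>R w) * p (x + t *\<^sub>R w))" by (intro mult_left_mono norm_Phi_trunc_le) auto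
      finally show ?thesis by (simp add: mult.assoc)
    qed
    have "(\<lambda>t. rate (x + t *\<^sub>R w)) integrable_on {0..1}"
      using fin by (intro nn_integral_interval_integrable rate_nonneg) (simp_all add: w_def)
    then show "(\<lambda>t. norm w * rate (x + t *\<^sub>R w)) integrable_on {0..1}" by (rule integrable_on_mult_right)
  qed (auto intro!: p_trunc_le p_trunc_limit p_trunc_increment rate_nonneg less_imp_le[OF p_pos] mult_nonneg_nonneg)
  have "p (x + 1 *\<^sub>R w) - p (x + 0 *\<^sub>R w) = integral {0..1} (\<lambda>t. w \<bullet> Phi V \<nu> (x + t *\<^sub>R w))"
    by (rule I.limit_ftc) (intro tendsto_intros Phi_trunc_limit)
  then show ?thesis by (simp add: slope_def w_def)
qed

lemma slope_continuous: "continuous_on UNIV (slope x)" "continuous_on UNIV (\<lambda>x. slope x y)"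
proof -
  have "continuous_on UNIV (\<lambda>y. integral (cbox 0 (1::real)) (\<lambda>t. (y - x) \<bullet> Phi V \<nu> (x + t *\<^sub>R (y - x))))"
    by (rule integral_continuous_on_param)
      (auto simp: split_beta intro!: continuous_intros continuous_on_compose2[OF Phi_cont])
  then show "continuous_on UNIV (slope x)" by (simp add: slope_def[abs_def])
  have "continuous_on UNIV (\<lambda>x. integral (cbox 0 (1::real)) (\<lambda>t. (y - x) \<bullet> Phi V \<nu> (x + t *\<^sub>R (y - x))))"
    by (rule integral_continuous_on_param)
      (auto simp: split_beta intro!: continuous_intros continuous_on_compose2[OF Phi_cont])
  then show "continuous_on UNIV (\<lambda>x. slope x y)" by (simp add: slope_def[abs_def])
qed

lemma AE_segment_finite:
  assumes loc: "\<And>n::nat. (\<integral>\<^sup>+x\<in>ball 0 (real n). ennreal (rate x) \<partial>lborel) < \<infinity>"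
  shows "AE x in lborel. AE y in lborel. (\<integral>\<^sup>+t\<in>{0..1}. ennreal (rate (x + t *\<^sub>R (y - x))) \<partial>lborel) < \<infinity>"
proof -
  define I where "I x y = (\<integral>\<^sup>+t\<in>{0..1::real}. ennreal (rate (x + t *\<^sub>R (y - x))) \<partial>lborel)" for x y
  have [measurable]: "ball (0::'a) r \<in> sets borel" for r by simp
  have [measurable (raw)]: "(\<lambda>w. I (f w) (g w)) \<in> borel_measurable N"
    if [measurable]: "f \<in> borel_measurable N" "g \<in> borel_measurable N" for f g and N :: "'b measure"
    unfolding I_def by measurable
  have ball: "AE x in lborel. AE y in lborel. x \<in> ball 0 (real n) \<longrightarrow> y \<in> ball 0 (real n) \<longrightarrow> I x y < \<infinity>" for n :: nat
  proof -
    let ?B = "ball (0::'a) (real n)"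
    have "(\<integral>\<^sup>+x\<in>?B. (\<integral>\<^sup>+y\<in>?B. I x y \<partial>lborel) \<partial>lborel)
        \<le> 2 ^ DIM('a) * emeasure lborel ?B * (\<integral>\<^sup>+y\<in>?B. ennreal (rate y) \<partial>lborel)"
      unfolding I_def by (rule nn_integral_segment_le) auto
    also have "\<dots> < \<infinity>"
      using loc[of n] emeasure_bounded_finite[OF bounded_ball[of "0::'a" "real n"]]
      by (simp add: ennreal_mult_less_top power_less_top_ennreal)
    finally have "AE x in lborel. (\<integral>\<^sup>+y\<in>?B. I x y \<partial>lborel) * indicator ?B x \<noteq> \<infinity>"
      by (intro nn_integral_noteq_infinite) auto
    then show ?thesis
    proof eventually_elim
      fix x :: 'a assume x: "(\<integral>\<^sup>+y\<in>?B. I x y \<partial>lborel) * indicator ?B x \<noteq> \<infinity>"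
      show "AE y in lborel. x \<in> ?B \<longrightarrow> y \<in> ?B \<longrightarrow> I x y < \<infinity>"
      proof (cases "x \<in> ?B")
        case True
        then have "AE y in lborel. I x y * indicator ?B y \<noteq> \<infinity>"
          using x by (intro nn_integral_noteq_infinite) auto
        then show ?thesis by (rule AE_mp) (auto simp: less_top)
      qed simp
    qed
  qed
  have "AE x in lborel. \<forall>n::nat. AE y in lborel. x \<in> ball 0 (real n) \<longrightarrow> y \<in> ball 0 (real n) \<longrightarrow> I x y < \<infinity>"
    unfolding AE_all_countable by (intro allI ball)
  then have "AE x in lborel. AE y in lborel. I x y < \<infinity>"
  proof eventually_elim
    fix x :: 'a
    assume "\<forall>n::nat. AE y in lborel. x \<in> ball 0 (real n) \<longrightarrow> y \<in> ball 0 (real n) \<longrightarrow> I x y < \<infinity>"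
    then have "AE y in lborel. \<forall>n::nat. x \<in> ball 0 (real n) \<longrightarrow> y \<in> ball 0 (real n) \<longrightarrow> I x y < \<infinity>"
      unfolding AE_all_countable .
    then show "AE y in lborel. I x y < \<infinity>"
    proof eventually_elim
      fix y :: 'a assume *: "\<forall>n::nat. x \<in> ball 0 (real n) \<longrightarrow> y \<in> ball 0 (real n) \<longrightarrow> I x y < \<infinity>"
      obtain n :: nat where "max (norm x) (norm y) < real n" using reals_Archimedean2 by blast
      then show "I x y < \<infinity>" using *[rule_format, of n] by simp
    qed
  qed
  then show ?thesis by (simp add: I_def)
qed

text \<open>The increments of \<open>p\<close> are those prescribed by \<open>Phi V \<nu>\<close> along almost every segment. Integrating
  \<open>Phi V \<nu>\<close> from a fixed good base point \<open>x0\<close> gives a continuous \<open>q\<close> equal to \<open>p\<close> almost everywhere. By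
  continuity its increments are the prescribed ones for every pair of points, which makes \<open>q\<close> continuously
  differentiable. It is positive because it lies above the continuous functions \<open>p_trunc n\<close>, hence above \<open>p\<close>.\<close>

lemma C1_density:
  assumes loc: "\<And>n::nat. (\<integral>\<^sup>+x\<in>ball 0 (real n). ennreal (rate x) \<partial>lborel) < \<infinity>"
  obtains q where "q \<in> C1" "grad q = Phi V \<nu>" "\<And>x. q x > 0" "AE x in lborel. p x = q x"
proof -
  have ae: "AE x in lborel. AE y in lborel. p y - p x = slope x y"
    using AE_segment_finite[OF loc]
  proof eventually_elim
    fix x assume "AE y in lborel. (\<integral>\<^sup>+t\<in>{0..1}. ennreal (rate (x + t *\<^sub>R (y - x))) \<partial>lborel) < \<infinity>"
    then show "AE y in lborel. p y - p x = slope x y" by eventually_elim (rule p_increment)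
  qed
  then obtain x0 where x0: "AE y in lborel. p y - p x0 = slope x0 y"
    using AE_lborel_ex by blast
  define q where "q y = p x0 + slope x0 y" for y
  have pq: "AE y in lborel. p y = q y" using x0 by (rule AE_mp) (auto simp: q_def)
  have cq: "continuous_on UNIV q" unfolding q_def[abs_def] by (intro continuous_intros slope_continuous)
  have inc1: "AE x in lborel. \<forall>y. q y - q x = slope x y"
    using ae pq
  proof eventually_elim
    fix x assume x: "AE y in lborel. p y - p x = slope x y" "p x = q x"
    have "(\<lambda>y. q y - q x) = slope x"
    proof (rule AE_eq_continuous_imp_eq)
      show "AE y in lborel. q y - q x = slope x y" using x(1) pq by eventually_elim (simp add: x(2))
    qed (intro continuous_intros cq slope_continuous)+
    then show "\<forall>y. q y - q x = slope x y" by metis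
  qed
  have inc: "q y - q x = slope x y" for x y
  proof -
    have "(\<lambda>x. q y - q x) = (\<lambda>x. slope x y)"
    proof (rule AE_eq_continuous_imp_eq)
      show "AE x in lborel. q y - q x = slope x y" using inc1 by eventually_elim simp
    qed (intro continuous_intros cq slope_continuous)+
    then show ?thesis by metis
  qed
  have "GDERIV q x :> Phi V \<nu> x" for x
    unfolding gderiv_def has_derivative_at_alt
  proof (intro conjI allI impI)
    show "bounded_linear (\<lambda>h. h \<bullet> Phi V \<nu> x)" by (rule bounded_linear_inner_left)
    fix e :: real assume e: "e > 0"
    have "isCont (Phi V \<nu>) x" using Phi_cont by (simp add: continuous_on_eq_continuous_at)
    then obtain d where d: "d > 0" "\<And>y. norm (y - x) < d \<Longrightarrow> norm (Phi V \<nu> y - Phi V \<nu> x) < e"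
      using e unfolding continuous_at_eps_delta dist_norm by metis
    have "norm (q y - q x - (y - x) \<bullet> Phi V \<nu> x) \<le> e * norm (y - x)" if y: "norm (y - x) < d" for y
    proof -
      let ?f = "\<lambda>t. (y - x) \<bullet> Phi V \<nu> (x + t *\<^sub>R (y - x))"
      have c: "continuous_on {0..1} ?f"
        by (intro continuous_intros continuous_on_compose2[OF Phi_cont]) auto
      have I: "((\<lambda>t. ?f t - (y - x) \<bullet> Phi V \<nu> x) has_integral (slope x y - (y - x) \<bullet> Phi V \<nu> x)) {0..1}"
        unfolding slope_def
        using has_integral_const_real[of "(y - x) \<bullet> Phi V \<nu> x" 0 1]
        by (intro has_integral_diff integrable_integral integrable_continuous_interval c) simp
      have "norm (slope x y - (y - x) \<bullet> Phi V \<nu> x) \<le> (e * norm (y - x)) * measure lborel {0..1::real}"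
      proof (rule has_integral_bound_real[OF _ finite.emptyI I])
        show "0 \<le> e * norm (y - x)" using e by simp
        show "norm (?f t - (y - x) \<bullet> Phi V \<nu> x) \<le> e * norm (y - x)" if t: "t \<in> {0..1} - {}" for t
        proof -
          have "norm (x + t *\<^sub>R (y - x) - x) \<le> 1 * norm (y - x)" using t by (auto intro!: mult_left_le_one_le)
          then have "norm (Phi V \<nu> (x + t *\<^sub>R (y - x)) - Phi V \<nu> x) < e" using y by (intro d(2)) linarith
          then have "norm (y - x) * norm (Phi V \<nu> (x + t *\<^sub>R (y - x)) - Phi V \<nu> x) \<le> norm (y - x) * e"
            by (intro mult_left_mono) auto
          then have "\<bar>(y - x) \<bullet> (Phi V \<nu> (x + t *\<^sub>R (y - x)) - Phi V \<nu> x)\<bar> \<le> norm (y - x) * e"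
            using Cauchy_Schwarz_ineq2 order_trans by blast
          then show "norm (?f t - (y - x) \<bullet> Phi V \<nu> x) \<le> e * norm (y - x)"
            by (simp add: inner_diff_right mult.commute)
        qed
      qed
      then show ?thesis by (simp add: inc)
    qed
    then show "\<exists>d>0. \<forall>y. norm (y - x) < d \<longrightarrow> norm (q y - q x - (y - x) \<bullet> Phi V \<nu> x) \<le> e * norm (y - x)"
      using d(1) by blast
  qed
  note C1 = C1_I[OF this Phi_cont]
  have "p_trunc n x \<le> q x" for n x
  proof -
    have "(\<lambda>x. max (p_trunc n x) (q x)) = q"
    proof (rule AE_eq_continuous_imp_eq)
      show "AE x in lborel. max (p_trunc n x) (q x) = q x"
        using pq by eventually_elim (metis max.absorb2 p_trunc_le)
    qed (intro continuous_intros cq trunc_continuous)+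
    then show ?thesis by (metis max.cobounded1)
  qed
  then have "p x \<le> q x" for x using LIMSEQ_le_const2[OF p_trunc_limit] by blast
  then have "q x > 0" for x using p_pos less_le_trans by blast
  then show thesis using that C1 pq by blast
qed

lemma convolution_eq_density:
  assumes mu: "prob_space (gibbs V)"
  shows "distr (gibbs V \<Otimes>\<^sub>M \<nu>) borel (\<lambda>(x, z). x + z) = density lborel (\<lambda>x. ennreal (p x))"
    (is "?D = _")
proof (rule measure_eqI)
  interpret mu: prob_space "gibbs V" by fact
  interpret P: pair_sigma_finite "lborel :: 'a measure" \<nu> ..
  have [measurable_cong]: "sets (gibbs V) = sets borel" by (simp add: gibbs_def)
  fix A assume "A \<in> sets ?D"
  then have [measurable]: "A \<in> sets borel" by simp
  have "emeasure ?D A = (\<integral>\<^sup>+x. indicator A x \<partial>?D)" by simp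
  also have "\<dots> = (\<integral>\<^sup>+x. \<integral>\<^sup>+z. indicator A (x + z) \<partial>\<nu> \<partial>gibbs V)"
    by (simp add: nn_integral_distr nu.nn_integral_fst[symmetric] del: nn_integral_indicator)
  also have "\<dots> = (\<integral>\<^sup>+x. \<integral>\<^sup>+z. ennreal (u x) * indicator A (x + z) \<partial>\<nu> \<partial>lborel)"
    unfolding gibbs_def by (subst nn_integral_density) (auto simp: nn_integral_cmult)
  also have "\<dots> = (\<integral>\<^sup>+z. \<integral>\<^sup>+x. ennreal (u x) * indicator A (x + z) \<partial>lborel \<partial>\<nu>)"
    by (intro P.Fubini'[symmetric]) measurable
  also have "\<dots> = (\<integral>\<^sup>+z. \<integral>\<^sup>+x. ennreal (u (x - z)) * indicator A x \<partial>lborel \<partial>\<nu>)"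
  proof (rule nn_integral_cong)
    fix z
    have "(\<integral>\<^sup>+x. ennreal (u (x - z)) * indicator A x \<partial>lborel)
        = (\<integral>\<^sup>+x. ennreal (u (x - z)) * indicator A x \<partial>distr lborel borel ((+) z))"
      by (simp add: lborel_distr_plus)
    also have "\<dots> = (\<integral>\<^sup>+x. ennreal (u x) * indicator A (x + z) \<partial>lborel)"
      by (subst nn_integral_distr) (auto simp: add.commute)
    finally show "(\<integral>\<^sup>+x. ennreal (u x) * indicator A (x + z) \<partial>lborel)
        = (\<integral>\<^sup>+x. ennreal (u (x - z)) * indicator A x \<partial>lborel)" by simp
  qed
  also have "\<dots> = (\<integral>\<^sup>+x. \<integral>\<^sup>+z. ennreal (u (x - z)) * indicator A x \<partial>\<nu> \<partial>lborel)"
    by (intro P.Fubini') measurable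
  also have "\<dots> = (\<integral>\<^sup>+x. ennreal (p x) * indicator A x \<partial>lborel)"
  proof (rule nn_integral_cong)
    fix x
    have "(\<integral>\<^sup>+z. ennreal (u (x - z)) \<partial>\<nu>) = ennreal (p x)"
      unfolding p_conv_def by (intro nn_integral_eq_integral p_finite) auto
    then show "(\<integral>\<^sup>+z. ennreal (u (x - z)) * indicator A x \<partial>\<nu>) = ennreal (p x) * indicator A x"
      by (subst nn_integral_multc) auto
  qed
  also have "\<dots> = emeasure (density lborel (\<lambda>x. ennreal (p x))) A"
    by (subst emeasure_density) auto
  finally show "emeasure ?D A = emeasure (density lborel (\<lambda>x. ennreal (p x))) A" .
qed simp

text \<open>On a ball, Lebesgue measure is bounded by a multiple of \<open>gibbs V\<close>.\<close>

lemma rate_locally_integrable: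
  assumes mu: "prob_space (gibbs V)" and k: "k > 0"
    and moment: "(\<integral>\<^sup>+x. ennreal (exp (k * (drift x)\<^sup>2)) \<partial>gibbs V) < \<infinity>"
  shows "(\<integral>\<^sup>+x\<in>ball 0 r. ennreal (rate x) \<partial>lborel) < \<infinity>"
proof -
  interpret mu: prob_space "gibbs V" by fact
  let ?B = "ball (0::'a) r"
  have [measurable]: "?B \<in> sets borel" by simp
  obtain a where a: "\<And>x. norm x \<le> r \<Longrightarrow> norm (grad V x) \<le> a"
    using continuous_bounded_cball[OF C1_D(2)[OF V]] by blast
  obtain b where b: "\<And>x. norm x \<le> r \<Longrightarrow> \<bar>V x\<bar> \<le> b"
    using continuous_bounded_cball[OF C1_D(3)[OF V]] unfolding real_norm_def by blast
  have vol: "emeasure lborel ?B < \<infinity>" by (rule emeasure_bounded_finite) simp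
  have "(\<integral>\<^sup>+x\<in>?B. ennreal (norm (grad V x)) \<partial>lborel) \<le> (\<integral>\<^sup>+x. ennreal a * indicator ?B x \<partial>lborel)"
    using a by (intro nn_integral_mono) (auto simp: indicator_def ennreal_leI)
  also have "\<dots> < \<infinity>" using vol by (simp add: nn_integral_cmult_indicator ennreal_mult_less_top)
  finally have 1: "(\<integral>\<^sup>+x\<in>?B. ennreal (norm (grad V x)) \<partial>lborel) < \<infinity>" .
  have "(\<integral>\<^sup>+x\<in>?B. ennreal (drift x) \<partial>lborel) \<le> (\<integral>\<^sup>+x. ennreal (exp b) * (ennreal (u x) * ennreal (1 + 1 / k * exp (k * (drift x)\<^sup>2))) \<partial>lborel)"
  proof (intro nn_integral_mono)
    fix x :: 'a
    show "ennreal (drift x) * indicator ?B x \<le> ennreal (exp b) * (ennreal (u x) * ennreal (1 + 1 / k * exp (k * (drift x)\<^sup>2)))"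
    proof (cases "x \<in> ?B")
      case True
      then have "V x \<le> b" using b[of x] by simp
      then have "1 \<le> exp b * u x" by (simp flip: exp_add)
      moreover have "drift x \<le> 1 + 1 / k * exp (k * (drift x)\<^sup>2)"
      proof -
        have "k * (drift x)\<^sup>2 \<le> exp (k * (drift x)\<^sup>2)" using exp_ge_add_one_self[of "k * (drift x)\<^sup>2"] by linarith
        then have "(drift x)\<^sup>2 \<le> 1 / k * exp (k * (drift x)\<^sup>2)" using k by (simp add: field_simps)
        moreover have "drift x \<le> 1 + (drift x)\<^sup>2"
          using zero_le_power2[of "drift x - 1/2"] by (simp add: power2_diff field_simps)
        ultimately show ?thesis by linarith
      qed
      ultimately have "1 * drift x \<le> (exp b * u x) * (1 + 1 / k * exp (k * (drift x)\<^sup>2))"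
        by (intro mult_mono) (auto simp: drift_nonneg)
      then have "ennreal (drift x) \<le> ennreal ((exp b * u x) * (1 + 1 / k * exp (k * (drift x)\<^sup>2)))"
        by (intro ennreal_leI) simp
      then show ?thesis using True k by (simp add: ennreal_mult mult.assoc)
    qed simp
  qed
  also have "\<dots> = ennreal (exp b) * (\<integral>\<^sup>+x. ennreal (1 + 1 / k * exp (k * (drift x)\<^sup>2)) \<partial>gibbs V)"
    unfolding gibbs_def by (subst nn_integral_cmult) (auto simp: nn_integral_density)
  also have "(\<integral>\<^sup>+x. ennreal (1 + 1 / k * exp (k * (drift x)\<^sup>2)) \<partial>gibbs V)
      = 1 + ennreal (1 / k) * (\<integral>\<^sup>+x. ennreal (exp (k * (drift x)\<^sup>2)) \<partial>gibbs V)"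
  proof -
    have m: "drift \<in> borel_measurable (gibbs V)" by (simp add: gibbs_def)
    have "(\<integral>\<^sup>+x. ennreal (1 + 1 / k * exp (k * (drift x)\<^sup>2)) \<partial>gibbs V)
      = (\<integral>\<^sup>+x. 1 + ennreal (1 / k) * ennreal (exp (k * (drift x)\<^sup>2)) \<partial>gibbs V)"
      using k by (intro nn_integral_cong) (simp add: ennreal_plus ennreal_mult[symmetric])
    also have "\<dots> = 1 + ennreal (1 / k) * (\<integral>\<^sup>+x. ennreal (exp (k * (drift x)\<^sup>2)) \<partial>gibbs V)"
      using m by (subst nn_integral_add) (auto simp: nn_integral_cmult mu.emeasure_space_1)
    finally show ?thesis .
  qed
  also have "ennreal (exp b) * \<dots> < \<infinity>" using moment by (simp add: ennreal_mult_less_top)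
  finally have 2: "(\<integral>\<^sup>+x\<in>?B. ennreal (drift x) \<partial>lborel) < \<infinity>" .
  have "(\<integral>\<^sup>+x\<in>?B. ennreal (rate x) \<partial>lborel) = (\<integral>\<^sup>+x. ennreal (drift x) * indicator ?B x + ennreal (norm (grad V x)) * indicator ?B x \<partial>lborel)"
    unfolding rate_def by (intro nn_integral_cong) (auto simp: ennreal_plus drift_nonneg indicator_def)
  also have "\<dots> = (\<integral>\<^sup>+x\<in>?B. ennreal (drift x) \<partial>lborel) + (\<integral>\<^sup>+x\<in>?B. ennreal (norm (grad V x)) \<partial>lborel)"
    by (rule nn_integral_add) auto
  finally show ?thesis using 1 2 by simp
qed

end

section \<open>The log-Sobolev inequality for the convolution\<close>

theorem theorem2p1:
  fixes V :: "real ^ 'd \<Rightarrow> real" and \<nu> :: "(real ^ 'd) measure" and C \<delta> :: real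
  assumes V_C1: "V \<in> C1"
    and mu_prob: "prob_space (gibbs V)"
    and nu_prob: "prob_space \<nu>"
    and nu_borel: "sets \<nu> = sets borel"
    and C_pos: "C > 0"
    and mu_LSI: "log_sobolev (gibbs V) C"
    and p_finite: "\<And>x. integrable \<nu> (\<lambda>z. exp (- V (x - z)))"
    and Phi_defined: "\<And>x. integrable \<nu> (\<lambda>z. grad (\<lambda>y. exp (- V y)) (x - z))"
    and Phi_cont: "continuous_on UNIV (Phi V \<nu>)"
    and delta: "\<delta> > 1"
    and exp_moment:
      "(\<integral>\<^sup>+x. ennreal (exp (\<delta> * C / 4 *
          (\<integral>z. norm (grad V x - grad V (x - z)) \<partial>nu_at V \<nu> x)\<^sup>2)) \<partial>gibbs V) < \<infinity>"
  shows "\<exists>C'>0. log_sobolev (gibbs V \<star> \<nu>) C'"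
proof -
  interpret G: gibbs_convolution V \<nu>
    by (rule gibbs_convolution.intro[OF V_C1 nu_prob nu_borel p_finite Phi_defined Phi_cont])
  define k where "k = \<delta> * C / 4"
  have k: "k > 0" "4 * k > C" using C_pos delta by (simp_all add: k_def)
  have moment: "(\<integral>\<^sup>+x. ennreal (exp (k * (G.drift x)\<^sup>2)) \<partial>gibbs V) < \<infinity>"
    using exp_moment by (simp add: k_def G.drift_def)
  obtain q where q: "q \<in> C1" "grad q = Phi V \<nu>" "\<And>x. q x > 0" "AE x in lborel. G.p x = q x"
    using G.C1_density[OF G.rate_locally_integrable[OF mu_prob k(1) moment]] by blast
  note [measurable] = C1_D(5)[OF q(1)]
  define W where "W x = V x + ln (q x)" for x
  have lnq: "(\<lambda>x. ln (q x)) \<in> C1" "grad (\<lambda>x. ln (q x)) = (\<lambda>x. (1 / q x) *\<^sub>R Phi V \<nu> x)"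
  proof -
    have d: "DERIV ln (q x) :> 1 / q x" for x using q(3)[of x] by (rule DERIV_ln_divide)
    have c: "continuous_on (range q) (\<lambda>s. 1 / s)"
      using q(3) by (intro continuous_intros) (auto simp: less_imp_neq[THEN not_sym])
    show "(\<lambda>x. ln (q x)) \<in> C1" "grad (\<lambda>x. ln (q x)) = (\<lambda>x. (1 / q x) *\<^sub>R Phi V \<nu> x)"
      using C1_compose[where f=q and g=ln and g'="\<lambda>s. 1 / s", OF q(1) d c] unfolding q(2) by blast+
  qed
  have W: "W \<in> C1" "grad W = (\<lambda>x. grad V x + (1 / q x) *\<^sub>R Phi V \<nu> x)"
    unfolding W_def[abs_def] using C1_add[OF V_C1 lnq(1)] by (simp_all add: lnq(2))
  have gradW: "AE x in lborel. norm (grad W x) \<le> G.drift x"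
    using q(4)
  proof eventually_elim
    fix x assume x: "G.p x = q x"
    have "grad W x = (1 / q x) *\<^sub>R (Phi V \<nu> x + q x *\<^sub>R grad V x)"
      using q(3)[of x] by (simp add: W algebra_simps)
    then have "norm (grad W x) = norm (Phi V \<nu> x + G.p x *\<^sub>R grad V x) / q x"
      using q(3)[of x] by (simp add: x)
    also have "\<dots> \<le> G.drift x * q x / q x"
      using G.norm_Phi_le[of x] q(3)[of x] by (intro divide_right_mono) (simp_all add: x)
    finally show "norm (grad W x) \<le> G.drift x" using q(3)[of x] by simp
  qed
  have [measurable]: "W \<in> borel_measurable borel" "grad W \<in> borel_measurable borel"
    by (rule C1_D[OF W(1)])+
  have conv: "(gibbs V \<star> \<nu>) = density lborel (\<lambda>x. ennreal (q x))"
  proof -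
    have "(gibbs V \<star> \<nu>) = density lborel (\<lambda>x. ennreal (G.p x))"
      unfolding convolution_def by (rule G.convolution_eq_density[OF mu_prob])
    also have "\<dots> = density lborel (\<lambda>x. ennreal (q x))"
      using q(4) by (intro density_cong) auto
    finally show ?thesis .
  qed
  have weight: "density (gibbs V) (\<lambda>x. ennreal (exp (W x))) = (gibbs V \<star> \<nu>)"
  proof -
    have "ennreal (exp (- V x)) * ennreal (exp (W x)) = ennreal (q x)" for x
      using q(3)[of x] by (simp add: W_def exp_add exp_minus ennreal_mult[symmetric])
    then show ?thesis unfolding conv unfolding gibbs_def by (subst density_density_eq) simp_all
  qed
  interpret mu: prob_space "gibbs V" by (rule mu_prob)
  interpret pair_prob_space "gibbs V" \<nu> ..
  have prob: "prob_space (gibbs V \<star> \<nu>)"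
    unfolding convolution_def
    by (rule prob_space_distr) (simp add: gibbs_def nu_borel cong: measurable_cong_sets)
  have sets_mu: "sets (gibbs V) = sets borel" by (simp add: gibbs_def)
  interpret W: log_sobolev_weight "gibbs V" C k W
  proof (rule log_sobolev_weight.intro)
    show "integrable (gibbs V) (\<lambda>x. exp (k * (norm (grad W x))\<^sup>2))"
    proof (rule integrableI_nonneg)
      show "(\<lambda>x. exp (k * (norm (grad W x))\<^sup>2)) \<in> borel_measurable (gibbs V)"
        by (simp add: gibbs_def)
      have "AE x in gibbs V. norm (grad W x) \<le> G.drift x"
        unfolding gibbs_def using gradW by (subst AE_density) auto
      then have "(\<integral>\<^sup>+x. ennreal (exp (k * (norm (grad W x))\<^sup>2)) \<partial>gibbs V)
          \<le> (\<integral>\<^sup>+x. ennreal (exp (k * (G.drift x)\<^sup>2)) \<partial>gibbs V)"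
      proof (intro nn_integral_mono_AE, eventually_elim)
        fix x assume "norm (grad W x) \<le> G.drift x"
        then show "ennreal (exp (k * (norm (grad W x))\<^sup>2)) \<le> ennreal (exp (k * (G.drift x)\<^sup>2))"
          using k by (auto intro!: ennreal_leI mult_left_mono power_mono)
      qed
      then show "(\<integral>\<^sup>+x. ennreal (exp (k * (norm (grad W x))\<^sup>2)) \<partial>gibbs V) < \<infinity>"
        using moment by (rule le_less_trans)
    qed simp
  qed (use mu_prob sets_mu mu_LSI C_pos W(1) k(2) weight prob in simp_all)
  obtain A B where AB: "A \<ge> 0" "B \<ge> 0" and defective: "\<forall>f\<in>C1b. ent (gibbs V \<star> \<nu>) (\<lambda>x. (f x)\<^sup>2)
      \<le> A * (\<integral>x. (norm (grad f x))\<^sup>2 \<partial>(gibbs V \<star> \<nu>)) + B * (\<integral>x. (f x)\<^sup>2 \<partial>(gibbs V \<star> \<nu>))"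
    using W.defective_log_sobolev unfolding weight by (elim exE conjE)
  have fin: "finite_measure (density lborel (\<lambda>x. ennreal (q x)))"
    using prob unfolding conv by (rule prob_space.finite_measure)
  show ?thesis
  proof (rule tight_log_sobolev[OF prob _ AB])
    show "ent (gibbs V \<star> \<nu>) (\<lambda>x. (f x)\<^sup>2) \<le> A * (\<integral>x. (norm (grad f x))\<^sup>2 \<partial>(gibbs V \<star> \<nu>))
        + B * (\<integral>x. (f x)\<^sup>2 \<partial>(gibbs V \<star> \<nu>))" if "f \<in> C1b" for f
      using defective that by blast
    show "\<exists>c\<ge>0. \<forall>f\<in>C1b. \<exists>a. (\<integral>x. (f x - a)\<^sup>2 * indicator (ball 0 (real n)) x \<partial>(gibbs V \<star> \<nu>))
        \<le> c * (\<integral>x. (norm (grad f x))\<^sup>2 \<partial>(gibbs V \<star> \<nu>))" for n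
      unfolding conv by (rule local_poincare[OF C1_D(3)[OF q(1)] q(3) fin])
  qed simp
qed

end
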